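(* The Airy line ensemble $\mathcal{A}$ is ergodic with respect to horizontal shifts. That is, if $\mathbb{P}$ denotes the law of $\mathcal{A}$ on $(X,\mathcal{C})$, then for every $A\in\mathcal{C}$ such that $\theta_sA=A$ for all $s\in\mathbb{R}$, one has $\mathbb{P}[A]\in\{0,1\}$.
   Context: Let $\mathbb{N}=\{1,2,\dots\}$. Let $X$ be the set of continuous functions $f:\mathbb{N}\times\mathbb{R}\to\mathbb{R}$ with the topology of uniform convergence on compact subsets of $\mathbb{N}\times\mathbb{R}$, and let $\mathcal{C}$ be its Borel $\sigma$-field. An $\mathbb{N}\times\mathbb{R}$-indexed line ensemble is a random variable $\mathcal{L}$ with values in $(X,\mathcal{C})$; write $\mathcal{L}_i(x)=\mathcal{L}(i,x)$. Airy line ensemble: it is the (unique in law, known to exist) $\mathbb{N}\times\mathbb{R}$-indexed line ensemble $\mathcal{A}$, with lines ordered $\mathcal{A}_1(t)>\mathcal{A}_2(t)>\cdots$, such that for every $n\ge 1$ and every finite set $I=\{t_1,\dots,t_n\}\subset\mathbb{R}$, the point process $\{(t,\mathcal{A}_i(t)): i\in\mathbb{N},\,t\in I\}$ on $I\times\mathbb{R}$ is determinantal (with respect to counting measure times Lebesgue measure) with correlation kernel the extended Airy$_2$ kernel $$K^{\rm ext}_2(s,x;t,y)=\begin{cases}\int_0^\infty e^{-\lambda(s-t)}\,\mathrm{Ai}(x+\lambda)\mathrm{Ai}(y+\lambda)\,d\lambda & \text{if } s\ge t,\\[2pt] -\int_{-\infty}^0 e^{-\lambda(s-t)}\,\mathrm{Ai}(x+\lambda)\mathrm{Ai}(y+\lambda)\,d\lambda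 & \text{if } s<t,\end{cases}$$ where $\mathrm{Ai}$ is the Airy function. Horizontal shifts: for $s\in\mathbb{R}$, $\theta_s:X\to X$ is $(\theta_sf)(i,x)=f(i,x+s)$, and $\theta_sA=\{\theta_s\omega:\omega\in A\}$ for $A\in\mathcal{C}$. The law of $\mathcal{A}$ is invariant under every $\theta_s$ (immediate from the kernel). *)

theory Defs
  imports "HOL-Probability.Probability" "Jordan_Normal_Form.Determinant"
begin

section \<open>Line ensembles indexed by the positive integers and the real line\<close>

abbreviation index_space :: "(nat \<times> real) set" where
  "index_space \<equiv> {1..} \<times> UNIV"

text \<open>The type \<^typ>\<open>nat\<close> contains 0, so a function on \<^term>\<open>index_space\<close> is represented by its
  extensional extension to \<^typ>\<open>nat \<times> real\<close>.\<close>

definition ensemble_carrier :: "(nat \<times> real \<Rightarrow> real) set" where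
  "ensemble_carrier = {f \<in> extensional index_space. continuous_on index_space f}"

text \<open>The generating sets below are open balls with respect to the supremum over a compact
  set; that they give uniform convergence on compact sets is
  \<open>limitin_ensemble_topology\<close> below.\<close>

definition ensemble_topology :: "(nat \<times> real \<Rightarrow> real) topology" where
  "ensemble_topology = topology_generated_by
     {{g \<in> ensemble_carrier. \<forall>p\<in>K. \<bar>g p - f p\<bar> < e} | f K e.
        f \<in> ensemble_carrier \<and> compact K \<and> K \<subseteq> index_space \<and> e > 0}"

definition ensemble_borel :: "(nat \<times> real \<Rightarrow> real) measure" where
  "ensemble_borel = sigma ensemble_carrier {U. openin ensemble_topology U}"

definition line_ensemble :: "'a measure \<Rightarrow> ('a \<Rightarrow> nat \<times> real \<Rightarrow> real) \<Rightarrow> bool" where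
  "line_ensemble M L \<longleftrightarrow> prob_space M \<and> L \<in> measurable M ensemble_borel"

definition hshift :: "real \<Rightarrow> (nat \<times> real \<Rightarrow> real) \<Rightarrow> (nat \<times> real \<Rightarrow> real)" where
  "hshift s f = (\<lambda>(i, x). f (i, x + s))"

section \<open>Determinantal point processes\<close>

text \<open>A (simple) point process on the measurable space underlying \<open>\<mu>\<close>, given as a random set
  of points. Local finiteness is not imposed; for a determinantal process whose kernel is
  bounded on bounded sets it holds almost surely.\<close>

definition point_process :: "'a measure \<Rightarrow> 'e measure \<Rightarrow> ('a \<Rightarrow> 'e set) \<Rightarrow> bool" where
  "point_process M \<mu> S \<longleftrightarrow>
     (\<forall>\<omega>\<in>space M. S \<omega> \<subseteq> space \<mu>) \<and>
     (\<forall>B\<in>sets \<mu>. (\<lambda>\<omega>. emeasure (count_space UNIV) (S \<omega> \<inter> B)) \<in> borel_measurable M)"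

text \<open>The number of \<open>k\<close>-tuples of pairwise distinct points of \<open>S\<close> that lie in \<open>B\<close>
  (possibly infinite).\<close>

definition tuple_count :: "nat \<Rightarrow> 'e set \<Rightarrow> (nat \<Rightarrow> 'e) set \<Rightarrow> ennreal" where
  "tuple_count k S B = emeasure (count_space UNIV) {x \<in> B. inj_on x {..<k} \<and> x ` {..<k} \<subseteq> S}"

text \<open>\<open>\<rho>\<close> is the \<open>k\<close>-point correlation function with respect to \<open>\<mu>\<close>: the density of the
  \<open>k\<close>-th factorial moment measure with respect to the \<open>k\<close>-fold product of \<open>\<mu>\<close>. The
  non-negativity is stated because \<^const>\<open>ennreal\<close> truncates negative values.\<close>

definition correlation_function ::
  "'a measure \<Rightarrow> 'e measure \<Rightarrow> ('a \<Rightarrow> 'e set) \<Rightarrow> nat \<Rightarrow> ((nat \<Rightarrow> 'e) \<Rightarrow> real) \<Rightarrow> bool" where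
  "correlation_function M \<mu> S k \<rho> \<longleftrightarrow>
     \<rho> \<in> borel_measurable (Pi\<^sub>M {..<k} (\<lambda>_. \<mu>)) \<and>
     (AE x in Pi\<^sub>M {..<k} (\<lambda>_. \<mu>). 0 \<le> \<rho> x) \<and>
     (\<forall>B \<in> sets (Pi\<^sub>M {..<k} (\<lambda>_. \<mu>)).
        (\<integral>\<^sup>+\<omega>. tuple_count k (S \<omega>) B \<partial>M) = (\<integral>\<^sup>+x\<in>B. ennreal (\<rho> x) \<partial>Pi\<^sub>M {..<k} (\<lambda>_. \<mu>)))"

definition determinantal ::
  "'a measure \<Rightarrow> 'e measure \<Rightarrow> ('e \<Rightarrow> 'e \<Rightarrow> real) \<Rightarrow> ('a \<Rightarrow> 'e set) \<Rightarrow> bool" where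
  "determinantal M \<mu> K S \<longleftrightarrow> point_process M \<mu> S \<and>
     (\<forall>k\<ge>1. correlation_function M \<mu> S k
        (\<lambda>x. Determinant.det (Matrix.mat k k (\<lambda>(i, j). K (x i) (x j)))))"

section \<open>The Airy line ensemble\<close>

text \<open>The Airy function on the real line; the integral over the half-line converges only
  conditionally, so it is an improper integral.\<close>

definition Ai :: "real \<Rightarrow> real" where
  "Ai x = (1 / pi) * Lim at_top (\<lambda>R. integral {0..R} (\<lambda>t. cos (t ^ 3 / 3 + x * t)))"

fun airy_ext_kernel :: "real \<times> real \<Rightarrow> real \<times> real \<Rightarrow> real" where
  "airy_ext_kernel (s, x) (t, y) =
     (if s \<ge> t then LBINT l:{0..}. exp (- l * (s - t)) * Ai (x + l) * Ai (y + l)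
      else - (LBINT l:{..0}. exp (- l * (s - t)) * Ai (x + l) * Ai (y + l)))"

definition airy_line_ensemble :: "'a measure \<Rightarrow> ('a \<Rightarrow> nat \<times> real \<Rightarrow> real) \<Rightarrow> bool" where
  "airy_line_ensemble M L \<longleftrightarrow> line_ensemble M L \<and>
     (AE \<omega> in M. \<forall>t. \<forall>i\<ge>1. L \<omega> (i, t) > L \<omega> (i + 1, t)) \<and>
     (\<forall>I. finite I \<and> I \<noteq> {} \<longrightarrow>
        determinantal M (count_space I \<Otimes>\<^sub>M lborel) airy_ext_kernel
          (\<lambda>\<omega>. {(t, L \<omega> (i, t)) | t i. t \<in> I \<and> i \<ge> 1}))"

section \<open>Basic facts\<close>

lemma topspace_ensemble_topology [simp]: "topspace ensemble_topology = ensemble_carrier"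
proof -
  have "ensemble_carrier \<subseteq> \<Union>{{g \<in> ensemble_carrier. \<forall>p\<in>K. \<bar>g p - f p\<bar> < e} | f K e.
        f \<in> ensemble_carrier \<and> compact K \<and> K \<subseteq> index_space \<and> e > 0}" (is "_ \<subseteq> \<Union>?B")
  proof
    fix f assume f: "f \<in> ensemble_carrier"
    have "{g \<in> ensemble_carrier. \<forall>p\<in>{}. \<bar>g p - f p\<bar> < 1} \<in> ?B"
      using f by (intro CollectI exI[of _ f] exI[of _ "{}"] exI[of _ 1]) auto
    then show "f \<in> \<Union>?B" using f by blast
  qed
  then show ?thesis
    unfolding ensemble_topology_def topology_generated_by_topspace by blast
qed

lemma space_ensemble_borel [simp]: "space ensemble_borel = ensemble_carrier"
  unfolding ensemble_borel_def
  by (rule space_measure_of) (use openin_subset in force)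

lemma sets_ensemble_borel:
  "sets ensemble_borel = sigma_sets ensemble_carrier {U. openin ensemble_topology U}"
  unfolding ensemble_borel_def
  by (rule sets_measure_of) (use openin_subset in force)

lemma hshift_in_carrier: "f \<in> ensemble_carrier \<Longrightarrow> hshift s f \<in> ensemble_carrier"
proof -
  assume f: "f \<in> ensemble_carrier"
  have "continuous_on index_space (f \<circ> (\<lambda>p. (fst p, snd p + s)))"
    by (rule continuous_on_compose)
      (use f in \<open>auto simp: ensemble_carrier_def intro!: continuous_intros
        elim!: continuous_on_subset\<close>)
  then show ?thesis
    using f by (auto simp: ensemble_carrier_def hshift_def extensional_def o_def case_prod_beta)
qed

lemma limitin_ensemble_topology:
  "limitin ensemble_topology F f net \<longleftrightarrow>
     f \<in> ensemble_carrier \<and> (\<forall>\<^sub>F n in net. F n \<in> ensemble_carrier) \<and>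
     (\<forall>K. compact K \<and> K \<subseteq> index_space \<longrightarrow> uniform_limit K F f net)"
  (is "?lhs \<longleftrightarrow> ?rhs")
proof
  assume lim: ?lhs
  then have f: "f \<in> ensemble_carrier"
    by (simp add: limitin_def)
  have "\<forall>\<^sub>F n in net. F n \<in> ensemble_carrier"
    using lim openin_topspace[of ensemble_topology] f unfolding limitin_def
    by (metis topspace_ensemble_topology)
  moreover have "uniform_limit K F f net" if K: "compact K" "K \<subseteq> index_space" for K
  proof (rule uniform_limitI)
    fix e :: real assume "e > 0"
    define U where "U = {g \<in> ensemble_carrier. \<forall>p\<in>K. \<bar>g p - f p\<bar> < e}"
    have "openin ensemble_topology U"
      unfolding ensemble_topology_def U_def
      by (rule topology_generated_by_Basis) (use f K \<open>e > 0\<close> in blast)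
    moreover have "f \<in> U" using f \<open>e > 0\<close> by (simp add: U_def)
    ultimately have "\<forall>\<^sub>F n in net. F n \<in> U"
      using lim by (simp add: limitin_def)
    then show "\<forall>\<^sub>F n in net. \<forall>x\<in>K. dist (F n x) (f x) < e"
      by eventually_elim (auto simp: U_def dist_real_def)
  qed
  ultimately show ?rhs using f by blast
next
  assume rhs: ?rhs
  then have f: "f \<in> ensemble_carrier" by blast
  have "f \<in> U \<longrightarrow> (\<forall>\<^sub>F n in net. F n \<in> U)"
    if "generate_topology_on {{g \<in> ensemble_carrier. \<forall>p\<in>K. \<bar>g p - h p\<bar> < e} | h K e.
        h \<in> ensemble_carrier \<and> compact K \<and> K \<subseteq> index_space \<and> e > 0} U" for U
    using that
  proof (induction rule: generate_topology_on.induct)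
    case Empty
    then show ?case by simp
  next
    case (Int a b)
    then show ?case by (auto intro: eventually_conj)
  next
    case (UN \<U>)
    show ?case
    proof
      assume "f \<in> \<Union>\<U>"
      then obtain X where X: "X \<in> \<U>" "f \<in> X" by blast
      then have "\<forall>\<^sub>F n in net. F n \<in> X" using UN by blast
      then show "\<forall>\<^sub>F n in net. F n \<in> \<Union>\<U>"
        by eventually_elim (use X in blast)
    qed
  next
    case (Basis U)
    then obtain h K e where U: "U = {g \<in> ensemble_carrier. \<forall>p\<in>K. \<bar>g p - h p\<bar> < e}"
      and h: "h \<in> ensemble_carrier" and K: "compact K" "K \<subseteq> index_space" and e: "e > 0"
      by blast
    show ?case
    proof
      assume fU: "f \<in> U"
      have cont: "continuous_on K (\<lambda>p. \<bar>f p - h p\<bar>)"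
        using f h K(2) unfolding ensemble_carrier_def
        by (auto intro!: continuous_intros elim: continuous_on_subset)
      obtain d where d: "d > 0" "\<And>p. p \<in> K \<Longrightarrow> \<bar>f p - h p\<bar> + d \<le> e"
      proof (cases "K = {}")
        case True
        then show ?thesis using that[of 1] by simp
      next
        case False
        then obtain q where q: "q \<in> K" "\<And>p. p \<in> K \<Longrightarrow> \<bar>f p - h p\<bar> \<le> \<bar>f q - h q\<bar>"
          using continuous_attains_sup[OF K(1) False cont] by blast
        show ?thesis
        proof (rule that[of "e - \<bar>f q - h q\<bar>"])
          show "e - \<bar>f q - h q\<bar> > 0" using fU q(1) by (simp add: U)
        qed (use q(2) in force)
      qed
      have "\<forall>\<^sub>F n in net. \<forall>p\<in>K. dist (F n p) (f p) < d"
        using rhs K d(1) by (auto dest: uniform_limitD)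
      moreover have "\<forall>\<^sub>F n in net. F n \<in> ensemble_carrier" using rhs by blast
      ultimately show "\<forall>\<^sub>F n in net. F n \<in> U"
      proof eventually_elim
        case (elim n)
        have "\<bar>F n p - h p\<bar> < e" if "p \<in> K" for p
          using elim(1) d(2)[OF that] that unfolding dist_real_def by force
        then show ?case using elim(2) by (simp add: U)
      qed
    qed
  qed
  then have "\<forall>U. openin ensemble_topology U \<and> f \<in> U \<longrightarrow> (\<forall>\<^sub>F n in net. F n \<in> U)"
    unfolding ensemble_topology_def openin_topology_generated_by_iff by blast
  then show ?lhs
    unfolding limitin_def topspace_ensemble_topology using f by blast
qed

end

theory Submission
  imports Defs "HOL-Real_Asymp.Real_Asymp"
begin

text \<open>
  The reason for ergodicity is that the extended Airy kernel between two times tends to 0 as the times move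
  apart, so that the point configurations at distant times become independent. In fact the shifts are
  mixing, which is stronger.

  The correlation functions determine the expectations of polynomials in the counts
  \<open>N (t, a)\<close>, the number of points above \<open>a\<close> at time \<open>t\<close>. A product of counts is a sum of numbers of
  tuples of distinct points (\<open>card_tuples_mult\<close>), and the expected number of tuples is an integral of a
  determinant that depends only on the time differences. Expectations of such polynomials are therefore
  invariant under shifts. When one group of times is moved away, the off-diagonal blocks of the determinant
  vanish in the limit and the expectation factorises (\<open>ray_moment_append_tendsto\<close>). The
  dominating function needed here comes from elementary bounds on the Airy function, obtained by
  integrating the defining oscillatory integral by parts: it is bounded, and of order \<open>x powr (-2)\<close> at
  \<open>+\<infinity>\<close>.

  Since the lines are ordered, line \<open>i\<close> lies above \<open>a\<close> at time \<open>t\<close> exactly if \<open>N (t, a) \<ge> i\<close>. The passage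
  from polynomials to such events is a quantitative form of the method of moments. A bounded
  function of \<open>N\<close> is replaced by its Newton interpolation polynomial of degree \<open>R\<close>, which is at most
  \<open>3 ^ N\<close> whatever \<open>R\<close> is. At a single time the kernel is positive semidefinite, so Hadamard's inequality
  bounds the \<open>k\<close>-th factorial moment of \<open>N\<close> by the \<open>k\<close>-th power of its mean, and \<open>N\<close> has exponential moments
  of every order. The error of the replacement is thus of order \<open>1 / R\<close>, uniformly in the time shifts
  (\<open>exceed_approx_error\<close>), and invariance and mixing carry over from polynomials to events.

  These events generate the Borel sigma-algebra of the path space. Dynkin's argument then extends first invariance
  and then mixing to pairs of a cylinder and an arbitrary event. Applied to an invariant event
  \<open>A\<close>, mixing says that \<open>A\<close> is independent of every cylinder, hence of itself.
\<close>


section \<open>Newton interpolation of bounded functions of a count\<close>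

definition forward_diff :: "(nat \<Rightarrow> real) \<Rightarrow> nat \<Rightarrow> real" where
  "forward_diff g n = g (Suc n) - g n"

text \<open>The induction runs over all \<open>g\<close> at once: writing \<open>g (N + 1)\<close> as \<open>g N + fdiff g N\<close> and
  expanding both terms at \<open>N\<close>, the coefficients combine by Pascal's rule.\<close>

lemma newton_expansion: "g N = (\<Sum>k\<le>N. real (N choose k) * (forward_diff ^^ k) g 0)"
proof (induction N arbitrary: g)
  case 0
  show ?case by simp
next
  case (Suc N)
  have shift: "(forward_diff ^^ k) (forward_diff g) 0 = (forward_diff ^^ Suc k) g 0" for k
    by (simp only: funpow_Suc_right o_def)
  have "g (Suc N) = g N + forward_diff g N" by (simp add: forward_diff_def)
  also have "\<dots> = (\<Sum>k\<le>N. real (N choose k) * (forward_diff ^^ k) g 0)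
      + (\<Sum>k\<le>N. real (N choose k) * (forward_diff ^^ Suc k) g 0)"
    using Suc.IH[of g] Suc.IH[of "forward_diff g"] by (simp only: shift)
  also have "(\<Sum>k\<le>N. real (N choose k) * (forward_diff ^^ k) g 0)
      = (\<Sum>k\<le>Suc N. real (N choose k) * (forward_diff ^^ k) g 0)"
    by (simp add: binomial_eq_0)
  also have "\<dots> = g 0 + (\<Sum>k\<le>N. real (N choose Suc k) * (forward_diff ^^ Suc k) g 0)"
    by (subst sum.atMost_Suc_shift) simp
  also have "g 0 + (\<Sum>k\<le>N. real (N choose Suc k) * (forward_diff ^^ Suc k) g 0)
      + (\<Sum>k\<le>N. real (N choose k) * (forward_diff ^^ Suc k) g 0)
      = g 0 + (\<Sum>k\<le>N. real (Suc N choose Suc k) * (forward_diff ^^ Suc k) g 0)"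
    by (simp add: sum.distrib[symmetric] algebra_simps del: funpow.simps)
  also have "\<dots> = (\<Sum>k\<le>Suc N. real (Suc N choose k) * (forward_diff ^^ k) g 0)"
    by (subst sum.atMost_Suc_shift[of "\<lambda>k. real (Suc N choose k) * (forward_diff ^^ k) g 0"]) simp
  finally show ?case .
qed

lemma forward_diff_iterate_bound:
  assumes "\<And>n. \<bar>g n\<bar> \<le> 1"
  shows "\<bar>(forward_diff ^^ k) g n\<bar> \<le> 2 ^ k"
proof (induction k arbitrary: n)
  case (Suc k)
  have "\<bar>(forward_diff ^^ Suc k) g n\<bar> \<le> \<bar>(forward_diff ^^ k) g (Suc n)\<bar> + \<bar>(forward_diff ^^ k) g n\<bar>"
    by (simp add: forward_diff_def)
  then show ?case using Suc[of n] Suc[of "Suc n"] by simp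
qed (use assms in simp)

text \<open>The polynomial in \<open>N\<close> that interpolates \<open>g\<close> at \<open>0, ..., R\<close>. It turns a bounded function of a
  random count into a polynomial of that count, whose expectation the correlation functions determine.\<close>

definition newton_poly :: "(nat \<Rightarrow> real) \<Rightarrow> nat \<Rightarrow> nat \<Rightarrow> real" where
  "newton_poly g R N = (\<Sum>k\<le>R. real (N choose k) * (forward_diff ^^ k) g 0)"

lemma newton_poly_exact:
  assumes "N \<le> R" shows "newton_poly g R N = g N"
proof -
  have "newton_poly g R N = (\<Sum>k\<le>N. real (N choose k) * (forward_diff ^^ k) g 0)"
    unfolding newton_poly_def
    by (rule sum.mono_neutral_right) (use assms in \<open>auto simp: binomial_eq_0\<close>)
  then show ?thesis by (simp add: newton_expansion[symmetric])
qed

text \<open>The bound is uniform in the degree \<open>R\<close>, because the coefficients grow at most like \<open>2 ^ k\<close>. This is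
  what makes exponential moments of the counts sufficient to control the interpolation error.\<close>

lemma newton_poly_bound:
  assumes "\<And>n. \<bar>g n\<bar> \<le> 1"
  shows "\<bar>newton_poly g R N\<bar> \<le> 3 ^ N"
proof -
  have "\<bar>newton_poly g R N\<bar> \<le> (\<Sum>k\<le>R. real (N choose k) * 2 ^ k)"
    unfolding newton_poly_def
    by (rule order_trans[OF sum_abs])
       (auto simp: abs_mult intro!: sum_mono mult_left_mono forward_diff_iterate_bound assms)
  also have "\<dots> \<le> (\<Sum>k\<le>max R N. real (N choose k) * 2 ^ k)"
    by (rule sum_mono2) auto
  also have "\<dots> = (\<Sum>k\<le>N. real (N choose k) * 2 ^ k)"
    by (rule sum.mono_neutral_right) (auto simp: binomial_eq_0)
  also have "\<dots> = (2 + 1) ^ N"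
    by (subst binomial_ring) simp
  finally show ?thesis by simp
qed

section \<open>Hadamard's inequality\<close>

definition psd_on :: "nat \<Rightarrow> (nat \<Rightarrow> nat \<Rightarrow> real) \<Rightarrow> bool" where
  "psd_on n a \<longleftrightarrow> (\<forall>i j. a i j = a j i) \<and>
     (\<forall>c. 0 \<le> (\<Sum>i<n. \<Sum>j<n. c i * c j * a i j))"

lemma psd_on_2x2:
  assumes "psd_on n a" "i < n" "j < n" "i \<noteq> j"
  shows "0 \<le> s\<^sup>2 * a i i + 2 * s * t * a i j + t\<^sup>2 * a j j"
proof -
  define c where "c k = (if k = i then s else if k = j then t else 0)" for k
  have row: "(\<Sum>l<n. c k * c l * a k l) = c k * (s * a k i + t * a k j)" for k
  proof -
    have "(\<Sum>l<n. c k * c l * a k l) = (\<Sum>l\<in>{i,j}. c k * c l * a k l)"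
      by (rule sum.mono_neutral_right) (use assms in \<open>auto simp: c_def\<close>)
    then show ?thesis using assms(4) by (simp add: c_def algebra_simps)
  qed
  have "0 \<le> (\<Sum>k<n. \<Sum>l<n. c k * c l * a k l)"
    using assms(1) by (simp add: psd_on_def)
  also have "\<dots> = (\<Sum>k<n. c k * (s * a k i + t * a k j))" by (simp add: row)
  also have "\<dots> = (\<Sum>k\<in>{i,j}. c k * (s * a k i + t * a k j))"
    by (rule sum.mono_neutral_right) (use assms in \<open>auto simp: c_def\<close>)
  also have "\<dots> = s\<^sup>2 * a i i + 2 * s * t * a i j + t\<^sup>2 * a j j"
    using assms(1,4) by (simp add: c_def psd_on_def algebra_simps power2_eq_square)
  finally show ?thesis .
qed

lemma psd_on_diag:
  assumes "psd_on n a" "i < n" shows "0 \<le> a i i"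
proof -
  define c where "c k = (if k = i then 1 else 0 :: real)" for k
  have "0 \<le> (\<Sum>k<n. \<Sum>l<n. c k * c l * a k l)"
    using assms(1) by (simp add: psd_on_def)
  also have "\<dots> = (\<Sum>k\<in>{i}. \<Sum>l<n. c k * c l * a k l)"
    by (rule sum.mono_neutral_right) (use assms in \<open>auto simp: c_def\<close>)
  also have "\<dots> = (\<Sum>l\<in>{i}. c i * c l * a i l)"
    by (simp, rule sum.mono_neutral_right[of _ "{i}", simplified])
       (use assms in \<open>auto simp: c_def\<close>)
  also have "\<dots> = a i i" by (simp add: c_def)
  finally show ?thesis .
qed

text \<open>Otherwise the quadratic form at \<open>s e\<^sub>i + e\<^sub>j\<close> is a non-constant affine function of \<open>s\<close>, hence negative
  somewhere.\<close>

lemma psd_on_zero_row: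
  assumes "psd_on n a" "i < n" "j < n" "a i i = 0"
  shows "a i j = 0"
proof (rule ccontr)
  assume nz: "a i j \<noteq> 0"
  with assms(4) have ij: "i \<noteq> j" by auto
  have "0 \<le> 2 * s * a i j + a j j" for s
    using psd_on_2x2[OF assms(1-3) ij, of s 1] assms(4) by simp
  from this[of "- (a j j + 1) / (2 * a i j)"] nz show False by (simp add: field_simps)
qed

text \<open>One step of block Gaussian elimination: subtracting multiples of row 0 leaves the Schur complement of
  the entry \<open>a 0 0\<close>.\<close>

lemma det_schur:
  fixes a :: "nat \<Rightarrow> nat \<Rightarrow> real"
  assumes "a 0 0 \<noteq> 0"
  shows "Determinant.det (Matrix.mat (Suc n) (Suc n) (\<lambda>(i, j). a i j)) =
    a 0 0 * Determinant.det (Matrix.mat n n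
      (\<lambda>(i, j). a (Suc i) (Suc j) - a (Suc i) 0 * a 0 (Suc j) / a 0 0))"
proof -
  define P where "P = four_block_mat (1\<^sub>m 1) (0\<^sub>m 1 n)
     (Matrix.mat n 1 (\<lambda>(i, j). a (Suc i) 0 / a 0 0)) (1\<^sub>m n)"
  define B where "B = Matrix.mat n n
     (\<lambda>(i, j). a (Suc i) (Suc j) - a (Suc i) 0 * a 0 (Suc j) / a 0 0)"
  define Q where "Q = four_block_mat (Matrix.mat 1 1 (\<lambda>_. a 0 0))
     (Matrix.mat 1 n (\<lambda>(i, j). a 0 (Suc j))) (0\<^sub>m n 1) B"
  have B: "B \<in> carrier_mat n n" by (simp add: B_def)
  have "Matrix.mat (Suc n) (Suc n) (\<lambda>(i, j). a i j) = P * Q"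
    unfolding P_def Q_def
  proof (subst mult_four_block_mat)
    show "Matrix.mat (Suc n) (Suc n) (\<lambda>(i, j). a i j) =
      four_block_mat
       (1\<^sub>m 1 * Matrix.mat 1 1 (\<lambda>_. a 0 0) + 0\<^sub>m 1 n * 0\<^sub>m n 1)
       (1\<^sub>m 1 * Matrix.mat 1 n (\<lambda>(i, j). a 0 (Suc j)) + 0\<^sub>m 1 n * B)
       (Matrix.mat n 1 (\<lambda>(i, j). a (Suc i) 0 / a 0 0) * Matrix.mat 1 1 (\<lambda>_. a 0 0) +
        1\<^sub>m n * 0\<^sub>m n 1)
       (Matrix.mat n 1 (\<lambda>(i, j). a (Suc i) 0 / a 0 0) *
        Matrix.mat 1 n (\<lambda>(i, j). a 0 (Suc j)) + 1\<^sub>m n * B)"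
      using assms B
      by (intro eq_matI) (auto simp: scalar_prod_def B_def split: nat.splits)
  qed (use B in auto)
  moreover have "Determinant.det P = 1" unfolding P_def
    by (subst det_four_block_mat_upper_right_zero[of _ 1 _ n]) auto
  moreover have "Determinant.det Q = a 0 0 * Determinant.det B" unfolding Q_def
    by (subst det_four_block_mat_lower_left_zero[of _ 1 _ n]) (use B in \<open>auto simp: det_single\<close>)
  moreover have "P \<in> carrier_mat (Suc n) (Suc n)" "Q \<in> carrier_mat (Suc n) (Suc n)"
    using four_block_carrier_mat[of "1\<^sub>m 1" 1 1 "1\<^sub>m n" n n]
      four_block_carrier_mat[of "Matrix.mat 1 1 (\<lambda>_. a 0 0)" 1 1 B n n] B
    by (simp_all add: P_def Q_def)
  ultimately show ?thesis
    using Determinant.det_mult[of P "Suc n" Q] by (simp add: B_def)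
qed

text \<open>For a vector \<open>c\<close> on the last \<open>n\<close> indices, the form of the Schur complement at \<open>c\<close> is the form of \<open>a\<close> at
  the extension of \<open>c\<close> whose entry at 0 minimises it.\<close>

lemma psd_on_schur:
  assumes "psd_on (Suc n) a" "a 0 0 > 0"
  shows "psd_on n (\<lambda>i j. a (Suc i) (Suc j) - a (Suc i) 0 * a 0 (Suc j) / a 0 0)"
  unfolding psd_on_def
proof (intro conjI allI)
  have sym: "a i j = a j i" for i j using assms(1) by (simp add: psd_on_def)
  show "a (Suc i) (Suc j) - a (Suc i) 0 * a 0 (Suc j) / a 0 0 =
        a (Suc j) (Suc i) - a (Suc j) 0 * a 0 (Suc i) / a 0 0" for i j
    using sym[of "Suc i" "Suc j"] sym[of "Suc i" 0] sym[of "Suc j" 0] by simp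
  fix c :: "nat \<Rightarrow> real"
  define u where "u = (\<Sum>i<n. c i * a (Suc i) 0)"
  define d where "d k = (case k of 0 \<Rightarrow> - u / a 0 0 | Suc i \<Rightarrow> c i)" for k
  have dS: "d (Suc i) = c i" for i by (simp add: d_def)
  have "0 \<le> (\<Sum>i<Suc n. \<Sum>j<Suc n. d i * d j * a i j)"
    using assms(1) unfolding psd_on_def by blast
  also have "\<dots> = d 0 * d 0 * a 0 0 + (\<Sum>j<n. d 0 * c j * a 0 (Suc j))
      + (\<Sum>i<n. c i * d 0 * a (Suc i) 0) + (\<Sum>i<n. \<Sum>j<n. c i * c j * a (Suc i) (Suc j))"
    by (simp add: sum.lessThan_Suc_shift dS sum.distrib del: sum.lessThan_Suc)
  also have "(\<Sum>j<n. d 0 * c j * a 0 (Suc j)) = d 0 * u"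
    by (simp add: u_def sum_distrib_left sym[of 0] mult.assoc)
  also have "(\<Sum>i<n. c i * d 0 * a (Suc i) 0) = d 0 * u"
    by (simp add: u_def sum_distrib_left mult_ac)
  also have "d 0 * d 0 * a 0 0 + d 0 * u + d 0 * u = - u * u / a 0 0"
    using assms(2) by (simp add: d_def field_simps)
  also have "- u * u / a 0 0 + (\<Sum>i<n. \<Sum>j<n. c i * c j * a (Suc i) (Suc j)) =
    (\<Sum>i<n. \<Sum>j<n. c i * c j * (a (Suc i) (Suc j) - a (Suc i) 0 * a 0 (Suc j) / a 0 0))"
  proof -
    have "u * u = (\<Sum>i<n. \<Sum>j<n. c i * c j * (a (Suc i) 0 * a 0 (Suc j)))"
      by (simp add: u_def sum_product sym[of 0] mult_ac)
    then have "u * u / a 0 0 = (\<Sum>i<n. \<Sum>j<n. c i * c j * (a (Suc i) 0 * a 0 (Suc j)) / a 0 0)"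
      by (simp add: sum_divide_distrib)
    then have "- u * u / a 0 0 = - (\<Sum>i<n. \<Sum>j<n. c i * c j * (a (Suc i) 0 * a 0 (Suc j)) / a 0 0)"
      by (simp only: mult_minus_left minus_divide_left)
    then show ?thesis
      by (simp only: right_diff_distrib sum_subtractf times_divide_eq_right)
  qed
  finally show "0 \<le> (\<Sum>i<n. \<Sum>j<n. c i * c j *
    (a (Suc i) (Suc j) - a (Suc i) 0 * a 0 (Suc j) / a 0 0))" .
qed

text \<open>Hadamard's inequality, by pivoting on the entry \<open>a 0 0\<close>: passing to the Schur complement can only
  decrease the diagonal, and if the pivot vanishes then so does its row. For the equal-time Airy kernel
  it removes the factor \<open>k!\<close> that the trivial bound on a determinant of size \<open>k\<close> has; with that factor
  the exponential moments of the counts would be finite only for small exponents.\<close>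

lemma hadamard_psd:
  assumes "psd_on n a"
  shows "0 \<le> Determinant.det (Matrix.mat n n (\<lambda>(i, j). a i j)) \<and>
    Determinant.det (Matrix.mat n n (\<lambda>(i, j). a i j)) \<le> (\<Prod>i<n. a i i)"
  using assms
proof (induction n arbitrary: a)
  case 0
  show ?case by (simp add: det_dim_zero)
next
  case (Suc n)
  let ?A = "Matrix.mat (Suc n) (Suc n) (\<lambda>(i, j). a i j)"
  let ?b = "\<lambda>i j. a (Suc i) (Suc j) - a (Suc i) 0 * a 0 (Suc j) / a 0 0"
  have sym: "a i j = a j i" for i j using Suc.prems by (simp add: psd_on_def)
  have diag: "i < Suc n \<Longrightarrow> 0 \<le> a i i" for i by (rule psd_on_diag[OF Suc.prems])
  show ?case
  proof (cases "a 0 0 = 0")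
    case True
    have "Determinant.det ?A = (\<Sum>j<Suc n. ?A $$ (0, j) * cofactor ?A 0 j)"
      by (rule laplace_expansion_row) auto
    also have "\<dots> = 0"
      by (rule sum.neutral) (use psd_on_zero_row[OF Suc.prems, of 0] True in auto)
    finally show ?thesis using diag by (auto intro!: prod_nonneg simp del: prod.lessThan_Suc)
  next
    case False
    then have pos: "a 0 0 > 0" using diag[of 0] by simp
    have det: "Determinant.det ?A = a 0 0 * Determinant.det (Matrix.mat n n (\<lambda>(i, j). ?b i j))"
      using det_schur[of a n] False by simp
    have psd: "psd_on n ?b" by (rule psd_on_schur[OF Suc.prems pos])
    note IH = Suc.IH[OF psd]
    have "(\<Prod>i<n. ?b i i) \<le> (\<Prod>i<n. a (Suc i) (Suc i))"
    proof (rule prod_mono)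
      fix i assume "i \<in> {..<n}"
      then show "0 \<le> ?b i i \<and> ?b i i \<le> a (Suc i) (Suc i)"
        using psd_on_diag[OF psd, of i] pos sym[of 0 "Suc i"] by auto
    qed
    then have "Determinant.det (Matrix.mat n n (\<lambda>(i, j). ?b i j)) \<le> (\<Prod>i<n. a (Suc i) (Suc i))"
      using IH by linarith
    then have "Determinant.det ?A \<le> a 0 0 * (\<Prod>i<n. a (Suc i) (Suc i))"
      unfolding det using pos by (intro mult_left_mono) auto
    also have "\<dots> = (\<Prod>i<Suc n. a i i)" by (rule prod.lessThan_Suc_shift[symmetric])
    finally show ?thesis unfolding det using IH pos by (simp del: prod.lessThan_Suc)
  qed
qed

section \<open>Tuples of distinct points\<close>

text \<open>The lists of distinct points of \<open>S\<close> whose \<open>i\<close>-th member lies in the \<open>i\<close>-th set of \<open>Ds\<close>: the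
  set that \<^const>\<open>tuple_count\<close> counts for a product set. Lists make extension by one point and
  concatenation easy to express.\<close>

definition tuples :: "'e set \<Rightarrow> 'e set list \<Rightarrow> 'e list set" where
  "tuples S Ds = {xs. distinct xs \<and> set xs \<subseteq> S \<and> list_all2 (\<in>) xs Ds}"

lemma tuples_Nil [simp]: "tuples S [] = {[]}"
  by (auto simp: tuples_def)

lemma tuples_Cons:
  "tuples S (C # Ds) = (\<lambda>(x, xs). x # xs) ` {(x, xs) \<in> (S \<inter> C) \<times> tuples S Ds. x \<notin> set xs}"
  by (auto simp: tuples_def list_all2_Cons2 image_iff)

lemma finite_tuples:
  assumes "\<And>D. D \<in> set Ds \<Longrightarrow> finite (S \<inter> D)"
  shows "finite (tuples S Ds)"
  using assms
proof (induction Ds)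
  case (Cons C Ds)
  have "finite ((S \<inter> C) \<times> tuples S Ds)" using Cons by simp
  then show ?case unfolding tuples_Cons
    by (intro finite_imageI) (rule finite_subset[rotated], auto)
qed simp

lemma tuples_empty_box: "{} \<in> set Ds \<Longrightarrow> tuples S Ds = {}"
  by (auto simp: tuples_def list_all2_conv_all_nth in_set_conv_nth)

lemma tuples_update_iff:
  assumes "i < length Ds"
  shows "xs \<in> tuples S (Ds[i := Ds ! i \<inter> C]) \<longleftrightarrow> xs \<in> tuples S Ds \<and> xs ! i \<in> C"
  using assms by (auto simp: tuples_def list_all2_conv_all_nth nth_list_update)

text \<open>A point of \<open>C\<close> and a tuple either form a longer tuple, or the point is the \<open>i\<close>-th member of the tuple
  for exactly one \<open>i\<close>. By iteration, every product of counts is a sum of tuple numbers, even when the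
  counted sets overlap or are repeated.\<close>

lemma card_tuples_mult:
  assumes fin: "\<And>D. D \<in> set Ds \<Longrightarrow> finite (S \<inter> D)" and finC: "finite (S \<inter> C)"
  shows "card (S \<inter> C) * card (tuples S Ds) =
    card (tuples S (C # Ds)) + (\<Sum>i<length Ds. card (tuples S (Ds[i := Ds ! i \<inter> C])))"
proof -
  let ?Z = "(S \<inter> C) \<times> tuples S Ds"
  let ?Z1 = "{(x, xs) \<in> ?Z. x \<notin> set xs}" and ?Z2 = "{(x, xs) \<in> ?Z. x \<in> set xs}"
  let ?Sg = "SIGMA i:{..<length Ds}. tuples S (Ds[i := Ds ! i \<inter> C])"
  have finT: "finite (tuples S Ds)" by (rule finite_tuples[OF fin])
  have finZ: "finite ?Z" using finT finC by simp
  have "card ?Z = card ?Z1 + card ?Z2"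
    by (subst card_Un_disjoint[symmetric])
       (auto intro: finite_subset[OF _ finZ] intro!: arg_cong[where f = card])
  moreover have "card (tuples S (C # Ds)) = card ?Z1"
    unfolding tuples_Cons by (rule card_image) (auto simp: inj_on_def)
  moreover have "card ?Z2 = card ?Sg"
  proof -
    have "?Z2 = (\<lambda>(i, xs). (xs ! i, xs)) ` ?Sg"
    proof (intro equalityI subsetI)
      fix z assume "z \<in> ?Z2"
      then obtain x xs where z: "z = (x, xs)" "x \<in> S" "x \<in> C" "xs \<in> tuples S Ds" "x \<in> set xs"
        by auto
      then obtain i where i: "i < length xs" "x = xs ! i" by (auto simp: in_set_conv_nth)
      have "length xs = length Ds" using z(4) by (auto simp: tuples_def list_all2_lengthD)
      then show "z \<in> (\<lambda>(i, xs). (xs ! i, xs)) ` ?Sg"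
        using z i by (intro image_eqI[of _ _ "(i, xs)"]) (auto simp: tuples_update_iff)
    next
      fix z assume "z \<in> (\<lambda>(i, xs). (xs ! i, xs)) ` ?Sg"
      then obtain i xs where z: "z = (xs ! i, xs)" "i < length Ds" "xs \<in> tuples S Ds" "xs ! i \<in> C"
        by (auto simp: tuples_update_iff)
      then have "length xs = length Ds" "set xs \<subseteq> S"
        by (auto simp: tuples_def list_all2_lengthD)
      then show "z \<in> ?Z2" using z nth_mem[of i xs] by auto
    qed
    moreover have "inj_on (\<lambda>(i, xs). (xs ! i, xs)) ?Sg"
    proof (rule inj_onI, clarsimp)
      fix i j xs
      assume "i < length Ds" "j < length Ds" "xs \<in> tuples S (Ds[i := Ds ! i \<inter> C])" "xs ! i = xs ! j"
      then show "i = j"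
        by (auto simp: tuples_update_iff tuples_def list_all2_lengthD nth_eq_iff_index_eq)
    qed
    ultimately show ?thesis by (simp only: card_image)
  qed
  moreover have "card ?Sg = (\<Sum>i<length Ds. card (tuples S (Ds[i := Ds ! i \<inter> C])))"
  proof (rule card_SigmaI)
    show "\<forall>i\<in>{..<length Ds}. finite (tuples S (Ds[i := Ds ! i \<inter> C]))"
      by (auto intro!: finite_subset[OF _ finT] simp: tuples_update_iff)
  qed simp
  ultimately show ?thesis by (simp add: card_cartesian_product)
qed

text \<open>Points taken from disjoint sets are automatically distinct, so nothing couples the two halves.\<close>

lemma card_tuples_append:
  assumes fin: "\<And>D. D \<in> set Ds \<union> set Es \<Longrightarrow> finite (S \<inter> D)"
    and disj: "\<And>D E. D \<in> set Ds \<Longrightarrow> E \<in> set Es \<Longrightarrow> D \<inter> E = {}"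
  shows "card (tuples S (Ds @ Es)) = card (tuples S Ds) * card (tuples S Es)"
proof -
  have "tuples S (Ds @ Es) = (\<lambda>(xs, ys). xs @ ys) ` (tuples S Ds \<times> tuples S Es)"
  proof (intro equalityI subsetI)
    fix zs assume "zs \<in> tuples S (Ds @ Es)"
    then show "zs \<in> (\<lambda>(xs, ys). xs @ ys) ` (tuples S Ds \<times> tuples S Es)"
      by (fastforce simp: tuples_def list_all2_append2)
  next
    fix zs assume "zs \<in> (\<lambda>(xs, ys). xs @ ys) ` (tuples S Ds \<times> tuples S Es)"
    then obtain xs ys where z: "zs = xs @ ys" "xs \<in> tuples S Ds" "ys \<in> tuples S Es" by auto
    have "set xs \<inter> set ys = {}"
    proof (rule ccontr)
      assume "set xs \<inter> set ys \<noteq> {}"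
      then obtain p where p: "p \<in> set xs" "p \<in> set ys" by blast
      obtain i where "i < length xs" "p = xs ! i" using p(1) by (auto simp: in_set_conv_nth)
      then have "p \<in> Ds ! i" "Ds ! i \<in> set Ds"
        using z(2) by (auto simp: tuples_def list_all2_conv_all_nth)
      moreover obtain j where "j < length ys" "p = ys ! j" using p(2) by (auto simp: in_set_conv_nth)
      then have "p \<in> Es ! j" "Es ! j \<in> set Es"
        using z(3) by (auto simp: tuples_def list_all2_conv_all_nth)
      ultimately show False using disj by blast
    qed
    then show "zs \<in> tuples S (Ds @ Es)"
      using z by (auto simp: tuples_def list_all2_appendI)
  qed
  moreover have "inj_on (\<lambda>(xs, ys). xs @ ys) (tuples S Ds \<times> tuples S Es)"
    by (auto simp: inj_on_def tuples_def dest!: list_all2_lengthD)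
  ultimately show ?thesis by (simp add: card_image card_cartesian_product)
qed

lemma tuple_count_eq_card:
  assumes fin: "\<And>D. D \<in> set Ds \<Longrightarrow> finite (S \<inter> D)"
  shows "tuple_count (length Ds) S (\<Pi>\<^sub>E i\<in>{..<length Ds}. Ds ! i) = ennreal (card (tuples S Ds))"
proof -
  let ?k = "length Ds"
  let ?X = "{x \<in> \<Pi>\<^sub>E i\<in>{..<?k}. Ds ! i. inj_on x {..<?k} \<and> x ` {..<?k} \<subseteq> S}"
  have bij: "bij_betw (\<lambda>x. map x [0..<?k]) ?X (tuples S Ds)"
  proof (rule bij_betwI[where g = "\<lambda>xs. \<lambda>i\<in>{..<?k}. xs ! i"])
    show "(\<lambda>x. map x [0..<?k]) \<in> ?X \<rightarrow> tuples S Ds"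
      by (auto simp: tuples_def distinct_map list_all2_conv_all_nth lessThan_atLeast0)
    show "(\<lambda>xs. \<lambda>i\<in>{..<?k}. xs ! i) \<in> tuples S Ds \<rightarrow> ?X"
    proof
      fix xs assume "xs \<in> tuples S Ds"
      then have xs: "distinct xs" "set xs \<subseteq> S" "list_all2 (\<in>) xs Ds" by (auto simp: tuples_def)
      have len: "length xs = ?k" using xs(3) by (rule list_all2_lengthD)
      show "(\<lambda>i\<in>{..<?k}. xs ! i) \<in> ?X"
        using xs len nth_mem[of _ xs]
        by (auto simp: list_all2_conv_all_nth inj_on_def nth_eq_iff_index_eq)
    qed
    show "(\<lambda>i\<in>{..<?k}. map x [0..<?k] ! i) = x" if "x \<in> ?X" for x
      using that by (auto simp: fun_eq_iff PiE_def extensional_def)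
    show "map (\<lambda>i\<in>{..<?k}. xs ! i) [0..<?k] = xs" if "xs \<in> tuples S Ds" for xs
      using that by (auto simp: tuples_def dest!: list_all2_lengthD intro!: nth_equalityI)
  qed
  have "finite ?X" using bij_betw_finite[OF bij] finite_tuples[OF fin] by simp
  then have "tuple_count ?k S (\<Pi>\<^sub>E i\<in>{..<?k}. Ds ! i) = of_nat (card ?X)"
    by (simp add: tuple_count_def emeasure_count_space)
  also have "card ?X = card (tuples S Ds)" by (rule bij_betw_same_card[OF bij])
  finally show ?thesis by (simp add: ennreal_of_nat_eq_real_of_nat)
qed

lemma card_tuples_replicate_Suc:
  assumes "finite (S \<inter> C)"
  shows "real (card (tuples S (replicate (Suc k) C))) =
    (real (card (S \<inter> C)) - real k) * real (card (tuples S (replicate k C)))"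
proof -
  have upd: "(replicate k C)[i := C] = replicate k C" for i
    by (cases "i < k") (auto simp: list_update_same_conv list_update_beyond)
  have "card (S \<inter> C) * card (tuples S (replicate k C)) =
    card (tuples S (C # replicate k C)) + (\<Sum>i<length (replicate k C).
       card (tuples S ((replicate k C)[i := replicate k C ! i \<inter> C])))"
    by (rule card_tuples_mult) (use assms in auto)
  also have "(\<Sum>i<length (replicate k C).
       card (tuples S ((replicate k C)[i := replicate k C ! i \<inter> C])))
     = k * card (tuples S (replicate k C))"
    by (simp add: upd)
  finally show ?thesis by (simp add: algebra_simps flip: of_nat_mult of_nat_add)
qed

lemma card_tuples_replicate:
  assumes "finite (S \<inter> C)"
  shows "real (card (tuples S (replicate k C))) = fact k * real (card (S \<inter> C) choose k)"
proof (induction k)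
  case (Suc k)
  let ?N = "card (S \<inter> C)"
  have "real (Suc k) * real (?N choose Suc k) = (real ?N - real k) * real (?N choose k)"
  proof (cases "k \<le> ?N")
    case True
    have "Suc k * (?N choose Suc k) = (?N - k) * (?N choose k)"
      by (metis binomial_absorb_comp binomial_absorption)
    then have "real (Suc k * (?N choose Suc k)) = real ((?N - k) * (?N choose k))" by simp
    then show ?thesis using True by (simp only: of_nat_mult of_nat_diff)
  qed (simp add: binomial_eq_0)
  then have "fact k * ((real ?N - real k) * real (?N choose k))
      = fact k * (real (Suc k) * real (?N choose Suc k))" by simp
  then show ?case
    unfolding card_tuples_replicate_Suc[OF assms] Suc by (simp only: fact_Suc mult_ac)
qed simp

section \<open>The Airy function\<close>

definition airy_partial :: "real \<Rightarrow> real \<Rightarrow> real" where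
  "airy_partial x R = integral {0..R} (\<lambda>t. cos (t ^ 3 / 3 + x * t))"

lemma airy_integrable: "(\<lambda>t. cos (t ^ 3 / 3 + x * t)) integrable_on {a..b::real}"
  by (intro integrable_continuous_real continuous_intros) auto

lemma airy_phase_derivs:
  shows DERIV_airy_phase_sin: "((\<lambda>t. sin (t ^ 3 / 3 + x * t)) has_real_derivative
      cos (t ^ 3 / 3 + x * t) * (t\<^sup>2 + x)) (at t within S)"
    and DERIV_airy_phase_cos: "((\<lambda>t. cos (t ^ 3 / 3 + x * t)) has_real_derivative
      - sin (t ^ 3 / 3 + x * t) * (t\<^sup>2 + x)) (at t within S)"
  by (auto intro!: derivative_eq_intros simp: power2_eq_square)

text \<open>Van der Corput's estimate: as the derivative \<open>t\<^sup>2 + x\<close> of the phase \<open>t ^ 3 / 3 + x t\<close> is monotone and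
  stays away from 0, one integration by parts gives a bound that does not depend on the length of the
  interval.\<close>

lemma airy_first_by_parts:
  fixes x a b m :: real
  assumes "0 \<le> a" "a \<le> b" "m > 0" "\<And>t. t \<in> {a..b} \<Longrightarrow> m \<le> \<bar>t\<^sup>2 + x\<bar>"
  shows "\<bar>integral {a..b} (\<lambda>t. cos (t ^ 3 / 3 + x * t))\<bar> \<le> 4 / m"
proof -
  let ?p = "\<lambda>t. t ^ 3 / 3 + x * t"
  let ?h = "\<lambda>t. 2 * t / (t\<^sup>2 + x)\<^sup>2"
  have nz: "t\<^sup>2 + x \<noteq> 0" if "t \<in> {a..b}" for t using assms(3) assms(4)[OF that] by auto
  have inv: "\<bar>1 / (t\<^sup>2 + x)\<bar> \<le> 1 / m" if "t \<in> {a..b}" for t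
    using assms(3) assms(4)[OF that] by (simp add: frac_le)
  have cont: "continuous_on {a..b} ?h" "continuous_on {a..b} (\<lambda>t. sin (?p t) * ?h t)"
    using nz by (auto intro!: continuous_intros)
  have "((\<lambda>t. cos (?p t) - sin (?p t) * ?h t) has_integral
      sin (?p b) / (b\<^sup>2 + x) - sin (?p a) / (a\<^sup>2 + x)) {a..b}"
  proof (rule fundamental_theorem_of_calculus[OF assms(2)])
    fix t assume t: "t \<in> {a..b}"
    have "((\<lambda>t. sin (?p t) / (t\<^sup>2 + x)) has_real_derivative cos (?p t) - sin (?p t) * ?h t)
        (at t within {a..b})"
      using nz[OF t]
      by (auto intro!: derivative_eq_intros DERIV_airy_phase_sin
          simp: diff_divide_distrib power2_eq_square)
    then show "((\<lambda>t. sin (?p t) / (t\<^sup>2 + x)) has_vector_derivative cos (?p t) - sin (?p t) * ?h t)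
        (at t within {a..b})"
      by (simp add: has_real_derivative_iff_has_vector_derivative)
  qed
  from has_integral_add[OF this integrable_integral[OF integrable_continuous_real[OF cont(2)]]]
  have "integral {a..b} (\<lambda>t. cos (?p t)) =
      sin (?p b) / (b\<^sup>2 + x) - sin (?p a) / (a\<^sup>2 + x) + integral {a..b} (\<lambda>t. sin (?p t) * ?h t)"
    by (simp add: integral_unique)
  moreover have "\<bar>integral {a..b} (\<lambda>t. sin (?p t) * ?h t)\<bar> \<le> 2 / m"
  proof -
    have hi: "(?h has_integral (- 1 / (b\<^sup>2 + x)) - (- 1 / (a\<^sup>2 + x))) {a..b}"
    proof (rule fundamental_theorem_of_calculus[OF assms(2)])
      fix t assume t: "t \<in> {a..b}"
      have "((\<lambda>t. - 1 / (t\<^sup>2 + x)) has_real_derivative ?h t) (at t within {a..b})"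
        using nz[OF t]
        by (auto intro!: derivative_eq_intros simp: field_simps power2_eq_square)
      then show "((\<lambda>t. - 1 / (t\<^sup>2 + x)) has_vector_derivative ?h t) (at t within {a..b})"
        by (simp add: has_real_derivative_iff_has_vector_derivative)
    qed
    have "\<bar>integral {a..b} (\<lambda>t. sin (?p t) * ?h t)\<bar> \<le> integral {a..b} ?h"
    proof -
      have "norm (integral {a..b} (\<lambda>t. sin (?p t) * ?h t)) \<le> integral {a..b} ?h"
      proof (rule integral_norm_bound_integral)
        show "norm (sin (?p t) * ?h t) \<le> ?h t" if "t \<in> {a..b}" for t
        proof -
          have "0 \<le> ?h t" using that assms(1) by auto
          then show ?thesis
            by (simp only: real_norm_def abs_mult abs_of_nonneg mult_left_le_one_le abs_sin_le_one abs_ge_zero)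
        qed
      qed (use cont in \<open>auto intro: integrable_continuous_real\<close>)
      then show ?thesis by simp
    qed
    also have "\<dots> = 1 / (a\<^sup>2 + x) - 1 / (b\<^sup>2 + x)" using integral_unique[OF hi] by simp
    also have "\<dots> \<le> 1 / m + 1 / m"
      using abs_le_D1[OF inv[of a]] abs_le_D2[OF inv[of b]] assms(2) by simp
    also have "\<dots> = 2 / m" by simp
    finally show ?thesis .
  qed
  moreover have "\<bar>sin (?p t) / (t\<^sup>2 + x)\<bar> \<le> 1 / m" if "t \<in> {a..b}" for t
  proof -
    have "\<bar>sin (?p t) / (t\<^sup>2 + x)\<bar> = \<bar>sin (?p t)\<bar> * \<bar>1 / (t\<^sup>2 + x)\<bar>"
      by (simp add: abs_mult[symmetric])
    also have "\<dots> \<le> 1 * \<bar>1 / (t\<^sup>2 + x)\<bar>" by (intro mult_right_mono) auto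
    finally show ?thesis using inv[OF that] by simp
  qed
  from this[of a] this[of b] have "\<bar>sin (?p a) / (a\<^sup>2 + x)\<bar> \<le> 1 / m" "\<bar>sin (?p b) / (b\<^sup>2 + x)\<bar> \<le> 1 / m"
    using assms(2) by auto
  ultimately have "\<bar>integral {a..b} (\<lambda>t. cos (?p t))\<bar> \<le> 1 / m + 1 / m + 2 / m"
    by (simp only:)
  then show ?thesis by (simp add: add_divide_distrib[symmetric])
qed

lemma airy_partial_diff:
  assumes "0 \<le> a" "a \<le> b"
  shows "airy_partial x b - airy_partial x a = integral {a..b} (\<lambda>t. cos (t ^ 3 / 3 + x * t))"
  unfolding airy_partial_def
  using Henstock_Kurzweil_Integration.integral_combine[OF assms airy_integrable, of x] by simp

text \<open>Away from the stationary point \<open>sqrt (- x)\<close> of the phase (distance at least 1) its derivative is at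
  least 1 in absolute value, and the remaining interval has length at most 2.\<close>

lemma airy_partial_bounded:
  assumes "0 \<le> R"
  shows "\<bar>airy_partial x R\<bar> \<le> 10"
proof -
  \<comment> \<open>the stationary point of the phase, or 0 if there is none; the unit interval to its left is cut off at 0\<close>
  define z where "z = sqrt (max 0 (- x))"
  define p where "p = max 0 (z - 1)"
  have z: "z \<ge> 0" "z\<^sup>2 \<ge> - x" "z\<^sup>2 = max 0 (- x)" by (auto simp: z_def)
  have pq: "0 \<le> p" "p \<le> z + 1" "z + 1 - p \<le> 2" using z by (auto simp: p_def)
  let ?f = "\<lambda>t. cos (t ^ 3 / 3 + x * t)"
  have 1: "\<bar>airy_partial x (min R p) - airy_partial x 0\<bar> \<le> 4"
  proof (cases "z \<ge> 1")
    case True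
    then have x: "x = - z\<^sup>2" using z by (auto simp: max_def split: if_splits)
    have "\<bar>integral {0..min R p} ?f\<bar> \<le> 4 / 1"
    proof (rule airy_first_by_parts)
      fix t assume t: "t \<in> {0..min R p}"
      then have "t \<le> z - 1" "0 \<le> t" using True by (auto simp: p_def)
      then have "t\<^sup>2 \<le> (z - 1)\<^sup>2" by (intro power_mono) auto
      then show "1 \<le> \<bar>t\<^sup>2 + x\<bar>" using True by (simp add: x power2_eq_square algebra_simps)
    qed (use assms pq in auto)
    then show ?thesis using assms pq by (subst airy_partial_diff) auto
  next
    case False
    then have "p = 0" by (simp add: p_def)
    then show ?thesis using assms by simp
  qed
  have 2: "\<bar>airy_partial x (min R (z + 1)) - airy_partial x (min R p)\<bar> \<le> 2"
  proof -
    have le: "min R p \<le> min R (z + 1)" "0 \<le> min R p" using pq assms by auto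
    have "norm (integral (cbox (min R p) (min R (z + 1))) ?f)
        \<le> 1 * Henstock_Kurzweil_Integration.content (cbox (min R p) (min R (z + 1)))"
      by (rule integrable_bound) (auto simp: airy_integrable)
    also have "\<dots> = min R (z + 1) - min R p" using le by simp
    also have "\<dots> \<le> 2" using pq by auto
    finally show ?thesis using le by (subst airy_partial_diff) auto
  qed
  have 3: "\<bar>airy_partial x R - airy_partial x (min R (z + 1))\<bar> \<le> 4"
  proof -
    have "\<bar>integral {min R (z + 1)..R} ?f\<bar> \<le> 4 / 1" if "z + 1 \<le> R"
    proof (rule airy_first_by_parts)
      fix t assume t: "t \<in> {min R (z + 1)..R}"
      then have "z + 1 \<le> t" using that by auto
      then have "(z + 1)\<^sup>2 \<le> t\<^sup>2" using z by (intro power_mono) auto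
      then have "z\<^sup>2 + 1 \<le> t\<^sup>2" using z by (simp add: power2_eq_square algebra_simps)
      then show "1 \<le> \<bar>t\<^sup>2 + x\<bar>" using z by linarith
    qed (use assms z in auto)
    then show ?thesis
      using assms z by (cases "z + 1 \<le> R") (auto simp: airy_partial_diff min_def)
  qed
  have "airy_partial x 0 = 0" by (simp add: airy_partial_def)
  with 1 2 3 show ?thesis by linarith
qed

lemma airy_partial_tail:
  assumes "\<bar>x\<bar> + 1 \<le> a" "a \<le> b"
  shows "\<bar>airy_partial x b - airy_partial x a\<bar> \<le> 4 / a"
proof -
  have a: "a \<ge> 1" using assms by linarith
  have "\<bar>integral {a..b} (\<lambda>t. cos (t ^ 3 / 3 + x * t))\<bar> \<le> 4 / a"
  proof (rule airy_first_by_parts)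
    fix t assume "t \<in> {a..b}"
    then have "a\<^sup>2 \<le> t\<^sup>2" using a by (intro power_mono) auto
    moreover have "a \<le> a\<^sup>2 - \<bar>x\<bar>"
    proof -
      have "0 \<le> (a - 1)\<^sup>2" by simp
      then show ?thesis using assms(1) by (simp add: power2_eq_square algebra_simps)
    qed
    ultimately show "a \<le> \<bar>t\<^sup>2 + x\<bar>" by linarith
  qed (use a assms in auto)
  then show ?thesis using a assms by (subst airy_partial_diff) auto
qed

lemma tendsto_airy_partial: "((airy_partial x) \<longlongrightarrow> pi * Ai x) at_top"
proof -
  have "Cauchy (\<lambda>n. airy_partial x (real n))"
  proof (rule metric_CauchyI)
    fix e :: real assume e: "e > 0"
    obtain N :: nat where N: "real N > max (\<bar>x\<bar> + 1) (4 / e)" using reals_Archimedean2 by blast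
    have Npos: "real N > 0" using N by linarith
    have lt: "4 / real N < e" using N e Npos by (simp add: field_simps)
    have *: "dist (airy_partial x (real m)) (airy_partial x (real n)) < e"
      if "N \<le> m" "m \<le> n" for m n
    proof -
      have "\<bar>airy_partial x (real n) - airy_partial x (real m)\<bar> \<le> 4 / real m"
        by (rule airy_partial_tail) (use N that in linarith)+
      also have "\<dots> \<le> 4 / real N" using that Npos by (intro divide_left_mono) auto
      finally show ?thesis using lt by (simp add: dist_real_def abs_minus_commute)
    qed
    show "\<exists>M. \<forall>m\<ge>M. \<forall>n\<ge>M. dist (airy_partial x (real m)) (airy_partial x (real n)) < e"
      by (rule exI[of _ N]) (metis * dist_commute nat_le_linear)
  qed
  then obtain l where l: "(\<lambda>n. airy_partial x (real n)) \<longlonglongrightarrow> l"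
    using Cauchy_convergent_iff convergent_def by blast
  have bound: "\<bar>l - airy_partial x R\<bar> \<le> 4 / R" if "R \<ge> \<bar>x\<bar> + 1" for R
  proof (rule tendsto_upperbound)
    show "(\<lambda>n. \<bar>airy_partial x (real n) - airy_partial x R\<bar>) \<longlonglongrightarrow> \<bar>l - airy_partial x R\<bar>"
      by (intro tendsto_intros l)
    show "\<forall>\<^sub>F n in sequentially. \<bar>airy_partial x (real n) - airy_partial x R\<bar> \<le> 4 / R"
      using eventually_ge_at_top[of "nat \<lceil>R\<rceil>"]
      by eventually_elim (rule airy_partial_tail[OF that], linarith)
  qed simp
  have lim: "((airy_partial x) \<longlongrightarrow> l) at_top"
  proof (rule Lim_null_comparison[of "\<lambda>R. airy_partial x R - l", THEN Lim_null[THEN iffD2]])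
    show "\<forall>\<^sub>F R in at_top. norm (airy_partial x R - l) \<le> 4 / R"
      using eventually_ge_at_top[of "\<bar>x\<bar> + 1"]
      by eventually_elim (use bound in \<open>simp add: abs_minus_commute\<close>)
    show "((\<lambda>R::real. 4 / R) \<longlongrightarrow> 0) at_top" by real_asymp
  qed
  moreover have "Ai x = (1 / pi) * l"
    unfolding Ai_def using tendsto_Lim[OF _ lim] by (simp add: airy_partial_def[abs_def])
  ultimately show ?thesis by simp
qed

lemma Ai_bounded: "\<bar>Ai x\<bar> \<le> 4"
proof -
  have "\<bar>pi * Ai x\<bar> \<le> 10"
  proof (rule tendsto_upperbound[OF tendsto_rabs[OF tendsto_airy_partial]])
    show "\<forall>\<^sub>F R in at_top. \<bar>airy_partial x R\<bar> \<le> 10"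
      using eventually_ge_at_top[of 0] by eventually_elim (rule airy_partial_bounded)
  qed simp
  then have "pi * \<bar>Ai x\<bar> \<le> 10" by (simp add: abs_mult)
  moreover have "3 * \<bar>Ai x\<bar> \<le> pi * \<bar>Ai x\<bar>" using pi_gt3 by (intro mult_right_mono) auto
  ultimately show ?thesis by linarith
qed

lemma borel_measurable_Ai [measurable]: "Ai \<in> borel_measurable borel"
proof (rule borel_measurable_LIMSEQ_real)
  show "(\<lambda>n. airy_partial x (real n) / pi) \<longlonglongrightarrow> Ai x" for x
  proof -
    have "(\<lambda>n. airy_partial x (real n)) \<longlonglongrightarrow> pi * Ai x"
      by (rule filterlim_compose[OF tendsto_airy_partial filterlim_real_sequentially])
    then have "(\<lambda>n. airy_partial x (real n) / pi) \<longlonglongrightarrow> pi * Ai x / pi"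
      by (intro tendsto_intros) auto
    then show ?thesis by simp
  qed
  show "(\<lambda>x. airy_partial x (real n) / pi) \<in> borel_measurable borel" for n
  proof (rule borel_measurable_continuous_onI)
    have "continuous_on UNIV (\<lambda>x. integral (cbox 0 (real n)) (\<lambda>t. cos (t ^ 3 / 3 + x * t)))"
      by (rule integral_continuous_on_param) (auto intro!: continuous_intros simp: case_prod_beta)
    then show "continuous_on UNIV (\<lambda>x. airy_partial x (real n) / pi)"
      unfolding airy_partial_def by (auto intro!: continuous_intros)
  qed
qed

text \<open>Two integrations by parts, merged into one antiderivative. The boundary terms vanish at 0 because
  both \<open>sin 0\<close> and the factor \<open>2 t\<close> do, so only an absolutely convergent integral of order \<open>x powr (-2)\<close>
  and terms that vanish for large \<open>R\<close> remain.\<close>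

lemma airy_second_by_parts:
  assumes x: "x \<ge> 1" and R: "R \<ge> 1"
  shows "\<bar>airy_partial x R\<bar> \<le> 3 / R + 28 / x\<^sup>2"
proof -
  let ?p = "\<lambda>t. t ^ 3 / 3 + x * t"
  \<comment> \<open>the boundary terms of both integrations by parts; \<open>?q\<close> is what the second one leaves\<close>
  let ?H = "\<lambda>t. sin (?p t) / (t\<^sup>2 + x) - cos (?p t) * (2 * t) / (t\<^sup>2 + x) ^ 3"
  let ?q = "\<lambda>t. 2 / (t\<^sup>2 + x) ^ 3 - 12 * t\<^sup>2 / (t\<^sup>2 + x) ^ 4"
  have pos: "t\<^sup>2 + x > 0" for t :: real using x by (smt (verit) zero_le_power2)
  then have nz: "t\<^sup>2 + x \<noteq> 0" for t :: real by (metis less_irrefl)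
  have "((\<lambda>t. cos (?p t) - cos (?p t) * ?q t) has_integral ?H R - ?H 0) {0..R}"
  proof (rule fundamental_theorem_of_calculus)
    fix t assume t: "t \<in> {0..R}"
    have "(?H has_real_derivative cos (?p t) - cos (?p t) * ?q t) (at t within {0..R})"
    proof -
      have alg: "(C * D * D - S * (2 * t)) / (D * D)
          - ((- S * D * (2 * t) + C * 2) * D ^ 3 - C * (2 * t) * (3 * D\<^sup>2 * (2 * t))) / (D ^ 3 * D ^ 3)
        = C - C * (2 / D ^ 3 - 12 * t\<^sup>2 / D ^ 4)" if "D \<noteq> 0" for C S D :: real
        using that by (simp add: field_simps eval_nat_numeral)
      have D: "((\<lambda>t. t\<^sup>2 + x) has_real_derivative 2 * t) (at t within {0..R})"
        by (auto intro!: derivative_eq_intros)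
      have D3: "((\<lambda>t. (t\<^sup>2 + x) ^ 3) has_real_derivative 3 * (t\<^sup>2 + x)\<^sup>2 * (2 * t)) (at t within {0..R})"
        by (auto intro!: derivative_eq_intros)
      have C: "((\<lambda>t. cos (?p t) * (2 * t)) has_real_derivative
          - sin (?p t) * (t\<^sup>2 + x) * (2 * t) + cos (?p t) * 2) (at t within {0..R})"
        by (auto intro!: derivative_eq_intros DERIV_airy_phase_cos)
      show ?thesis
        by (rule DERIV_cong[OF DERIV_diff[OF DERIV_divide[OF DERIV_airy_phase_sin D nz]
              DERIV_divide[OF C D3]]]) (use nz[of t] alg[OF nz] in auto)
    qed
    then show "(?H has_vector_derivative cos (?p t) - cos (?p t) * ?q t) (at t within {0..R})"
      by (simp add: has_real_derivative_iff_has_vector_derivative)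
  qed (use R in auto)
  moreover have cont: "(\<lambda>t. cos (?p t) * ?q t) integrable_on {0..R}"
    by (intro integrable_continuous_real continuous_intros) (use nz in auto)
  ultimately have "((\<lambda>t. cos (?p t)) has_integral
      ?H R - ?H 0 + integral {0..R} (\<lambda>t. cos (?p t) * ?q t)) {0..R}"
    using has_integral_add[OF _ integrable_integral[OF cont]] by fastforce
  then have eq: "airy_partial x R = ?H R + integral {0..R} (\<lambda>t. cos (?p t) * ?q t)"
    unfolding airy_partial_def by (simp add: integral_unique)
  have "\<bar>?H R\<bar> \<le> 3 / R"
  proof -
    have a: "R \<le> R\<^sup>2 + x" using R x self_le_power[of R 2] by simp
    have b: "R * R ^ 1 \<le> (R\<^sup>2 + x) ^ 3"
    proof -
      have "R * R ^ 1 \<le> R\<^sup>2 + x" using x by (simp add: power2_eq_square)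
      also have "\<dots> \<le> (R\<^sup>2 + x) ^ 3" using a R by (intro self_le_power) auto
      finally show ?thesis .
    qed
    have "\<bar>sin (?p R) / (R\<^sup>2 + x)\<bar> \<le> 1 / R"
      using a R pos[of R] by (auto simp: abs_div intro!: frac_le)
    moreover have "\<bar>cos (?p R) * (2 * R) / (R\<^sup>2 + x) ^ 3\<bar> \<le> 2 / R"
    proof -
      have "\<bar>cos (?p R) * (2 * R) / (R\<^sup>2 + x) ^ 3\<bar> = \<bar>cos (?p R)\<bar> * (2 * R / (R\<^sup>2 + x) ^ 3)"
        using R pos[of R] by (simp add: abs_mult)
      also have "\<dots> \<le> 1 * (2 * R / (R * R ^ 1))"
        using R b pos[of R] by (intro mult_mono divide_left_mono) auto
      finally show ?thesis using R by simp
    qed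
    ultimately have "\<bar>?H R\<bar> \<le> 1 / R + 2 / R"
      by (intro order_trans[OF abs_triangle_ineq4] add_mono)
    then show ?thesis by (simp add: add_divide_distrib[symmetric])
  qed
  moreover have "\<bar>integral {0..R} (\<lambda>t. cos (?p t) * ?q t)\<bar> \<le> 28 / x\<^sup>2"
  proof -
    have at: "((\<lambda>t. 14 / x\<^sup>2 * inverse (1 + t\<^sup>2)) has_integral 14 / x\<^sup>2 * arctan R - 14 / x\<^sup>2 * arctan 0) {0..R}"
    proof (rule fundamental_theorem_of_calculus)
      fix t assume t: "t \<in> {0..R}"
      have "((\<lambda>t. 14 / x\<^sup>2 * arctan t) has_real_derivative 14 / x\<^sup>2 * inverse (1 + t\<^sup>2)) (at t within {0..R})"
        by (intro DERIV_cmult DERIV_arctan[THEN has_field_derivative_at_within])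
      then show "((\<lambda>t. 14 / x\<^sup>2 * arctan t) has_vector_derivative 14 / x\<^sup>2 * inverse (1 + t\<^sup>2)) (at t within {0..R})"
        by (simp add: has_real_derivative_iff_has_vector_derivative)
    qed (use R in auto)
    have "norm (integral {0..R} (\<lambda>t. cos (?p t) * ?q t)) \<le> integral {0..R} (\<lambda>t. 14 / x\<^sup>2 * inverse (1 + t\<^sup>2))"
    proof (rule integral_norm_bound_integral)
      fix t assume t: "t \<in> {0..R}"
      have q: "\<bar>?q t\<bar> \<le> 14 / (t\<^sup>2 + x) ^ 3"
      proof -
        have "12 * t\<^sup>2 / (t\<^sup>2 + x) ^ 4 \<le> 12 * (t\<^sup>2 + x) / (t\<^sup>2 + x) ^ 4"
          using x pos[of t] by (intro divide_right_mono mult_left_mono) auto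
        also have "\<dots> = 12 / (t\<^sup>2 + x) ^ 3"         proof -
          have "12 * D / D ^ 4 = 12 / D ^ 3" if "D \<noteq> 0" for D :: real
            using that by (simp add: eval_nat_numeral)
          from this[OF nz] show ?thesis .
        qed
        finally have "12 * t\<^sup>2 / (t\<^sup>2 + x) ^ 4 \<le> 12 / (t\<^sup>2 + x) ^ 3" .
        moreover have "0 \<le> 12 * t\<^sup>2 / (t\<^sup>2 + x) ^ 4" "0 \<le> 2 / (t\<^sup>2 + x) ^ 3" using pos[of t] by auto
        moreover have "14 / (t\<^sup>2 + x) ^ 3 = 2 / (t\<^sup>2 + x) ^ 3 + 12 / (t\<^sup>2 + x) ^ 3"
          by (simp add: add_divide_distrib[symmetric])
        ultimately show ?thesis by linarith
      qed
      have "x\<^sup>2 * (1 + t\<^sup>2) \<le> (t\<^sup>2 + x)\<^sup>2 * (t\<^sup>2 + x)"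
        using x by (intro mult_mono power_mono) auto
      then have "x\<^sup>2 * (1 + t\<^sup>2) \<le> (t\<^sup>2 + x) ^ 3" by (simp add: power3_eq_cube power2_eq_square)
      moreover have "0 < x\<^sup>2 * (1 + t\<^sup>2)" using x by (intro mult_pos_pos) (auto simp: add_pos_nonneg)
      ultimately have "14 / (t\<^sup>2 + x) ^ 3 \<le> 14 / (x\<^sup>2 * (1 + t\<^sup>2))"
        by (intro frac_le) auto
      moreover have "norm (cos (?p t) * ?q t) \<le> 1 * \<bar>?q t\<bar>"
        unfolding real_norm_def abs_mult by (intro mult_right_mono) auto
      ultimately show "norm (cos (?p t) * ?q t) \<le> 14 / x\<^sup>2 * inverse (1 + t\<^sup>2)"
        using q by (simp add: field_simps)
    qed (use cont at in auto)
    also have "\<dots> = 14 / x\<^sup>2 * arctan R" using integral_unique[OF at] by simp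
    also have "\<dots> \<le> 14 / x\<^sup>2 * 2"
      using arctan_ubound[of R] pi_less_4 by (intro mult_left_mono) auto
    finally show ?thesis by simp
  qed
  ultimately show ?thesis unfolding eq by linarith
qed

lemma Ai_decay:
  assumes "x \<ge> 1"
  shows "\<bar>Ai x\<bar> \<le> 10 / x\<^sup>2"
proof -
  have "\<bar>pi * Ai x\<bar> \<le> 0 + 28 / x\<^sup>2"
  proof (rule tendsto_le[OF _ _ tendsto_rabs[OF tendsto_airy_partial]])
    show "((\<lambda>R. 3 / R + 28 / x\<^sup>2) \<longlongrightarrow> 0 + 28 / x\<^sup>2) at_top"
      by (intro tendsto_add tendsto_const) real_asymp
    show "\<forall>\<^sub>F R in at_top. \<bar>airy_partial x R\<bar> \<le> 3 / R + 28 / x\<^sup>2"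
      using eventually_ge_at_top[of 1] by eventually_elim (rule airy_second_by_parts[OF assms])
  qed simp
  then have "pi * \<bar>Ai x\<bar> \<le> 28 / x\<^sup>2" by (simp add: abs_mult)
  moreover have "3 * \<bar>Ai x\<bar> \<le> pi * \<bar>Ai x\<bar>" using pi_gt3 by (intro mult_right_mono) auto
  ultimately have "3 * \<bar>Ai x\<bar> \<le> 30 / x\<^sup>2"
    using assms by (smt (verit) divide_right_mono zero_le_power2)
  then show ?thesis by simp
qed

text \<open>Up to a constant, the Airy function is at most the square of this weight. The square is integrable at
  \<open>+\<infinity>\<close>, and the weight decays so slowly that a shift by a bounded amount changes it only by a bounded
  factor. All kernel estimates below rest on these two properties.\<close>

definition weight :: "real \<Rightarrow> real" where
  "weight x = 1 / (1 + max x 0)"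

lemma weight_pos: "weight x > 0" and weight_le_1: "weight x \<le> 1"
  by (auto simp: weight_def)

lemma borel_measurable_weight [measurable]: "weight \<in> borel_measurable borel"
  unfolding weight_def[abs_def] by measurable

lemma weight_antimono: "x \<le> y \<Longrightarrow> weight y \<le> weight x"
  by (auto simp: weight_def intro!: divide_left_mono)

lemma Ai_le_weight: "\<bar>Ai x\<bar> \<le> 40 * (weight x)\<^sup>2"
proof (cases "x \<ge> 1")
  case True
  have "10 / x\<^sup>2 = 40 / (2 * x)\<^sup>2" by (simp add: power2_eq_square)
  also have "\<dots> \<le> 40 / (1 + x)\<^sup>2"
    using True by (intro divide_left_mono power_mono mult_pos_pos zero_less_power) auto
  also have "\<dots> = 40 * (weight x)\<^sup>2" using True by (simp add: weight_def power_divide)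
  finally show ?thesis using Ai_decay[OF True] by linarith
next
  case False
  then have "1 / 2 \<le> weight x" using weight_antimono[of x 1] by (simp add: weight_def)
  then have "(1 / 2)\<^sup>2 \<le> (weight x)\<^sup>2" by (intro power_mono) auto
  then show ?thesis using Ai_bounded[of x] by (simp add: power_divide)
qed

section \<open>The extended Airy kernel\<close>

lemma weight_shift: "0 \<le> \<mu> \<Longrightarrow> weight (x - \<mu>) \<le> (1 + \<mu>) * weight x"
proof -
  assume "0 \<le> \<mu>"
  moreover have "\<mu> * \<mu> \<le> \<mu> * x" if "\<mu> \<le> x"
    using that \<open>0 \<le> \<mu>\<close> by (rule mult_left_mono)
  ultimately have "1 + max x 0 \<le> (1 + \<mu>) * (1 + max (x - \<mu>) 0)"
    by (auto simp: max_def algebra_simps)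
  then show ?thesis by (simp add: weight_def field_simps max_def)
qed

lemma weight_sq_integrable: "set_integrable lborel {a<..} (\<lambda>x. (weight x)\<^sup>2)"
proof (rule set_integrable_bound)
  \<comment> \<open>the factor \<open>1 + a\<^sup>2\<close> pays for negative arguments, where the weight is 1\<close>
  have "set_integrable lborel {a<..} (\<lambda>x. inverse (1 + x\<^sup>2))"
    by (rule set_integrable_subset[OF integrable_inverse_1_plus_square]) auto
  then show "set_integrable lborel {a<..} (\<lambda>x. (1 + a\<^sup>2) * inverse (1 + x\<^sup>2))" by simp
  show "AE x in lborel. x \<in> {a<..} \<longrightarrow> norm ((weight x)\<^sup>2) \<le> norm ((1 + a\<^sup>2) * inverse (1 + x\<^sup>2))"
  proof (intro AE_I2 impI)
    fix x assume x: "x \<in> {a<..}"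
    have p: "1 + x\<^sup>2 > 0" by (simp add: add_pos_nonneg)
    have "(weight x)\<^sup>2 \<le> (1 + a\<^sup>2) / (1 + x\<^sup>2)"
    proof (cases "x \<ge> 0")
      case True
      have "1 + x\<^sup>2 \<le> (1 + x)\<^sup>2" using True by (simp add: power2_eq_square algebra_simps)
      then have "(weight x)\<^sup>2 \<le> 1 / (1 + x\<^sup>2)"
        using True p by (auto simp: weight_def power_divide intro!: divide_left_mono)
      also have "\<dots> \<le> (1 + a\<^sup>2) / (1 + x\<^sup>2)" using p by (intro divide_right_mono) auto
      finally show ?thesis .
    next
      case False
      then have "x\<^sup>2 \<le> a\<^sup>2" using x by (subst abs_le_square_iff[symmetric]) auto
      then show ?thesis using False p by (simp add: weight_def)
    qed
    then show "norm ((weight x)\<^sup>2) \<le> norm ((1 + a\<^sup>2) * inverse (1 + x\<^sup>2))"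
      using p by (simp add: field_simps abs_mult)
  qed
qed (simp add: set_borel_measurable_def)

lemma
  fixes u :: real
  assumes "u > 0"
  shows set_integrable_exp_decay: "set_integrable lborel {0..} (\<lambda>x. exp (- u * x))"
    and set_integral_exp_decay: "(LBINT x:{0..}. exp (- u * x)) = 1 / u"
proof -
  have "(\<lambda>x. exp (- u * x)) absolutely_integrable_on {0..}"
    by (intro nonnegative_absolutely_integrable_1 integrable_on_exp_minus_to_infinity assms) auto
  then show *: "set_integrable lborel {0..} (\<lambda>x. exp (- u * x))"
    unfolding set_integrable_def by (subst (asm) integrable_completion) auto
  show "(LBINT x:{0..}. exp (- u * x)) = 1 / u"
    using set_borel_integral_eq_integral(2)[OF *] has_integral_exp_minus_to_infinity[OF assms, of 0]
    by (simp add: integral_unique)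
qed

text \<open>If \<open>g\<close> is not integrable then its Bochner integral is 0, so the bound holds for every \<open>g\<close>.\<close>

lemma set_integral_abs_le:
  fixes g h :: "'b \<Rightarrow> real"
  assumes "set_integrable M A h" "\<And>x. x \<in> A \<Longrightarrow> \<bar>g x\<bar> \<le> h x"
  shows "\<bar>LINT x:A|M. g x\<bar> \<le> (LINT x:A|M. h x)"
proof (cases "set_integrable M A g")
  case True
  have "\<bar>LINT x:A|M. g x\<bar> \<le> (LINT x:A|M. \<bar>g x\<bar>)"
    unfolding set_lebesgue_integral_def
    by (rule order_trans[OF integral_abs_bound]) (simp add: abs_mult)
  also have "\<dots> \<le> (LINT x:A|M. h x)"
    using assms True by (intro set_integral_mono set_integrable_abs) auto
  finally show ?thesis .
next
  case False
  then have "(LINT x:A|M. g x) = 0"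
    unfolding set_lebesgue_integral_def set_integrable_def by (rule not_integrable_integral_eq)
  moreover have "0 \<le> (LINT x:A|M. h x)"
    unfolding set_lebesgue_integral_def
    by (rule Bochner_Integration.integral_nonneg)
       (use assms(2) in \<open>force simp: indicator_def intro: order_trans[OF abs_ge_zero]\<close>)
  ultimately show ?thesis by simp
qed

lemma airy_ext_kernel_ge:
  "s \<ge> t \<Longrightarrow> airy_ext_kernel (s, x) (t, y) = (LBINT l:{0..}. exp (- l * (s - t)) * Ai (x + l) * Ai (y + l))"
  by simp

lemma airy_ext_kernel_less:
  assumes "s < t"
  shows "airy_ext_kernel (s, x) (t, y) =
    - (LBINT l:{0..}. exp (- (t - s) * l) * Ai (x - l) * Ai (y - l))"
  using assms by (simp, subst set_integral_reflect) (simp add: algebra_simps atLeast_def)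

text \<open>The exponential factor in the kernel integrates to \<open>1 / \<bar>s - t\<bar>\<close>. Hence distant times decouple, which
  is the source of mixing.\<close>

lemma airy_ext_kernel_decay:
  assumes "s \<noteq> t"
  shows "\<bar>airy_ext_kernel (s, x) (t, y)\<bar> \<le> 16 / \<bar>s - t\<bar>"
proof -
  have b: "\<bar>LBINT l:{0..}. g l\<bar> \<le> 16 / u"
    if "u > 0" "\<And>l. l \<ge> 0 \<Longrightarrow> \<bar>g l\<bar> \<le> 16 * exp (- u * l)" for u and g :: "real \<Rightarrow> real"
  proof -
    have "\<bar>LBINT l:{0..}. g l\<bar> \<le> (LBINT l:{0..}. 16 * exp (- u * l))"
      by (rule set_integral_abs_le) (use set_integrable_exp_decay[OF that(1)] that(2) in auto)
    also have "\<dots> = 16 / u" using set_integral_exp_decay[OF that(1)] by simp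
    finally show ?thesis .
  qed
  have A: "\<bar>exp v * Ai p * Ai q\<bar> \<le> 16 * exp v" for v p q
  proof -
    have "\<bar>Ai p\<bar> * \<bar>Ai q\<bar> \<le> 4 * 4" by (intro mult_mono Ai_bounded) auto
    then have "exp v * (\<bar>Ai p\<bar> * \<bar>Ai q\<bar>) \<le> exp v * 16" by (intro mult_left_mono) auto
    then show ?thesis by (simp add: abs_mult mult_ac)
  qed
  show ?thesis
  proof (cases "s < t")
    case True
    show ?thesis unfolding airy_ext_kernel_less[OF True] abs_minus_cancel
      by (rule b) (use True A[of "- (t - s) * l" for l] in \<open>auto simp: abs_minus_commute\<close>)
  next
    case False
    then have "s \<ge> t" by simp
    show ?thesis unfolding airy_ext_kernel_ge[OF \<open>s \<ge> t\<close>]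
    proof (rule b)
      show "\<bar>exp (- l * (s - t)) * Ai (x + l) * Ai (y + l)\<bar> \<le> 16 * exp (- \<bar>s - t\<bar> * l)" for l
      proof -
        have "- l * (s - t) = - \<bar>s - t\<bar> * l" using \<open>s \<ge> t\<close> by (simp add: algebra_simps)
        then show ?thesis using A[of "- l * (s - t)" "x + l" "y + l"] by (simp only:)
      qed
    qed (use assms in auto)
  qed
qed

text \<open>Of the four weight factors that bound the product of two Airy functions, one for each variable is kept
  for integrability in \<open>x\<close> and \<open>y\<close>, and the other two give integrability in \<open>l\<close>.\<close>

lemma Ai_prod_le_weight:
  assumes "a \<le> x" "a \<le> y" "0 \<le> l"
  shows "\<bar>Ai (x + l) * Ai (y + l)\<bar> \<le> 1600 * weight x * weight y * (weight (a + l))\<^sup>2"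
proof -
  have 1: "\<bar>Ai (z + l)\<bar> \<le> 40 * (weight z * weight (a + l))" if "a \<le> z" for z
  proof -
    have "weight (z + l) * weight (z + l) \<le> weight z * weight (a + l)"
      using that assms by (intro mult_mono weight_antimono less_imp_le[OF weight_pos]) auto
    then show ?thesis using Ai_le_weight[of "z + l"] by (simp add: power2_eq_square)
  qed
  have "\<bar>Ai (x + l)\<bar> * \<bar>Ai (y + l)\<bar> \<le>
      (40 * (weight x * weight (a + l))) * (40 * (weight y * weight (a + l)))"
    using assms weight_pos by (intro mult_mono 1) (auto intro!: mult_nonneg_nonneg less_imp_le)
  then show ?thesis by (simp add: abs_mult power2_eq_square mult_ac)
qed

lemma weight_sq_tail_integrable: "set_integrable lborel {0..} (\<lambda>l. (weight (a + l))\<^sup>2)"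
proof -
  have "set_integrable lborel {a..} (\<lambda>x. (weight x)\<^sup>2)"
    by (rule set_integrable_subset[OF weight_sq_integrable[of "a - 1"]]) auto
  then have "integrable lborel (\<lambda>x. indicator {a..} (a + 1 * x) *\<^sub>R (weight (a + 1 * x))\<^sup>2)"
    unfolding set_integrable_def by (intro lborel_integrable_real_affine) auto
  then show ?thesis unfolding set_integrable_def
    by (simp add: indicator_def)
qed

text \<open>The constant must be uniform in the times, since it has to serve as a dominating bound while the time
  difference grows. For \<open>s < t\<close> the integral runs over the oscillating side of the Airy function; there
  the exponential factor, which decays at least at rate \<open>\<delta>\<close>, beats the linear growth of
  \<^term>\<open>weight (x - l) / weight x\<close>.\<close>

lemma airy_ext_kernel_bound:
  fixes a \<delta> :: real
  assumes "\<delta> > 0"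
  obtains C where "C > 0"
    "\<And>s t x y. a \<le> x \<Longrightarrow> a \<le> y \<Longrightarrow> t \<le> s \<or> \<delta> \<le> t - s \<Longrightarrow>
       \<bar>airy_ext_kernel (s, x) (t, y)\<bar> \<le> C * weight x * weight y"
proof -
  define W where "W = (LBINT l:{0..}. (weight (a + l))\<^sup>2)"
  \<comment> \<open>chosen so that \<open>1 + l \<le> c * exp (\<delta> / 4 * l)\<close> for \<open>l \<ge> 0\<close>; the two Airy factors then use up half of the decay rate \<open>\<delta>\<close>\<close>
  define c where "c = max 1 (4 / \<delta>)"
  have W: "0 \<le> W" unfolding W_def set_lebesgue_integral_def
    by (rule Bochner_Integration.integral_nonneg) auto
  have c: "c \<ge> 1" "4 / \<delta> \<le> c" by (auto simp: c_def)
  define C where "C = 1600 * W + 1600 * c\<^sup>2 * (2 / \<delta>)"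
  have C1: "1600 * W \<le> C" and C2: "1600 * c\<^sup>2 * (2 / \<delta>) \<le> C" using W assms by (auto simp: C_def)
  have "0 < 1600 * c\<^sup>2 * (2 / \<delta>)" using assms c by simp
  then have Cpos: "C > 0" using C2 by linarith
  show thesis
  proof (rule that[OF Cpos])
    fix s t x y
    assume xy: "a \<le> x" "a \<le> y" and st: "t \<le> s \<or> \<delta> \<le> t - s"
    have ww: "0 \<le> weight x * weight y" using weight_pos by (simp add: less_imp_le)
    show "\<bar>airy_ext_kernel (s, x) (t, y)\<bar> \<le> C * weight x * weight y"
    proof (cases "t \<le> s")
      case True
      have "\<bar>airy_ext_kernel (s, x) (t, y)\<bar>
          \<le> (LBINT l:{0..}. 1600 * weight x * weight y * (weight (a + l))\<^sup>2)"
        unfolding airy_ext_kernel_ge[OF True]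
      proof (rule set_integral_abs_le)
        fix l :: real assume l: "l \<in> {0..}"
        have "\<bar>exp (- l * (s - t)) * Ai (x + l) * Ai (y + l)\<bar>
            = exp (- l * (s - t)) * \<bar>Ai (x + l) * Ai (y + l)\<bar>" by (simp add: abs_mult)
        also have "\<dots> \<le> 1 * \<bar>Ai (x + l) * Ai (y + l)\<bar>"
          using l True by (intro mult_right_mono) (auto intro!: mult_nonpos_nonneg)
        also have "\<dots> \<le> 1600 * weight x * weight y * (weight (a + l))\<^sup>2"
          using Ai_prod_le_weight[OF xy, of l] l by simp
        finally show "\<bar>exp (- l * (s - t)) * Ai (x + l) * Ai (y + l)\<bar>
            \<le> 1600 * weight x * weight y * (weight (a + l))\<^sup>2" .
      qed (use weight_sq_tail_integrable in auto)
      also have "\<dots> = 1600 * W * (weight x * weight y)" by (simp add: W_def)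
      also have "\<dots> \<le> C * (weight x * weight y)" using C1 ww by (rule mult_right_mono)
      finally show ?thesis by (simp add: mult_ac)
    next
      case False
      then have lt: "s < t" and d: "\<delta> \<le> t - s" using st by auto
      have half: "\<delta> / 2 > 0" using assms by simp
      have "\<bar>airy_ext_kernel (s, x) (t, y)\<bar>
          \<le> (LBINT l:{0..}. (1600 * c\<^sup>2 * weight x * weight y) * exp (- (\<delta> / 2) * l))"
        unfolding airy_ext_kernel_less[OF lt] abs_minus_cancel
      proof (rule set_integral_abs_le)
        fix l :: real assume l: "l \<in> {0..}"
        let ?e = "exp (\<delta> / 4 * l)"
        have "1 + l \<le> c * (1 + \<delta> / 4 * l)"
        proof -
          have "1 * l \<le> (c * \<delta> / 4) * l"
            using c(2) assms l by (intro mult_right_mono) (auto simp: field_simps)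
          then show ?thesis using c(1) by (simp add: algebra_simps)
        qed
        also have "\<dots> \<le> c * ?e" using c exp_ge_add_one_self[of "\<delta> / 4 * l"] by (intro mult_left_mono) auto
        finally have le: "1 + l \<le> c * ?e" .
        have 1: "\<bar>Ai (z - l)\<bar> \<le> 40 * (c * ?e * weight z)" for z
        proof -
          have "(weight (z - l))\<^sup>2 \<le> weight (z - l)"
            using weight_le_1[of "z - l"] weight_pos[of "z - l"] by (simp add: power2_eq_square mult_left_le)
          also have "\<dots> \<le> (1 + l) * weight z" using l by (intro weight_shift) auto
          also have "\<dots> \<le> c * ?e * weight z" using le weight_pos[of z] by (intro mult_right_mono) auto
          finally show ?thesis using Ai_le_weight[of "z - l"] by linarith
        qed
        have "\<bar>exp (- (t - s) * l) * Ai (x - l) * Ai (y - l)\<bar>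
            = exp (- (t - s) * l) * (\<bar>Ai (x - l)\<bar> * \<bar>Ai (y - l)\<bar>)" by (simp add: abs_mult)
        also have "\<dots> \<le> exp (- \<delta> * l) * ((40 * (c * ?e * weight x)) * (40 * (c * ?e * weight y)))"
        proof (intro mult_mono 1)
          show "exp (- (t - s) * l) \<le> exp (- \<delta> * l)"
            using mult_right_mono[OF d, of l] l by (simp add: algebra_simps)
        qed (use c weight_pos in \<open>auto intro!: mult_nonneg_nonneg less_imp_le\<close>)
        also have "\<dots> = (1600 * c\<^sup>2 * weight x * weight y) * (exp (- \<delta> * l) * (?e * ?e))"
          by (simp add: power2_eq_square)
        also have "exp (- \<delta> * l) * (?e * ?e) = exp (- (\<delta> / 2) * l)"
          by (simp add: exp_add[symmetric] field_simps)
        finally show "\<bar>exp (- (t - s) * l) * Ai (x - l) * Ai (y - l)\<bar>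
            \<le> (1600 * c\<^sup>2 * weight x * weight y) * exp (- (\<delta> / 2) * l)" .
      qed (use set_integrable_exp_decay[OF half] in auto)
      also have "\<dots> = 1600 * c\<^sup>2 * (2 / \<delta>) * (weight x * weight y)"
        using set_integral_exp_decay[OF half] by simp
      also have "\<dots> \<le> C * (weight x * weight y)" using C2 ww by (rule mult_right_mono)
      finally show ?thesis by (simp add: mult_ac)
    qed
  qed
qed

lemma airy_ext_kernel_shift:
  "airy_ext_kernel (s + T, x) (t + T, y) = airy_ext_kernel (s, x) (t, y)"
  by simp

lemma airy_kernel_equal_time:
  "airy_ext_kernel (t, x) (t, y) = (LBINT l:{0..}. Ai (x + l) * Ai (y + l))"
  by simp

text \<open>At equal times the kernel is the Gram matrix of the functions \<open>Ai (x + _)\<close> in \<open>L\<^sup>2\<close> of the half-line.\<close>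

lemma airy_kernel_psd: "psd_on n (\<lambda>i j. airy_ext_kernel (t, x i) (t, x j))"
  unfolding psd_on_def
proof (intro conjI allI)
  show "airy_ext_kernel (t, x i) (t, x j) = airy_ext_kernel (t, x j) (t, x i)" for i j
    by (simp add: mult.commute)
  fix c :: "nat \<Rightarrow> real"
  have int: "set_integrable lborel {0..} (\<lambda>l. Ai (x i + l) * Ai (x j + l))" for i j
  proof (rule set_integrable_bound)
    let ?a = "min (x i) (x j)"
    show "set_integrable lborel {0..} (\<lambda>l. 1600 * weight (x i) * weight (x j) * (weight (?a + l))\<^sup>2)"
      using weight_sq_tail_integrable by auto
    show "AE l in lborel. l \<in> {0..} \<longrightarrow> norm (Ai (x i + l) * Ai (x j + l))
        \<le> norm (1600 * weight (x i) * weight (x j) * (weight (?a + l))\<^sup>2)"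
    proof (intro AE_I2 impI)
      fix l :: real assume "l \<in> {0..}"
      then have "\<bar>Ai (x i + l) * Ai (x j + l)\<bar> \<le> 1600 * weight (x i) * weight (x j) * (weight (?a + l))\<^sup>2"
        by (intro Ai_prod_le_weight) auto
      then show "norm (Ai (x i + l) * Ai (x j + l))
        \<le> norm (1600 * weight (x i) * weight (x j) * (weight (?a + l))\<^sup>2)" by simp
    qed
  qed (simp add: set_borel_measurable_def)
  have "(\<Sum>i<n. \<Sum>j<n. c i * c j * airy_ext_kernel (t, x i) (t, x j))
      = (LBINT l:{0..}. (\<Sum>i<n. \<Sum>j<n. c i * c j * (Ai (x i + l) * Ai (x j + l))))"
    unfolding airy_kernel_equal_time set_lebesgue_integral_def
    using int unfolding set_integrable_def
    by (simp add: sum_distrib_left Bochner_Integration.integral_sum mult.left_commute[of "indicator _ _"])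
  also have "\<dots> = (LBINT l:{0..}. (\<Sum>i<n. c i * Ai (x i + l))\<^sup>2)"
    by (simp add: power2_eq_square sum_product mult_ac)
  also have "\<dots> \<ge> 0"
    unfolding set_lebesgue_integral_def by (rule Bochner_Integration.integral_nonneg) auto
  finally show "0 \<le> (\<Sum>i<n. \<Sum>j<n. c i * c j * airy_ext_kernel (t, x i) (t, x j))" .
qed

section \<open>Determinant estimates\<close>

lemma det_leibniz:
  fixes A :: "nat \<Rightarrow> nat \<Rightarrow> real"
  shows "Determinant.det (Matrix.mat n n (\<lambda>(i, j). A i j))
    = (\<Sum>p | p permutes {0..<n}. signof p * (\<Prod>i=0..<n. A i (p i)))"
  by (subst det_def'[of _ n]) (auto intro!: sum.cong prod.cong dest: permutes_in_image)

text \<open>Every permutation meets each row and each column once, so the weights of each term of the Leibniz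
  formula multiply to the same product.\<close>

lemma det_abs_le:
  fixes A :: "nat \<Rightarrow> nat \<Rightarrow> real" and w :: "nat \<Rightarrow> real"
  assumes "\<And>i j. i < n \<Longrightarrow> j < n \<Longrightarrow> \<bar>A i j\<bar> \<le> C * w i * w j"
  shows "\<bar>Determinant.det (Matrix.mat n n (\<lambda>(i, j). A i j))\<bar> \<le> fact n * C ^ n * (\<Prod>i<n. (w i)\<^sup>2)"
proof -
  let ?P = "{p. p permutes {0..<n}}"
  have "\<bar>Determinant.det (Matrix.mat n n (\<lambda>(i, j). A i j))\<bar>
      = \<bar>\<Sum>p\<in>?P. signof p * (\<Prod>i=0..<n. A i (p i))\<bar>"
    by (simp only: det_leibniz)
  also have "\<dots> \<le> (\<Sum>p\<in>?P. C ^ n * (\<Prod>i<n. (w i)\<^sup>2))"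
  proof (rule order_trans[OF sum_abs sum_mono])
    fix p assume p: "p \<in> ?P"
    have "\<bar>signof p * (\<Prod>i=0..<n. A i (p i))\<bar> = (\<Prod>i=0..<n. \<bar>A i (p i)\<bar>)"
      by (simp add: abs_mult sign_def abs_prod)
    also have "\<dots> \<le> (\<Prod>i=0..<n. C * w i * w (p i))"
      using p by (intro prod_mono) (auto intro!: assms dest: permutes_in_image)
    also have "\<dots> = C ^ n * (\<Prod>i=0..<n. w i) * (\<Prod>i=0..<n. w (p i))"
      by (simp add: prod.distrib)
    also have "(\<Prod>i=0..<n. w (p i)) = (\<Prod>i=0..<n. w i)"
      using prod.permute[of p "{0..<n}" w] p by (simp add: o_def)
    finally show "\<bar>signof p * (\<Prod>i=0..<n. A i (p i))\<bar> \<le> C ^ n * (\<Prod>i<n. (w i)\<^sup>2)"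
      by (simp add: power2_eq_square prod.distrib lessThan_atLeast0 mult_ac)
  qed
  also have "\<dots> = fact n * C ^ n * (\<Prod>i<n. (w i)\<^sup>2)"
    by (simp add: card_permutations)
  finally show ?thesis .
qed

lemma tendsto_det:
  fixes A :: "'c \<Rightarrow> nat \<Rightarrow> nat \<Rightarrow> real"
  assumes "\<And>i j. i < n \<Longrightarrow> j < n \<Longrightarrow> ((\<lambda>T. A T i j) \<longlongrightarrow> B i j) F"
  shows "((\<lambda>T. Determinant.det (Matrix.mat n n (\<lambda>(i, j). A T i j)))
     \<longlongrightarrow> Determinant.det (Matrix.mat n n (\<lambda>(i, j). B i j))) F"
  unfolding det_leibniz by (intro tendsto_intros assms) (auto dest: permutes_in_image)

lemma det_block_diag:
  fixes A B :: "nat \<Rightarrow> nat \<Rightarrow> real"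
  shows "Determinant.det (Matrix.mat (k + l) (k + l)
     (\<lambda>(i, j). if i < k \<and> j < k then A i j else if k \<le> i \<and> k \<le> j then B (i - k) (j - k) else 0))
   = Determinant.det (Matrix.mat k k (\<lambda>(i, j). A i j)) * Determinant.det (Matrix.mat l l (\<lambda>(i, j). B i j))"
proof -
  have "Matrix.mat (k + l) (k + l)
     (\<lambda>(i, j). if i < k \<and> j < k then A i j else if k \<le> i \<and> k \<le> j then B (i - k) (j - k) else 0)
    = four_block_mat (Matrix.mat k k (\<lambda>(i, j). A i j)) (0\<^sub>m k l) (0\<^sub>m l k) (Matrix.mat l l (\<lambda>(i, j). B i j))"
    by (intro eq_matI) auto
  then show ?thesis by (simp add: det_four_block_mat_lower_left_zero[of _ k _ l])
qed

section \<open>Factorial moments of the determinantal process\<close>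

abbreviation lborel_pow :: "nat \<Rightarrow> (nat \<Rightarrow> real) measure" where
  "lborel_pow n \<equiv> Pi\<^sub>M {..<n} (\<lambda>_. lborel)"

text \<open>A pair \<open>(t, a)\<close> of a time and a level, standing for the ray of points above \<open>a\<close> at time \<open>t\<close>.\<close>

type_synonym ray_id = "real \<times> real"

definition ray :: "ray_id \<Rightarrow> (real \<times> real) set" where
  "ray p = {fst p} \<times> {snd p<..}"

definition tshift :: "real \<Rightarrow> ray_id \<Rightarrow> ray_id" where
  "tshift T p = (fst p + T, snd p)"

lemma tshift_simps [simp]: "fst (tshift T p) = fst p + T" "snd (tshift T p) = snd p"
  by (auto simp: tshift_def)

definition ray_det :: "ray_id list \<Rightarrow> (nat \<Rightarrow> real) \<Rightarrow> real" where
  "ray_det D x = Determinant.det (Matrix.mat (length D) (length D)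
     (\<lambda>(i, j). airy_ext_kernel (fst (D ! i), x i) (fst (D ! j), x j)))"

definition ray_indicator :: "ray_id list \<Rightarrow> (nat \<Rightarrow> real) \<Rightarrow> real" where
  "ray_indicator D x = (\<Prod>i<length D. indicator {snd (D ! i)<..} (x i))"

text \<open>The factorial moment of the rays in the list \<open>D\<close> as the determinantal formula predicts it, with the
  times frozen so that only an integral over the positions is left. In this form the time differences
  occur only inside the kernel, which makes invariance and the limit of large shifts directly visible.\<close>

definition ray_moment :: "ray_id list \<Rightarrow> real" where
  "ray_moment D = (\<integral>x. ray_det D x * ray_indicator D x \<partial>lborel_pow (length D))"

lemma ray_indicator_01: "ray_indicator D x = 0 \<or> ray_indicator D x = 1"
  unfolding ray_indicator_def
  by (cases "\<forall>i<length D. x i \<in> {snd (D ! i)<..}") (auto simp: indicator_def intro!: prod.neutral prod_zero)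

lemma ray_indicator_nonneg: "0 \<le> ray_indicator D x"
  using ray_indicator_01[of D x] by auto

lemma ray_moment_tshift: "ray_moment (map (tshift T) D) = ray_moment D"
proof -
  have "ray_det (map (tshift T) D) x = ray_det D x" for x
    unfolding ray_det_def
    by (intro arg_cong[where f = Determinant.det] eq_matI)
       (auto simp: airy_ext_kernel_shift)
  moreover have "ray_indicator (map (tshift T) D) x = ray_indicator D x" for x
    by (simp add: ray_indicator_def)
  ultimately show ?thesis by (simp add: ray_moment_def)
qed

declare airy_ext_kernel.simps [simp del]

lemma borel_measurable_airy_ext_kernel:
  assumes [measurable]: "f \<in> borel_measurable N" "g \<in> borel_measurable N"
  shows "(\<lambda>x. airy_ext_kernel (s, f x) (t, g x)) \<in> borel_measurable N"
  unfolding airy_ext_kernel.simps set_lebesgue_integral_def by measurable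

lemma borel_measurable_det:
  fixes A :: "'c \<Rightarrow> nat \<Rightarrow> nat \<Rightarrow> real"
  assumes "\<And>i j. i < n \<Longrightarrow> j < n \<Longrightarrow> (\<lambda>x. A x i j) \<in> borel_measurable N"
  shows "(\<lambda>x. Determinant.det (Matrix.mat n n (\<lambda>(i, j). A x i j))) \<in> borel_measurable N"
  unfolding det_leibniz
  by (intro borel_measurable_sum borel_measurable_times borel_measurable_const borel_measurable_prod assms)
     (auto dest: permutes_in_image)

lemma borel_measurable_coordinate:
  "i < n \<Longrightarrow> (\<lambda>x. x i) \<in> borel_measurable (lborel_pow n)"
  using measurable_component_singleton[of i "{..<n}" "\<lambda>_. lborel :: real measure"] by simp

lemma borel_measurable_ray_det [measurable]:
  "ray_det D \<in> borel_measurable (lborel_pow (length D))"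
  unfolding ray_det_def[abs_def]
  by (rule borel_measurable_det) (auto intro!: borel_measurable_airy_ext_kernel borel_measurable_coordinate)

lemma borel_measurable_ray_indicator [measurable]:
  "ray_indicator D \<in> borel_measurable (lborel_pow (length D))"
  unfolding ray_indicator_def[abs_def]
  by (rule borel_measurable_prod, rule measurable_compose[OF measurable_component_singleton]) auto

interpretation lborel_prod: product_sigma_finite "\<lambda>_::nat. lborel :: real measure" ..

text \<open>Distinct times differ by at least \<open>\<delta>\<close>: the hypothesis under which \<open>airy_ext_kernel_bound\<close> applies
  to all pairs of entries of \<open>D\<close>.\<close>

definition gapped :: "real \<Rightarrow> ray_id list \<Rightarrow> bool" where
  "gapped \<delta> D \<longleftrightarrow> (\<forall>p\<in>set D. \<forall>q\<in>set D. fst q \<le> fst p \<or> \<delta> \<le> fst q - fst p)"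

lemma gapped_exists: "\<exists>\<delta>>0. gapped \<delta> D"
proof -
  \<comment> \<open>1 only ensures that the minimum is taken over a nonempty set\<close>
  let ?X = "insert 1 ((\<lambda>(p, q). fst q - fst p) ` {(p, q) \<in> set D \<times> set D. fst p < fst q})"
  have "finite ({(p, q) \<in> set D \<times> set D. fst p < fst q})"
    by (rule finite_subset[of _ "set D \<times> set D"]) auto
  then have fin: "finite ?X" by blast
  have "Min ?X > 0" using fin by (subst Min_gr_iff) auto
  moreover have "gapped (Min ?X) D"
    unfolding gapped_def
  proof (intro ballI)
    fix p q assume pq: "p \<in> set D" "q \<in> set D"
    have "Min ?X \<le> fst q - fst p" if "fst p < fst q"
      by (rule Min_le[OF fin]) (use that pq in force)
    then show "fst q \<le> fst p \<or> Min ?X \<le> fst q - fst p" by linarith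
  qed
  ultimately show ?thesis by blast
qed

text \<open>Once the shift exceeds the spread of the times by 1, mixed pairs are at least 1 apart, so the gap
  no longer depends on the shift.\<close>

lemma gapped_append_tshift:
  assumes "gapped \<delta>\<^sub>1 D" "gapped \<delta>\<^sub>2 E"
  shows "\<forall>\<^sub>F T in at_top. gapped (min 1 (min \<delta>\<^sub>1 \<delta>\<^sub>2)) (D @ map (tshift T) E)"
proof -
  let ?B = "\<Sum>p\<in>set D \<union> set E. \<bar>fst p\<bar>"
  have B: "\<bar>fst p\<bar> \<le> ?B" if "p \<in> set D \<union> set E" for p
    by (rule member_le_sum[of p "set D \<union> set E" "\<lambda>p. \<bar>fst p\<bar>"]) (use that in auto)
  show ?thesis
    using eventually_ge_at_top[of "2 * ?B + 1"]
  proof eventually_elim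
    case (elim T)
    have "fst p + 1 \<le> fst q + T" if "p \<in> set D" "q \<in> set E" for p q
      using B[of p] B[of q] that elim by auto
    then have DE: "\<forall>p\<in>set D. \<forall>q\<in>set E. fst p + 1 \<le> fst q + T" by blast
    show ?case
      unfolding gapped_def
    proof (intro ballI)
      fix p q assume pq: "p \<in> set (D @ map (tshift T) E)" "q \<in> set (D @ map (tshift T) E)"
      let ?g = "fst q \<le> fst p \<or> min 1 (min \<delta>\<^sub>1 \<delta>\<^sub>2) \<le> fst q - fst p"
      consider "p \<in> set D" "q \<in> set D" | q' where "p \<in> set D" "q' \<in> set E" "q = tshift T q'"
        | p' where "p' \<in> set E" "p = tshift T p'" "q \<in> set D"
        | p' q' where "p' \<in> set E" "p = tshift T p'" "q' \<in> set E" "q = tshift T q'"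
        using pq by auto
      then show ?g
      proof cases
        case 1
        then have "fst q \<le> fst p \<or> \<delta>\<^sub>1 \<le> fst q - fst p" using assms(1) unfolding gapped_def by blast
        then show ?thesis by linarith
      next
        case (2 q')
        then have "fst p + 1 \<le> fst q' + T" using DE by blast
        then show ?thesis using 2 by auto
      next
        case (3 p')
        then have "fst q + 1 \<le> fst p' + T" using DE by blast
        then show ?thesis using 3 by auto
      next
        case (4 p' q')
        then have "fst q' \<le> fst p' \<or> \<delta>\<^sub>2 \<le> fst q' - fst p'" using assms(2) unfolding gapped_def by blast
        then show ?thesis using 4 by auto
      qed
    qed
  qed
qed

text \<open>The integrable bound for all determinants with \<open>n\<close> positions above \<open>a\<close>. It depends on the list of rays only
  through \<open>n\<close>, \<open>a\<close> and \<open>C\<close>, hence not on a shift of some of the times.\<close>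

definition ray_dominator :: "real \<Rightarrow> real \<Rightarrow> nat \<Rightarrow> (nat \<Rightarrow> real) \<Rightarrow> real" where
  "ray_dominator a C n x = fact n * C ^ n * (\<Prod>i<n. indicator {a<..} (x i) * (weight (x i))\<^sup>2)"

lemma ray_det_bound:
  fixes a \<delta> :: real
  assumes "\<delta> > 0"
  shows "\<exists>C>0. \<forall>D x. gapped \<delta> D \<longrightarrow> (\<forall>p\<in>set D. a \<le> snd p) \<longrightarrow>
       \<bar>ray_det D x * ray_indicator D x\<bar>
         \<le> ray_dominator a C (length D) x"
proof -
  obtain C where C: "C > 0" "\<And>s t x y. a \<le> x \<Longrightarrow> a \<le> y \<Longrightarrow> t \<le> s \<or> \<delta> \<le> t - s \<Longrightarrow>
       \<bar>airy_ext_kernel (s, x) (t, y)\<bar> \<le> C * weight x * weight y"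
    using airy_ext_kernel_bound[OF assms] by metis
  show ?thesis
  proof (intro exI[of _ C] conjI allI impI C(1))
    fix D and x :: "nat \<Rightarrow> real"
    assume g: "gapped \<delta> D" and a: "\<forall>p\<in>set D. a \<le> snd p"
    let ?k = "length D"
    show "\<bar>ray_det D x * ray_indicator D x\<bar>
         \<le> ray_dominator a C ?k x"
    proof (cases "\<forall>i<?k. snd (D ! i) < x i")
      case True
      have ax: "a < x i" if "i < ?k" for i using True a[rule_format, of "D ! i"] that by force
      have "\<bar>ray_det D x\<bar> \<le> fact ?k * C ^ ?k * (\<Prod>i<?k. (weight (x i))\<^sup>2)"
        unfolding ray_det_def
      proof (rule det_abs_le)
        fix i j assume ij: "i < ?k" "j < ?k"
        then have "fst (D ! j) \<le> fst (D ! i) \<or> \<delta> \<le> fst (D ! j) - fst (D ! i)"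
          using g unfolding gapped_def by auto
        then show "\<bar>airy_ext_kernel (fst (D ! i), x i) (fst (D ! j), x j)\<bar> \<le> C * weight (x i) * weight (x j)"
          using ax[OF ij(1)] ax[OF ij(2)] by (intro C(2)) auto
      qed
      moreover have "ray_indicator D x = 1" using True by (simp add: ray_indicator_def)
      moreover have "(\<Prod>i<?k. indicator {a<..} (x i) * (weight (x i))\<^sup>2) = (\<Prod>i<?k. (weight (x i))\<^sup>2)"
        using ax by (intro prod.cong) auto
      ultimately show ?thesis by (simp add: ray_dominator_def)
    next
      case False
      then obtain i where "i < ?k" "indicator {snd (D ! i)<..} (x i) = (0::real)"
        by (auto simp: indicator_def)
      then have "ray_indicator D x = 0" unfolding ray_indicator_def by (intro prod_zero) auto
      moreover have "0 \<le> ray_dominator a C ?k x"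
        unfolding ray_dominator_def using C(1) by (intro mult_nonneg_nonneg prod_nonneg) auto
      ultimately show ?thesis by simp
    qed
  qed
qed

lemma integrable_ray_dominator: "integrable (lborel_pow n) (ray_dominator a C n)"
proof -
  have "integrable (lborel_pow n) (\<lambda>x. \<Prod>i<n. (\<lambda>y. indicator {a<..} y * (weight y)\<^sup>2) (x i))"
    by (rule lborel_prod.product_integrable_prod)
       (use weight_sq_integrable in \<open>auto simp: set_integrable_def\<close>)
  then show ?thesis by (simp add: ray_dominator_def[abs_def])
qed

lemma ray_lower_bound_exists: "\<exists>a. \<forall>p\<in>set D. a \<le> snd (p :: ray_id)"
proof -
  have "\<forall>p\<in>set D. Min (insert 0 (snd ` set D)) \<le> snd p" by auto
  then show ?thesis by blast
qed

lemma ray_integrable: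
  "integrable (lborel_pow (length D)) (\<lambda>x. ray_det D x * ray_indicator D x)"
proof -
  obtain \<delta> where \<delta>: "\<delta> > 0" "gapped \<delta> D" using gapped_exists by blast
  obtain a where a: "\<forall>p\<in>set D. a \<le> snd p" using ray_lower_bound_exists by blast
  obtain C where C: "C > 0" "\<And>D x. gapped \<delta> D \<Longrightarrow> \<forall>p\<in>set D. a \<le> snd p \<Longrightarrow>
       \<bar>ray_det D x * ray_indicator D x\<bar>
         \<le> ray_dominator a C (length D) x"
    using ray_det_bound[OF \<delta>(1), of a] by blast
  show ?thesis
  proof (rule Bochner_Integration.integrable_bound[OF integrable_ray_dominator])
    show "AE x in lborel_pow (length D). norm (ray_det D x * ray_indicator D x)
      \<le> norm (ray_dominator a C (length D) x)"
      unfolding real_norm_def by (intro AE_I2 order_trans[OF C(2)[OF \<delta>(2) a] abs_ge_self])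
  qed measurable
qed

lemma measurable_PiM_append:
  "(\<lambda>(x, y). \<lambda>i\<in>{..<k+l}. if i < k then x i else y (i - k)) \<in> measurable
     (lborel_pow k \<Otimes>\<^sub>M lborel_pow l) (lborel_pow (k+l))"
  (is "_ \<in> measurable ?P _")
  unfolding case_prod_beta
proof (rule measurable_restrict)
  fix i assume i: "i \<in> {..<k+l}"
  show "(\<lambda>z. if i < k then fst z i else snd z (i - k)) \<in> measurable ?P lborel"
    using i by (cases "i < k") auto
qed

text \<open>Concatenation identifies the product of the two powers of Lebesgue measure with the power of the
  summed dimension.\<close>

lemma distr_PiM_append:
  "distr (lborel_pow k \<Otimes>\<^sub>M lborel_pow l) (lborel_pow (k+l))
     (\<lambda>(x, y). \<lambda>i\<in>{..<k+l}. if i < k then x i else y (i - k)) = lborel_pow (k+l)"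
  (is "distr ?P ?Q ?f = _")
proof (rule lborel_prod.PiM_eqI)
  note f = measurable_PiM_append[of k l]
  fix A :: "nat \<Rightarrow> real set" assume A: "\<And>i. i \<in> {..<k+l} \<Longrightarrow> A i \<in> sets lborel"
  have "?f -` Pi\<^sub>E {..<k+l} A \<inter> space ?P = Pi\<^sub>E {..<k} A \<times> Pi\<^sub>E {..<l} (\<lambda>i. A (i + k))"
  proof (intro equalityI subsetI)
    fix z assume "z \<in> ?f -` Pi\<^sub>E {..<k+l} A \<inter> space ?P"
    then obtain x y where z: "z = (x, y)" "?f (x, y) \<in> Pi\<^sub>E {..<k+l} A"
      "x \<in> extensional {..<k}" "y \<in> extensional {..<l}"
      by (auto simp: space_pair_measure space_PiM PiE_def)
    have "x i \<in> A i" if "i < k" for i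
      using PiE_mem[OF z(2), of i] that by simp
    moreover have "y i \<in> A (i + k)" if "i < l" for i
      using PiE_mem[OF z(2), of "i + k"] that by simp
    ultimately show "z \<in> Pi\<^sub>E {..<k} A \<times> Pi\<^sub>E {..<l} (\<lambda>i. A (i + k))"
      using z by (auto simp: PiE_def)
  next
    fix z assume "z \<in> Pi\<^sub>E {..<k} A \<times> Pi\<^sub>E {..<l} (\<lambda>i. A (i + k))"
    then obtain x y where z: "z = (x, y)" "x \<in> Pi\<^sub>E {..<k} A" "y \<in> Pi\<^sub>E {..<l} (\<lambda>i. A (i + k))" by auto
    have "y (i - k) \<in> A i" if "\<not> i < k" "i < k + l" for i
      using PiE_mem[OF z(3), of "i - k"] that by simp
    then show "z \<in> ?f -` Pi\<^sub>E {..<k+l} A \<inter> space ?P"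
      using z by (auto simp: space_pair_measure space_PiM PiE_def)
  qed
  then have "emeasure (distr ?P ?Q ?f) (Pi\<^sub>E {..<k+l} A)
      = emeasure ?P (Pi\<^sub>E {..<k} A \<times> Pi\<^sub>E {..<l} (\<lambda>i. A (i + k)))"
    using A by (subst emeasure_distr[OF f]) (auto intro!: sets_PiM_I_finite)
  also have "\<dots> = emeasure (lborel_pow k) (Pi\<^sub>E {..<k} A)
      * emeasure (lborel_pow l) (Pi\<^sub>E {..<l} (\<lambda>i. A (i + k)))"
    using A by (intro sigma_finite_measure.emeasure_pair_measure_Times lborel_prod.sigma_finite sets_PiM_I_finite) auto
  also have "\<dots> = (\<Prod>i<k. emeasure lborel (A i)) * (\<Prod>i<l. emeasure lborel (A (i + k)))"
    using A by (intro arg_cong2[where f = "(*)"] lborel_prod.emeasure_PiM) auto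
  also have "(\<Prod>i<l. emeasure lborel (A (i + k))) = (\<Prod>i\<in>{k..<k+l}. emeasure lborel (A i))"
    using prod.shift_bounds_nat_ivl[of "\<lambda>i. emeasure lborel (A i)" 0 k l]
    by (simp add: lessThan_atLeast0 add.commute)
  also have "(\<Prod>i<k. emeasure lborel (A i)) * (\<Prod>i\<in>{k..<k+l}. emeasure lborel (A i))
      = (\<Prod>i\<in>{..<k+l}. emeasure lborel (A i))"
    by (subst prod.union_disjoint[symmetric]) (auto intro!: prod.cong)
  finally show "emeasure (distr ?P ?Q ?f) (Pi\<^sub>E {..<k+l} A) = (\<Prod>i\<in>{..<k+l}. emeasure lborel (A i))" .
qed auto

lemma integral_PiM_append:
  fixes f g :: "(nat \<Rightarrow> real) \<Rightarrow> real"
  assumes f: "integrable (lborel_pow k) f" and g: "integrable (lborel_pow l) g"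
  shows "(\<integral>x. f (\<lambda>i\<in>{..<k}. x i) * g (\<lambda>i\<in>{..<l}. x (i + k)) \<partial>lborel_pow (k+l))
    = (\<integral>x. f x \<partial>lborel_pow k) * (\<integral>x. g x \<partial>lborel_pow l)"
proof -
  let ?K = "lborel_pow k" and ?L = "lborel_pow l"
  let ?Q = "lborel_pow (k+l)"
  let ?f = "\<lambda>(x, y). \<lambda>i\<in>{..<k+l}. if i < k then x i else (y (i - k) :: real)"
  interpret P: pair_sigma_finite ?K ?L
    unfolding pair_sigma_finite_def by (auto intro: lborel_prod.sigma_finite)
  note fm = measurable_PiM_append[of k l]
  have m1: "(\<lambda>x. \<lambda>i\<in>{..<k}. x i) \<in> measurable ?Q ?K"
    by (intro measurable_restrict measurable_component_singleton) auto
  have m2: "(\<lambda>x. \<lambda>i\<in>{..<l}. x (i + k)) \<in> measurable ?Q ?L"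
    by (intro measurable_restrict measurable_component_singleton) auto
  have fb: "f \<in> borel_measurable ?K" and gb: "g \<in> borel_measurable ?L" using f g by auto
  have "(\<integral>x. f (\<lambda>i\<in>{..<k}. x i) * g (\<lambda>i\<in>{..<l}. x (i + k)) \<partial>?Q)
      = (\<integral>x. f (\<lambda>i\<in>{..<k}. x i) * g (\<lambda>i\<in>{..<l}. x (i + k)) \<partial>distr (?K \<Otimes>\<^sub>M ?L) ?Q ?f)"
    by (subst distr_PiM_append) simp
  also have "\<dots> = (\<integral>z. f (\<lambda>i\<in>{..<k}. ?f z i) * g (\<lambda>i\<in>{..<l}. ?f z (i + k)) \<partial>(?K \<Otimes>\<^sub>M ?L))"
    by (rule integral_distr[OF fm])
       (intro borel_measurable_times measurable_compose[OF m1 fb] measurable_compose[OF m2 gb])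
  also have "\<dots> = (\<integral>z. f (fst z) * g (snd z) \<partial>(?K \<Otimes>\<^sub>M ?L))"
  proof (rule Bochner_Integration.integral_cong[OF refl])
    fix z assume "z \<in> space (?K \<Otimes>\<^sub>M ?L)"
    then have e: "fst z \<in> extensional {..<k}" "snd z \<in> extensional {..<l}"
      by (auto simp: space_pair_measure space_PiM PiE_def)
    have "(\<lambda>i\<in>{..<k}. ?f z i) = fst z" "(\<lambda>i\<in>{..<l}. ?f z (i + k)) = snd z"
      using e by (auto simp: fun_eq_iff case_prod_beta extensional_def)
    then show "f (\<lambda>i\<in>{..<k}. ?f z i) * g (\<lambda>i\<in>{..<l}. ?f z (i + k)) = f (fst z) * g (snd z)" by simp
  qed
  also have "\<dots> = (\<integral>x. \<integral>y. f x * g y \<partial>?L \<partial>?K)"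
  proof -
    have "integrable (?K \<Otimes>\<^sub>M ?L) (\<lambda>z. f (fst z) * g (snd z))"
      unfolding case_prod_beta[symmetric]
    proof (rule P.Fubini_integrable)
      show "(\<lambda>z. f (fst z) * g (snd z)) \<in> borel_measurable (?K \<Otimes>\<^sub>M ?L)"
        using fb gb by measurable
      show "integrable ?K (\<lambda>x. \<integral>y. norm (f (fst (x, y)) * g (snd (x, y))) \<partial>?L)"
        using f by (simp add: abs_mult)
      show "AE x in ?K. integrable ?L (\<lambda>y. f (fst (x, y)) * g (snd (x, y)))"
        using g by simp
    qed
    from P.integral_fst'[OF this] show ?thesis by simp
  qed
  finally show ?thesis by simp
qed

text \<open>The analytic core of mixing. The off-diagonal blocks of the matrix tend to 0 by
  \<open>airy_ext_kernel_decay\<close>, so the determinant tends to that of a block diagonal matrix; the bound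
  \<open>ray_det_bound\<close> is uniform in the shift and allows dominated convergence.\<close>

lemma ray_moment_append_tendsto:
  "((\<lambda>T. ray_moment (D @ map (tshift T) E)) \<longlongrightarrow> ray_moment D * ray_moment E) at_top"
proof -
  let ?k = "length D" and ?l = "length E"
  let ?Q = "lborel_pow (?k + ?l)"
  let ?D = "\<lambda>T. D @ map (tshift T) E"
  let ?x1 = "\<lambda>x::nat \<Rightarrow> real. \<lambda>i\<in>{..<?k}. x i" and ?x2 = "\<lambda>x::nat \<Rightarrow> real. \<lambda>i\<in>{..<?l}. x (i + ?k)"
  obtain d1 d2 where d: "d1 > 0" "gapped d1 D" "d2 > 0" "gapped d2 E" using gapped_exists by metis
  define \<delta> where "\<delta> = min 1 (min d1 d2)"
  have \<delta>: "\<delta> > 0" using d by (auto simp: \<delta>_def)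
  have gap: "\<forall>\<^sub>F T in at_top. gapped \<delta> (?D T)"
    unfolding \<delta>_def by (rule gapped_append_tshift[OF d(2,4)])
  obtain a where a: "\<forall>p\<in>set (D @ E). a \<le> snd p" using ray_lower_bound_exists by blast
  obtain C where C: "C > 0" "\<And>D x. gapped \<delta> D \<Longrightarrow> \<forall>p\<in>set D. a \<le> snd p \<Longrightarrow>
       \<bar>ray_det D x * ray_indicator D x\<bar>
         \<le> ray_dominator a C (length D) x"
    using ray_det_bound[OF \<delta>, of a] by blast
  have pw: "((\<lambda>T. ray_det (?D T) x * ray_indicator (?D T) x)
      \<longlongrightarrow> ray_det D (?x1 x) * ray_indicator D (?x1 x) * (ray_det E (?x2 x) * ray_indicator E (?x2 x))) at_top" for x
  proof -
    let ?K = "\<lambda>T i j. airy_ext_kernel (fst (?D T ! i), x i) (fst (?D T ! j), x j)"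
    let ?A = "\<lambda>i j. airy_ext_kernel (fst (D ! i), ?x1 x i) (fst (D ! j), ?x1 x j)"
    let ?B = "\<lambda>i j. airy_ext_kernel (fst (E ! i), ?x2 x i) (fst (E ! j), ?x2 x j)"
    have far: "((\<lambda>T. airy_ext_kernel (s, u) (t + T, v)) \<longlongrightarrow> 0) at_top"
              "((\<lambda>T. airy_ext_kernel (t + T, v) (s, u)) \<longlongrightarrow> 0) at_top" for s t u v
    proof -
      have lim: "((\<lambda>T. 16 / \<bar>s - (t + T)\<bar>) \<longlongrightarrow> 0) at_top" by real_asymp
      have ev: "\<forall>\<^sub>F T in at_top. s \<noteq> t + T"
        using eventually_gt_at_top[of "s - t"] by eventually_elim auto
      show "((\<lambda>T. airy_ext_kernel (s, u) (t + T, v)) \<longlongrightarrow> 0) at_top"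
        by (rule Lim_null_comparison[OF _ lim], use ev in eventually_elim)
           (unfold real_norm_def, rule airy_ext_kernel_decay)
      show "((\<lambda>T. airy_ext_kernel (t + T, v) (s, u)) \<longlongrightarrow> 0) at_top"
        by (rule Lim_null_comparison[OF _ lim], use ev in eventually_elim)
           (metis real_norm_def airy_ext_kernel_decay abs_minus_commute)
    qed
    have "((\<lambda>T. Determinant.det (Matrix.mat (?k + ?l) (?k + ?l) (\<lambda>(i, j). ?K T i j)))
       \<longlongrightarrow> Determinant.det (Matrix.mat (?k + ?l) (?k + ?l)
         (\<lambda>(i, j). if i < ?k \<and> j < ?k then ?A i j else if ?k \<le> i \<and> ?k \<le> j then ?B (i - ?k) (j - ?k) else 0))) at_top"
    proof (rule tendsto_det)
      fix i j assume ij: "i < ?k + ?l" "j < ?k + ?l"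
      consider "i < ?k" "j < ?k" | "i < ?k" "?k \<le> j" | "?k \<le> i" "j < ?k" | "?k \<le> i" "?k \<le> j" by linarith
      then show "((\<lambda>T. ?K T i j) \<longlongrightarrow>
        (if i < ?k \<and> j < ?k then ?A i j else if ?k \<le> i \<and> ?k \<le> j then ?B (i - ?k) (j - ?k) else 0)) at_top"
      proof cases
        case 1 then show ?thesis by (simp add: nth_append)
      next
        case 2 then show ?thesis using ij far(1) by (simp add: nth_append)
      next
        case 3 then show ?thesis using ij far(2) by (simp add: nth_append)
      next
        case 4 then show ?thesis using ij
          by (auto simp: nth_append airy_ext_kernel_shift)
      qed
    qed
    then have det: "((\<lambda>T. ray_det (?D T) x) \<longlongrightarrow> ray_det D (?x1 x) * ray_det E (?x2 x)) at_top"
      by (simp only: ray_det_def length_append length_map det_block_diag[of ?k ?l ?A ?B])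
    have ind: "ray_indicator (?D T) x = ray_indicator D (?x1 x) * ray_indicator E (?x2 x)" for T
    proof -
      have "ray_indicator (?D T) x = (\<Prod>i\<in>{0..<?k + ?l}. indicator {snd ((D @ E) ! i)<..} (x i))"
        by (auto simp: ray_indicator_def lessThan_atLeast0 nth_append intro!: prod.cong)
      also have "\<dots> = (\<Prod>i\<in>{0..<?k}. indicator {snd ((D @ E) ! i)<..} (x i))
          * (\<Prod>i\<in>{?k..<?k + ?l}. indicator {snd ((D @ E) ! i)<..} (x i))"
        by (rule prod.atLeastLessThan_concat[symmetric]) auto
      also have "(\<Prod>i\<in>{?k..<?k + ?l}. indicator {snd ((D @ E) ! i)<..} (x i))
          = (\<Prod>i\<in>{0..<?l}. indicator {snd ((D @ E) ! (i + ?k))<..} (x (i + ?k)) :: real)"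
        using prod.shift_bounds_nat_ivl[of "\<lambda>i. indicator {snd ((D @ E) ! i)<..} (x i) :: real" 0 ?k ?l]
        by (simp add: add.commute)
      finally show ?thesis by (simp add: ray_indicator_def lessThan_atLeast0 nth_append)
    qed
    show ?thesis unfolding ind
      using tendsto_mult_right[OF det, of "ray_indicator D (?x1 x) * ray_indicator E (?x2 x)"]
      by (simp add: mult_ac)
  qed
  have "((\<lambda>T. \<integral>x. ray_det (?D T) x * ray_indicator (?D T) x \<partial>?Q)
      \<longlongrightarrow> (\<integral>x. ray_det D (?x1 x) * ray_indicator D (?x1 x) * (ray_det E (?x2 x) * ray_indicator E (?x2 x)) \<partial>?Q)) at_top"
  proof (rule integral_dominated_convergence_at_top)
    show "integrable ?Q (ray_dominator a C (?k + ?l))"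
      by (rule integrable_ray_dominator)
    show "\<forall>\<^sub>F T in at_top. AE x in ?Q. norm (ray_det (?D T) x * ray_indicator (?D T) x)
        \<le> ray_dominator a C (?k + ?l) x"
      using gap
    proof eventually_elim
      case (elim T)
      have "\<forall>p\<in>set (?D T). a \<le> snd p" using a by (simp add: ball_Un)
      from C(2)[OF elim this] show ?case by (intro AE_I2) simp
    qed
    show "AE x in ?Q. ((\<lambda>T. ray_det (?D T) x * ray_indicator (?D T) x)
      \<longlongrightarrow> ray_det D (?x1 x) * ray_indicator D (?x1 x) * (ray_det E (?x2 x) * ray_indicator E (?x2 x))) at_top"
      by (intro AE_I2 pw)
    show "(\<lambda>x. ray_det (?D T) x * ray_indicator (?D T) x) \<in> borel_measurable ?Q" for T
      using borel_measurable_ray_det[of "?D T"] borel_measurable_ray_indicator[of "?D T"] by simp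
    have m1: "?x1 \<in> measurable ?Q (lborel_pow ?k)"
      by (intro measurable_restrict measurable_component_singleton) auto
    have m2: "?x2 \<in> measurable ?Q (lborel_pow ?l)"
      by (intro measurable_restrict measurable_component_singleton) auto
    show "(\<lambda>x. ray_det D (?x1 x) * ray_indicator D (?x1 x) * (ray_det E (?x2 x) * ray_indicator E (?x2 x))) \<in> borel_measurable ?Q"
      by (intro borel_measurable_times measurable_compose[OF m1] measurable_compose[OF m2]
          borel_measurable_ray_det borel_measurable_ray_indicator)
  qed
  also have "(\<integral>x. ray_det D (?x1 x) * ray_indicator D (?x1 x) * (ray_det E (?x2 x) * ray_indicator E (?x2 x)) \<partial>?Q)
      = ray_moment D * ray_moment E"
    unfolding ray_moment_def
    by (rule integral_PiM_append[OF ray_integrable ray_integrable])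
  finally show ?thesis by (simp add: ray_moment_def)
qed

text \<open>The expected number of points above \<open>a\<close> at one time; it does not depend on that time.\<close>

definition tail_mass :: "real \<Rightarrow> real" where
  "tail_mass a = (\<integral>x. indicator {a<..} x * airy_ext_kernel (0, x) (0, x) \<partial>lborel)"

lemma ray_moment_replicate:
  "ray_moment (replicate k p) \<le> tail_mass (snd p) ^ k"
proof -
  let ?Q = "lborel_pow k"
  let ?f = "\<lambda>x. indicator {snd p<..} x * airy_ext_kernel (0, x) (0, x)"
  have K: "airy_ext_kernel (fst p, x) (fst p, y) = airy_ext_kernel (0, x) (0, y)" for x y
    using airy_ext_kernel_shift[of 0 "fst p" x 0 y] by (simp)
  have int1: "integrable lborel ?f"
  proof -
    obtain C where C: "C > 0" "\<And>s t x y. snd p \<le> x \<Longrightarrow> snd p \<le> y \<Longrightarrow> t \<le> s \<or> 1 \<le> t - s \<Longrightarrow>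
       \<bar>airy_ext_kernel (s, x) (t, y)\<bar> \<le> C * weight x * weight y"
      using airy_ext_kernel_bound[of 1 "snd p"] by auto
    show ?thesis
    proof (rule Bochner_Integration.integrable_bound)
      show "integrable lborel (\<lambda>x. C * (indicator {snd p<..} x *\<^sub>R (weight x)\<^sup>2))"
        using weight_sq_integrable[of "snd p"] by (simp add: set_integrable_def)
      show "AE x in lborel. norm (?f x) \<le> norm (C * (indicator {snd p<..} x *\<^sub>R (weight x)\<^sup>2))"
      proof (rule AE_I2)
        fix x
        show "norm (?f x) \<le> norm (C * (indicator {snd p<..} x *\<^sub>R (weight x)\<^sup>2))"
        proof (cases "x > snd p")
          case True
          then have "\<bar>airy_ext_kernel (0, x) (0, x)\<bar> \<le> C * weight x * weight x" by (intro C(2)) auto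
          then show ?thesis using True C(1)
            by (simp add: power2_eq_square mult.assoc abs_mult weight_pos less_imp_le)
        qed simp
      qed
    qed (intro borel_measurable_times borel_measurable_airy_ext_kernel, auto)
  qed
  have "ray_moment (replicate k p) = (\<integral>x. ray_det (replicate k p) x * ray_indicator (replicate k p) x \<partial>?Q)"
    by (simp add: ray_moment_def)
  also have "\<dots> \<le> (\<integral>x. (\<Prod>i<k. ?f (x i)) \<partial>?Q)"
  proof (rule integral_mono)
    show "integrable ?Q (\<lambda>x. ray_det (replicate k p) x * ray_indicator (replicate k p) x)"
      using ray_integrable[of "replicate k p"] by simp
    show "integrable ?Q (\<lambda>x. \<Prod>i<k. ?f (x i))"
      by (rule lborel_prod.product_integrable_prod) (use int1 in auto)
    fix x assume "x \<in> space ?Q"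
    have "ray_det (replicate k p) x = Determinant.det (Matrix.mat k k
        (\<lambda>(i, j). airy_ext_kernel (0, x i) (0, x j)))"
      unfolding ray_det_def by (intro arg_cong[where f = Determinant.det] eq_matI) (auto simp: K)
    also have "\<dots> \<le> (\<Prod>i<k. airy_ext_kernel (0, x i) (0, x i))"
      using hadamard_psd[OF airy_kernel_psd] by blast
    finally have "ray_det (replicate k p) x * ray_indicator (replicate k p) x
        \<le> (\<Prod>i<k. airy_ext_kernel (0, x i) (0, x i)) * ray_indicator (replicate k p) x"
      by (intro mult_right_mono ray_indicator_nonneg)
    also have "\<dots> = (\<Prod>i<k. ?f (x i))"
      by (simp add: ray_indicator_def prod.distrib mult.commute)
    finally show "ray_det (replicate k p) x * ray_indicator (replicate k p) x \<le> (\<Prod>i<k. ?f (x i))" .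
  qed
  also have "\<dots> = (\<Prod>i<k. integral\<^sup>L lborel ?f)"
    by (rule lborel_prod.product_integral_prod) (use int1 in auto)
  finally show ?thesis by (simp add: tail_mass_def)
qed

section \<open>Counts of points in rays\<close>

text \<open>A time slice of the product of counting and Lebesgue measure is a copy of Lebesgue measure.\<close>

lemma slice_measure:
  assumes I: "finite I" "t \<in> I"
  shows "distr lborel (count_space I \<Otimes>\<^sub>M (lborel :: real measure)) (Pair t)
     = density (count_space I \<Otimes>\<^sub>M lborel) (indicator ({t} \<times> UNIV))"
proof (rule measure_eqI)
  let ?\<mu> = "count_space I \<Otimes>\<^sub>M (lborel :: real measure)"
  have m: "Pair t \<in> measurable lborel ?\<mu>" using I by (intro measurable_Pair1') simp
  have sl: "{t} \<times> UNIV \<in> sets ?\<mu>" using I by (intro pair_measureI) auto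
  fix A assume "A \<in> sets (distr lborel ?\<mu> (Pair t))"
  then have A: "A \<in> sets ?\<mu>" by simp
  have "emeasure (density ?\<mu> (indicator ({t} \<times> UNIV))) A = emeasure ?\<mu> ({t} \<times> UNIV \<inter> A)"
    by (rule emeasure_restricted[OF sl A])
  also have "\<dots> = (\<integral>\<^sup>+s. emeasure lborel (Pair s -` ({t} \<times> UNIV \<inter> A)) \<partial>count_space I)"
    using sl A by (intro lborel.emeasure_pair_measure_alt) auto
  also have "\<dots> = (\<Sum>s\<in>I. emeasure lborel (Pair s -` ({t} \<times> UNIV \<inter> A)))"
    using I by (simp add: nn_integral_count_space_finite)
  also have "\<dots> = (\<Sum>s\<in>{t}. emeasure lborel (Pair s -` ({t} \<times> UNIV \<inter> A)))"
    using I by (intro sum.mono_neutral_right) (auto simp: vimage_def)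
  also have "\<dots> = emeasure lborel (Pair t -` A)" by (simp add: vimage_def)
  finally show "emeasure (distr lborel ?\<mu> (Pair t)) A
      = emeasure (density ?\<mu> (indicator ({t} \<times> UNIV))) A"
    using A m by (simp add: emeasure_distr)
qed simp

text \<open>Both sides are the product of the slice measures of \<open>slice_measure\<close>.\<close>

lemma PiM_slice:
  fixes t :: "nat \<Rightarrow> real"
  assumes I: "finite I" "\<And>i::nat. t i \<in> I"
  shows "distr (lborel_pow k) (Pi\<^sub>M {..<k} (\<lambda>_. count_space I \<Otimes>\<^sub>M (lborel :: real measure)))
       (\<lambda>x. \<lambda>i\<in>{..<k}. (t i, x i))
     = density (Pi\<^sub>M {..<k} (\<lambda>_. count_space I \<Otimes>\<^sub>M lborel)) (indicator (\<Pi>\<^sub>E i\<in>{..<k}. {t i} \<times> UNIV))"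
    (is "distr ?P ?Q ?e = density ?Q (indicator ?R)")
proof -
  let ?\<mu> = "count_space I \<Otimes>\<^sub>M (lborel :: real measure)"
  let ?\<nu> = "\<lambda>i. distr lborel ?\<mu> (Pair (t i))"
  have fI: "sigma_finite_measure (count_space I)" by (rule sigma_finite_measure_count_space_finite[OF I(1)])
  interpret mu: pair_sigma_finite "count_space I" "lborel :: real measure"
    unfolding pair_sigma_finite_def using fI lborel.sigma_finite_measure_axioms by blast
  have sl: "{t i} \<times> UNIV \<in> sets ?\<mu>" for i using I by (intro pair_measureI) auto
  have m: "Pair (t i) \<in> measurable lborel ?\<mu>" for i using I(2)[of i] by (intro measurable_Pair1') simp
  interpret Mu: product_sigma_finite "\<lambda>_::nat. ?\<mu>"
    by (rule product_sigma_finite.intro) (rule mu.P.sigma_finite_measure_axioms)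
  have "sigma_finite_measure (?\<nu> i)" for i
    unfolding slice_measure[OF I(1) I(2)]
    by (subst mu.P.sigma_finite_iff_density_finite) (use sl in \<open>auto simp: indicator_def\<close>)
  then interpret N: product_sigma_finite ?\<nu> by (intro product_sigma_finite.intro)
  have setsN: "sets ?Q = sets (Pi\<^sub>M {..<k} ?\<nu>)" by (intro sets_PiM_cong) auto
  have e: "?e \<in> measurable ?P ?Q"
  proof (intro measurable_restrict)
    fix i assume "i \<in> {..<k}"
    then show "(\<lambda>x. (t i, x i)) \<in> measurable ?P ?\<mu>"
      using I(2)[of i] by (intro measurable_Pair measurable_component_singleton) auto
  qed
  have 1: "distr ?P ?Q ?e = Pi\<^sub>M {..<k} ?\<nu>"
  proof (rule N.PiM_eqI)
    fix A :: "nat \<Rightarrow> (real \<times> real) set" assume "\<And>i. i \<in> {..<k} \<Longrightarrow> A i \<in> sets (?\<nu> i)"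
    then have A: "\<And>i. i \<in> {..<k} \<Longrightarrow> A i \<in> sets ?\<mu>" by simp
    have pre: "Pair (t i) -` A i \<in> sets lborel" if "i \<in> {..<k}" for i
      using measurable_sets[OF m A[OF that]] by simp
    have "emeasure (distr ?P ?Q ?e) (Pi\<^sub>E {..<k} A) = emeasure ?P (\<Pi>\<^sub>E i\<in>{..<k}. Pair (t i) -` A i)"
    proof -
      have "Pi\<^sub>E {..<k} A \<in> sets ?Q" using A by (intro sets_PiM_I_finite) auto
      moreover have "?e -` Pi\<^sub>E {..<k} A \<inter> space ?P = (\<Pi>\<^sub>E i\<in>{..<k}. Pair (t i) -` A i)"
        by (rule Set.set_eqI) (simp add: space_PiM PiE_iff)
      ultimately show ?thesis by (simp add: emeasure_distr[OF e])
    qed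
    also have "\<dots> = (\<Prod>i<k. emeasure lborel (Pair (t i) -` A i))"
      using pre by (intro lborel_prod.emeasure_PiM) auto
    also have "\<dots> = (\<Prod>i\<in>{..<k}. emeasure (?\<nu> i) (A i))"
      using A by (intro prod.cong refl) (simp add: emeasure_distr[OF m])
    finally show "emeasure (distr ?P ?Q ?e) (Pi\<^sub>E {..<k} A) = (\<Prod>i\<in>{..<k}. emeasure (?\<nu> i) (A i))" .
  qed (use setsN in auto)
  have 2: "density ?Q (indicator ?R) = Pi\<^sub>M {..<k} ?\<nu>"
  proof (rule N.PiM_eqI)
    fix A :: "nat \<Rightarrow> (real \<times> real) set" assume "\<And>i. i \<in> {..<k} \<Longrightarrow> A i \<in> sets (?\<nu> i)"
    then have A: "\<And>i. i \<in> {..<k} \<Longrightarrow> A i \<in> sets ?\<mu>" by simp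
    have "emeasure (density ?Q (indicator ?R)) (Pi\<^sub>E {..<k} A) = emeasure ?Q (?R \<inter> Pi\<^sub>E {..<k} A)"
      using A sl by (intro emeasure_restricted sets_PiM_I_finite) auto
    also have "?R \<inter> Pi\<^sub>E {..<k} A = (\<Pi>\<^sub>E i\<in>{..<k}. {t i} \<times> UNIV \<inter> A i)"
      by (auto simp: PiE_def Pi_def)
    also have "emeasure ?Q \<dots> = (\<Prod>i<k. emeasure ?\<mu> ({t i} \<times> UNIV \<inter> A i))"
      using A sl by (intro Mu.emeasure_PiM) auto
    also have "\<dots> = (\<Prod>i<k. emeasure (?\<nu> i) (A i))"
      unfolding slice_measure[OF I(1) I(2)]
      using A sl by (intro prod.cong refl emeasure_restricted[symmetric]) auto
    finally show "emeasure (density ?Q (indicator ?R)) (Pi\<^sub>E {..<k} A) = (\<Prod>i\<in>{..<k}. emeasure (?\<nu> i) (A i))"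
      by simp
  qed (use setsN in auto)
  show ?thesis using 1 2 by simp
qed

definition meet :: "ray_id \<Rightarrow> ray_id \<Rightarrow> ray_id" where
  "meet p q = (fst p, max (snd p) (snd q))"

text \<open>The number of tuples, expressed through the counts of single rays by the recursion of
  \<open>card_tuples_mult\<close>. Unlike the number of tuples itself, this expression is measurable by construction
  and obeys the recursion everywhere, not only where all counts are finite.\<close>

function tuple_poly :: "ray_id list \<Rightarrow> (ray_id \<Rightarrow> real) \<Rightarrow> real" where
  "tuple_poly [] N = 1"
| "tuple_poly (p # D) N = N p * tuple_poly D N -
     (\<Sum>i<length D. if fst (D ! i) = fst p
        then tuple_poly (D[i := meet p (D ! i)]) N else 0)"
  by pat_completeness auto
termination by (relation "Wellfounded.measure (\<lambda>(D, N). length D)") auto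

lemma tuple_count_1:
  "tuple_count 1 S (\<Pi>\<^sub>E i\<in>{..<1}. B) = emeasure (count_space UNIV) (S \<inter> B)"
proof -
  let ?X = "{x \<in> \<Pi>\<^sub>E i\<in>{..<1::nat}. B. inj_on x {..<1} \<and> x ` {..<1} \<subseteq> S}"
  have bij: "bij_betw (\<lambda>x. x 0) ?X (S \<inter> B)"
    by (rule bij_betwI[where g = "\<lambda>b. \<lambda>i\<in>{..<1}. b"])
       (auto simp: fun_eq_iff PiE_def extensional_def inj_on_def)
  show ?thesis
    unfolding tuple_count_def
    using bij_betw_finite[OF bij] bij_betw_same_card[OF bij]
    by (simp add: emeasure_count_space)
qed

lemma ray_Int: "ray q \<inter> ray p = (if fst q = fst p then ray (meet p q) else {})"
  by (auto simp: ray_def meet_def)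

lemma tuple_poly_eq_card:
  assumes "\<And>p. p \<in> set D \<Longrightarrow> finite (S \<inter> ray p)"
    and N: "\<And>p. N p = real (card (S \<inter> ray p))"
  shows "tuple_poly D N = real (card (tuples S (map ray D)))"
  using assms(1)
proof (induction "length D" arbitrary: D rule: less_induct)
  case less
  show ?case
  proof (cases D)
    case Nil
    then show ?thesis by simp
  next
    case (Cons p E)
    have finE: "finite (S \<inter> ray q)" if "q \<in> set E" for q using less.prems that Cons by auto
    have finp: "finite (S \<inter> ray p)" using less.prems Cons by auto
    have "card (S \<inter> ray p) * card (tuples S (map ray E)) = card (tuples S (map ray D))
        + (\<Sum>i<length E. card (tuples S ((map ray E)[i := map ray E ! i \<inter> ray p])))"
    proof -
      have "card (S \<inter> ray p) * card (tuples S (map ray E)) = card (tuples S (ray p # map ray E))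
        + (\<Sum>i<length (map ray E). card (tuples S ((map ray E)[i := map ray E ! i \<inter> ray p])))"
        by (rule card_tuples_mult) (use finE finp in auto)
      then show ?thesis by (simp only: Cons list.map length_map)
    qed
    moreover have "real (card (tuples S ((map ray E)[i := map ray E ! i \<inter> ray p]))) =
        (if fst (E ! i) = fst p then tuple_poly (E[i := meet p (E ! i)]) N else 0)"
      if i: "i < length E" for i
    proof (cases "fst (E ! i) = fst p")
      case True
      let ?E = "E[i := meet p (E ! i)]"
      have "tuple_poly ?E N = real (card (tuples S (map ray ?E)))"
      proof (rule less.hyps)
        fix q assume "q \<in> set ?E"
        then have "q \<in> set E \<or> q = meet p (E ! i)"
          using set_update_subset_insert by fastforce
        then show "finite (S \<inter> ray q)"
        proof
          assume "q = meet p (E ! i)"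
          then have "S \<inter> ray q \<subseteq> S \<inter> ray p" by (auto simp: ray_def meet_def)
          then show ?thesis using finp finite_subset by blast
        qed (rule finE)
      qed (simp add: Cons)
      moreover have "(map ray E)[i := map ray E ! i \<inter> ray p] = map ray ?E"
        using i True by (simp add: map_update ray_Int)
      ultimately show ?thesis using True by simp
    next
      case False
      have "{} \<in> set ((map ray E)[i := map ray E ! i \<inter> ray p])"
        using i False by (simp add: ray_Int set_update_memI)
      then show ?thesis using False by (simp add: tuples_empty_box)
    qed
    ultimately have "real (card (S \<inter> ray p)) * real (card (tuples S (map ray E)))
        = real (card (tuples S (map ray D))) + (\<Sum>i<length E. if fst (E ! i) = fst p
            then tuple_poly (E[i := meet p (E ! i)]) N else 0)"
      by (simp flip: of_nat_mult add: of_nat_sum)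
    moreover have "tuple_poly E N = real (card (tuples S (map ray E)))"
      by (rule less.hyps) (use finE Cons in auto)
    ultimately show ?thesis by (simp add: Cons N)
  qed
qed

locale airy_ensemble =
  fixes M :: "'a measure" and L :: "'a \<Rightarrow> nat \<times> real \<Rightarrow> real"
  assumes airy: "airy_line_ensemble M L"
begin

sublocale prob_space M
  using airy by (simp add: airy_line_ensemble_def line_ensemble_def)

definition points :: "'a \<Rightarrow> (real \<times> real) set" where
  "points \<omega> = {(t, L \<omega> (i, t)) | t i. i \<ge> 1}"

definition cnt :: "ray_id \<Rightarrow> 'a \<Rightarrow> real" where
  "cnt p \<omega> = real (card (points \<omega> \<inter> ray p))"

definition tuple_number :: "ray_id list \<Rightarrow> 'a \<Rightarrow> real" where
  "tuple_number D \<omega> = tuple_poly D (\<lambda>p. cnt p \<omega>)"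

lemma determinantal_points:
  assumes "finite I" "I \<noteq> {}"
  shows "determinantal M (count_space I \<Otimes>\<^sub>M lborel) airy_ext_kernel (\<lambda>\<omega>. points \<omega> \<inter> I \<times> UNIV)"
proof -
  have "(\<lambda>\<omega>. points \<omega> \<inter> I \<times> UNIV) = (\<lambda>\<omega>. {(t, L \<omega> (i, t)) | t i. t \<in> I \<and> i \<ge> 1})"
    by (auto simp: points_def fun_eq_iff)
  then show ?thesis using airy assms by (simp add: airy_line_ensemble_def)
qed

lemma ray_measurable: "fst p \<in> I \<Longrightarrow> ray p \<in> sets (count_space I \<Otimes>\<^sub>M lborel)"
  unfolding ray_def by (intro pair_measureI) auto

lemma borel_measurable_emeasure_points:
  "(\<lambda>\<omega>. emeasure (count_space UNIV) (points \<omega> \<inter> ray p)) \<in> borel_measurable M"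
proof -
  have "point_process M (count_space {fst p} \<Otimes>\<^sub>M lborel) (\<lambda>\<omega>. points \<omega> \<inter> {fst p} \<times> UNIV)"
    using determinantal_points[of "{fst p}"] by (simp add: determinantal_def)
  then have "(\<lambda>\<omega>. emeasure (count_space UNIV) (points \<omega> \<inter> {fst p} \<times> UNIV \<inter> ray p)) \<in> borel_measurable M"
    using ray_measurable[of p "{fst p}"] unfolding point_process_def by blast
  moreover have "points \<omega> \<inter> {fst p} \<times> UNIV \<inter> ray p = points \<omega> \<inter> ray p" for \<omega>
    by (auto simp: ray_def)
  ultimately show ?thesis by simp
qed

lemma borel_measurable_cnt [measurable]: "cnt p \<in> borel_measurable M"
proof -
  have "cnt p = (\<lambda>\<omega>. enn2real (emeasure (count_space UNIV) (points \<omega> \<inter> ray p)))"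
    by (auto simp: cnt_def fun_eq_iff emeasure_count_space)
  then show ?thesis using borel_measurable_emeasure_points by simp
qed

lemma borel_measurable_tuple_number [measurable]: "tuple_number D \<in> borel_measurable M"
proof (induction "length D" arbitrary: D rule: less_induct)
  case less
  show ?case
  proof (cases D)
    case Nil
    then show ?thesis by (simp add: tuple_number_def[abs_def])
  next
    case (Cons p E)
    have [measurable]: "tuple_number E' \<in> borel_measurable M" if "length E' = length E" for E'
      by (rule less) (use Cons that in simp)
    have "tuple_number D = (\<lambda>\<omega>. cnt p \<omega> * tuple_number E \<omega> - (\<Sum>i<length E. if fst (E ! i) = fst p
        then tuple_number (E[i := meet p (E ! i)]) \<omega> else 0))"
      by (simp add: fun_eq_iff tuple_number_def Cons cong: if_cong)
    also have "\<dots> \<in> borel_measurable M"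
      by (intro borel_measurable_diff borel_measurable_times borel_measurable_sum)
         (auto intro: \<open>\<And>E'. length E' = length E \<Longrightarrow> tuple_number E' \<in> borel_measurable M\<close>)
    finally show ?thesis .
  qed
qed

text \<open>The determinantal property, restricted to a product of rays: since each ray lies in one time slice,
  \<open>PiM_slice\<close> removes the sum over times.\<close>

lemma
  assumes "D \<noteq> []"
  shows nn_integral_tuple_count: "(\<integral>\<^sup>+\<omega>. tuple_count (length D) (points \<omega>) (\<Pi>\<^sub>E i\<in>{..<length D}. ray (D ! i)) \<partial>M)
      = (\<integral>\<^sup>+x. ennreal (ray_det D x * ray_indicator D x) \<partial>lborel_pow (length D))"
    and ray_det_AE_nonneg: "AE x in lborel_pow (length D). 0 \<le> ray_det D x"
proof -
  define k where "k = length D"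
  define I where "I = fst ` set D"
  \<comment> \<open>a product measure needs a measure at every index, hence the default for \<open>i \<ge> k\<close>\<close>
  define t where "t i = fst (if i < k then D ! i else hd D)" for i
  have I: "finite I" "\<And>i. t i \<in> I" "I \<noteq> {}"
    using assms by (auto simp: I_def t_def k_def intro!: imageI)
  let ?\<mu> = "count_space I \<Otimes>\<^sub>M (lborel :: real measure)"
  let ?Q = "Pi\<^sub>M {..<k} (\<lambda>_. ?\<mu>)" and ?P = "lborel_pow k"
  let ?e = "\<lambda>x. \<lambda>i\<in>{..<k}. (t i, x i)"
  let ?B = "\<Pi>\<^sub>E i\<in>{..<k}. ray (D ! i)" and ?R = "\<Pi>\<^sub>E i\<in>{..<k}. {t i} \<times> UNIV"
  let ?\<rho> = "\<lambda>x. Determinant.det (Matrix.mat k k (\<lambda>(i, j). airy_ext_kernel (x i) (x j)))"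
  have "correlation_function M ?\<mu> (\<lambda>\<omega>. points \<omega> \<inter> I \<times> UNIV) k ?\<rho>"
    using determinantal_points[OF I(1,3)] assms by (auto simp: determinantal_def k_def Suc_le_eq)
  then have \<rho>m [measurable]: "?\<rho> \<in> borel_measurable ?Q" and \<rho>0: "AE x in ?Q. 0 \<le> ?\<rho> x"
    and cf: "\<And>B. B \<in> sets ?Q \<Longrightarrow> (\<integral>\<^sup>+\<omega>. tuple_count k (points \<omega> \<inter> I \<times> UNIV) B \<partial>M) = (\<integral>\<^sup>+x\<in>B. ennreal (?\<rho> x) \<partial>?Q)"
    unfolding correlation_function_def by blast+
  have Dt: "fst (D ! i) = t i" if "i < k" for i using that by (simp add: t_def)
  have B [measurable]: "?B \<in> sets ?Q"
    by (intro sets_PiM_I_finite ray_measurable) (auto simp: Dt I(2))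
  have R: "?R \<in> sets ?Q"
    using I by (intro sets_PiM_I_finite pair_measureI) auto
  have BR: "?B \<subseteq> ?R" by (auto simp: ray_def Dt PiE_def Pi_def)
  have e: "?e \<in> measurable ?P ?Q"
  proof (intro measurable_restrict)
    fix i assume "i \<in> {..<k}"
    then show "(\<lambda>x. (t i, x i)) \<in> measurable ?P ?\<mu>"
      using I(2)[of i] by (intro measurable_Pair measurable_component_singleton) auto
  qed
  have \<rho>e: "?\<rho> (?e x) = ray_det D x" for x
    unfolding ray_det_def k_def[symmetric]
    by (intro arg_cong[where f = Determinant.det] eq_matI) (auto simp: Dt)
  have Be: "indicator ?B (?e x) = (indicator {x. ray_indicator D x = 1} x :: ennreal)" for x
  proof -
    have "?e x \<in> ?B \<longleftrightarrow> (\<forall>i<k. snd (D ! i) < x i)"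
      by (auto simp: PiE_iff ray_def Dt mem_Times_iff)
    also have "\<dots> \<longleftrightarrow> ray_indicator D x = 1"
    proof
      assume "ray_indicator D x = 1"
      then show "\<forall>i<k. snd (D ! i) < x i"
        unfolding ray_indicator_def k_def
        by (metis (no_types, lifting) finite_lessThan greaterThan_iff indicator_simps(2) lessThan_iff prod_zero_iff zero_neq_one)
    qed (auto simp: ray_indicator_def k_def)
    finally show ?thesis by (auto simp: indicator_def)
  qed
  have S: "tuple_count k (points \<omega> \<inter> I \<times> UNIV) ?B = tuple_count k (points \<omega>) ?B" for \<omega>
  proof -
    have "x ` {..<k} \<subseteq> I \<times> UNIV" if "x \<in> ?B" for x
    proof
      fix z assume "z \<in> x ` {..<k}"
      then obtain i where "i < k" "z = x i" by auto
      then show "z \<in> I \<times> UNIV" using PiE_mem[OF that, of i] Dt[of i] I(2)[of i] by (auto simp: ray_def)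
    qed
    then show ?thesis unfolding tuple_count_def by (intro arg_cong[where f = "emeasure _"]) auto
  qed
  note slice = PiM_slice[of I t k, OF I(1,2)]
  have "(\<integral>\<^sup>+\<omega>. tuple_count k (points \<omega>) ?B \<partial>M) = (\<integral>\<^sup>+x. ennreal (?\<rho> x) * indicator ?B x \<partial>?Q)"
    using cf[OF B] S by simp
  also have "\<dots> = (\<integral>\<^sup>+x. indicator ?R x * (ennreal (?\<rho> x) * indicator ?B x) \<partial>?Q)"
    using BR by (intro nn_integral_cong) (auto simp: indicator_def)
  also have "\<dots> = (\<integral>\<^sup>+x. ennreal (?\<rho> x) * indicator ?B x \<partial>density ?Q (indicator ?R))"
    using R by (subst nn_integral_density) auto
  also have "\<dots> = (\<integral>\<^sup>+x. ennreal (?\<rho> x) * indicator ?B x \<partial>distr ?P ?Q ?e)"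
    by (simp only: slice)
  also have "\<dots> = (\<integral>\<^sup>+x. ennreal (?\<rho> (?e x)) * indicator ?B (?e x) \<partial>?P)"
    by (rule nn_integral_distr[OF e]) simp
  also have "\<dots> = (\<integral>\<^sup>+x. ennreal (ray_det D x * ray_indicator D x) \<partial>?P)"
    unfolding \<rho>e Be
  proof (intro nn_integral_cong)
    fix x show "ennreal (ray_det D x) * indicator {x. ray_indicator D x = 1} x
        = ennreal (ray_det D x * ray_indicator D x)"
      using ray_indicator_01[of D x] by auto
  qed
  finally show "(\<integral>\<^sup>+\<omega>. tuple_count (length D) (points \<omega>) (\<Pi>\<^sub>E i\<in>{..<length D}. ray (D ! i)) \<partial>M)
      = (\<integral>\<^sup>+x. ennreal (ray_det D x * ray_indicator D x) \<partial>lborel_pow (length D))"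
    by (simp add: k_def)
  have "AE x in density ?Q (indicator ?R). 0 \<le> ?\<rho> x"
    using \<rho>0 R by (subst AE_density) auto
  then have "AE x in distr ?P ?Q ?e. 0 \<le> ?\<rho> x" by (simp only: slice)
  then have "AE x in ?P. 0 \<le> ?\<rho> (?e x)" by (rule AE_distrD[OF e])
  then show "AE x in lborel_pow (length D). 0 \<le> ray_det D x"
    unfolding \<rho>e unfolding k_def .
qed

lemma nn_integral_tuple_count_moment:
  assumes "D \<noteq> []"
  shows "(\<integral>\<^sup>+\<omega>. tuple_count (length D) (points \<omega>) (\<Pi>\<^sub>E i\<in>{..<length D}. ray (D ! i)) \<partial>M)
      = ennreal (ray_moment D)"
  unfolding nn_integral_tuple_count[OF assms] ray_moment_def
proof (rule nn_integral_eq_integral[OF ray_integrable])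
  show "AE x in lborel_pow (length D). 0 \<le> ray_det D x * ray_indicator D x"
    using ray_det_AE_nonneg[OF assms] by eventually_elim (simp add: ray_indicator_nonneg)
qed

text \<open>The expected number of points in a ray is finite.\<close>

lemma AE_finite_points: "AE \<omega> in M. finite (points \<omega> \<inter> ray p)"
proof -
  have "(\<integral>\<^sup>+\<omega>. emeasure (count_space UNIV) (points \<omega> \<inter> ray p) \<partial>M) = ennreal (ray_moment [p])"
  proof -
    have "(\<Pi>\<^sub>E i\<in>{..<length [p]}. ray ([p] ! i)) = (\<Pi>\<^sub>E i\<in>{..<1}. ray p)"
      by (simp, intro PiE_cong) auto
    then have "tuple_count (length [p]) (points \<omega>) (\<Pi>\<^sub>E i\<in>{..<length [p]}. ray ([p] ! i))
        = emeasure (count_space UNIV) (points \<omega> \<inter> ray p)" for \<omega>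
      using tuple_count_1[of "points \<omega>" "ray p"] by simp
    then show ?thesis using nn_integral_tuple_count_moment[of "[p]"] by (simp only: not_Cons_self2 not_False_eq_True)
  qed
  then have "AE \<omega> in M. emeasure (count_space UNIV) (points \<omega> \<inter> ray p) \<noteq> \<infinity>"
    by (intro nn_integral_PInf_AE borel_measurable_emeasure_points) auto
  then show ?thesis by eventually_elim (auto simp: emeasure_count_space split: if_splits)
qed

lemma AE_finite_points_list: "AE \<omega> in M. \<forall>p\<in>set D. finite (points \<omega> \<inter> ray p)"
  by (subst AE_ball_countable) (auto intro: AE_finite_points countable_finite)

lemma AE_tuple_number_eq: "AE \<omega> in M. tuple_number D \<omega> = real (card (tuples (points \<omega>) (map ray D)))"
  using AE_finite_points_list[of D]
  by eventually_elim (auto simp: tuple_number_def cnt_def intro!: tuple_poly_eq_card)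

text \<open>The tuple number agrees almost surely with the tuple count of the point process, whose expectation is
  known.\<close>

lemma
  shows integrable_tuple_number: "integrable M (tuple_number D)"
    and expectation_tuple_number: "expectation (tuple_number D) = ray_moment D"
proof -
  have "integrable M (tuple_number D) \<and> expectation (tuple_number D) = ray_moment D"
  proof (cases "D = []")
    case True
    have "ray_moment [] = 1"
      unfolding ray_moment_def by (simp add: ray_det_def ray_indicator_def det_dim_zero PiM_empty)
    then show ?thesis using True by (simp add: tuple_number_def[abs_def] prob_space)
  next
    case False
    have ae0: "AE \<omega> in M. 0 \<le> tuple_number D \<omega>" using AE_tuple_number_eq[of D] by eventually_elim simp
    have "(\<integral>\<^sup>+\<omega>. ennreal (tuple_number D \<omega>) \<partial>M)
        = (\<integral>\<^sup>+\<omega>. tuple_count (length D) (points \<omega>) (\<Pi>\<^sub>E i\<in>{..<length D}. ray (D ! i)) \<partial>M)"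
    proof (rule nn_integral_cong_AE)
      show "AE \<omega> in M. ennreal (tuple_number D \<omega>)
          = tuple_count (length D) (points \<omega>) (\<Pi>\<^sub>E i\<in>{..<length D}. ray (D ! i))"
        using AE_tuple_number_eq[of D] AE_finite_points_list[of D]
      proof eventually_elim
        case (elim \<omega>)
        have "(\<Pi>\<^sub>E i\<in>{..<length D}. ray (D ! i)) = (\<Pi>\<^sub>E i\<in>{..<length (map ray D)}. map ray D ! i)"
          unfolding length_map by (intro PiE_cong) simp
        moreover have "\<And>B. B \<in> set (map ray D) \<Longrightarrow> finite (points \<omega> \<inter> B)" using elim by auto
        from tuple_count_eq_card[of "map ray D", OF this] have "tuple_count (length D) (points \<omega>)
            (\<Pi>\<^sub>E i\<in>{..<length (map ray D)}. map ray D ! i) = ennreal (card (tuples (points \<omega>) (map ray D)))"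
          by (simp only: length_map)
        ultimately show ?case using elim by simp
      qed
    qed
    also have "\<dots> = ennreal (ray_moment D)" by (rule nn_integral_tuple_count_moment[OF False])
    finally have nn: "(\<integral>\<^sup>+\<omega>. ennreal (tuple_number D \<omega>) \<partial>M) = ennreal (ray_moment D)" .
    have int: "integrable M (tuple_number D)"
      by (rule integrableI_nn_integral_finite[OF _ ae0 nn]) simp
    have "0 \<le> ray_moment D"
      unfolding ray_moment_def
    proof (rule integral_nonneg_AE)
      show "AE x in lborel_pow (length D). 0 \<le> ray_det D x * ray_indicator D x"
        using ray_det_AE_nonneg[OF False] by eventually_elim (simp add: ray_indicator_nonneg)
    qed
    moreover have "ennreal (expectation (tuple_number D)) = ennreal (ray_moment D)"
      using nn_integral_eq_integral[OF int ae0] nn by simp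
    ultimately show ?thesis
      using int integral_nonneg_AE[OF ae0] by (simp add: ennreal_inj)
  qed
  then show "integrable M (tuple_number D)" "expectation (tuple_number D) = ray_moment D" by auto
qed

lemma AE_tuple_number_append:
  assumes "\<And>p q. p \<in> set D \<Longrightarrow> q \<in> set E \<Longrightarrow> fst p \<noteq> fst q"
  shows "AE \<omega> in M. tuple_number (D @ E) \<omega> = tuple_number D \<omega> * tuple_number E \<omega>"
  using AE_finite_points_list[of "D @ E"] AE_tuple_number_eq[of D] AE_tuple_number_eq[of E] AE_tuple_number_eq[of "D @ E"]
proof eventually_elim
  case (elim \<omega>)
  have "card (tuples (points \<omega>) (map ray D @ map ray E))
      = card (tuples (points \<omega>) (map ray D)) * card (tuples (points \<omega>) (map ray E))"
  proof (rule card_tuples_append)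
    show "B \<inter> C = {}" if "B \<in> set (map ray D)" "C \<in> set (map ray E)" for B C
      using that assms by (auto simp: ray_def)
  qed (use elim(1) in auto)
  then show ?case using elim by simp
qed

end

section \<open>Exceedance events\<close>

text \<open>A real-valued indicator function, so that products of indicators and products of interpolating
  polynomials have the same shape.\<close>

definition at_least :: "nat \<Rightarrow> nat \<Rightarrow> real" where
  "at_least i n = (if i \<le> n then 1 else 0)"

abbreviation line_indices :: "(nat \<times> ray_id) list \<Rightarrow> bool" where
  "line_indices J \<equiv> \<forall>(i, p)\<in>set J. 1 \<le> i"

definition nshift :: "real \<Rightarrow> nat \<times> ray_id \<Rightarrow> nat \<times> ray_id" where
  "nshift T = map_prod id (tshift T)"

lemma at_least_abs: "\<bar>at_least i n\<bar> \<le> 1"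
  by (simp add: at_least_def)

lemma nonneg_le_sum_list:
  fixes f :: "'b \<Rightarrow> real"
  assumes "\<And>z. 0 \<le> f z" "z \<in> set J"
  shows "f z \<le> (\<Sum>z\<leftarrow>J. f z)"
  using assms(2)
proof (induction J)
  case (Cons y J)
  have "0 \<le> (\<Sum>z\<leftarrow>J. f z)" by (rule sum_list_nonneg) (use assms(1) in auto)
  then show ?case using Cons assms(1)[of y] by auto
qed simp

text \<open>The two products agree unless some count exceeds \<open>R\<close>. In that case both are at most \<open>3 ^ Q\<close>, where
  \<open>Q\<close> is the sum of the counts, and \<open>Q / R > 1\<close> supplies the decay in \<open>R\<close>. Bounding \<open>6 ^ Q\<close> by a sum of
  powers of single counts leaves only moments of one time.\<close>

lemma newton_product_error:
  fixes J :: "(nat \<times> 'b) list" and N :: "'b \<Rightarrow> nat"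
  assumes R: "R > 0"
  shows "\<bar>(\<Prod>(i, p)\<leftarrow>J. at_least i (N p)) - (\<Prod>(i, p)\<leftarrow>J. newton_poly (at_least i) R (N p))\<bar>
    \<le> 2 / real R * (\<Sum>(i, p)\<leftarrow>J. (6 ^ length J) ^ N p)"
proof -
  define Q where "Q = (\<Sum>(i, p)\<leftarrow>J. N p)"
  let ?e = "(\<Prod>(i, p)\<leftarrow>J. at_least i (N p))" and ?a = "(\<Prod>(i, p)\<leftarrow>J. newton_poly (at_least i) R (N p))"
  let ?s = "(\<Sum>(i, p)\<leftarrow>J. (6 ^ length J) ^ N p) :: real"
  have s0: "0 \<le> ?s" by (rule sum_list_nonneg) auto
  show ?thesis
  proof (cases "\<forall>(i, p)\<in>set J. N p \<le> R")
    case True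
    then have "?e = ?a"
      by (intro arg_cong[where f = prod_list] map_cong) (auto simp: newton_poly_exact)
    then show ?thesis using s0 by simp
  next
    case False
    then obtain i p where ip: "(i, p) \<in> set J" "N p > R" by auto
    have NQ: "N q \<le> Q" if "(j, q) \<in> set J" for j q
      unfolding Q_def by (rule member_le_sum_list) (use that in force)+
    have QR: "Q > R" using NQ[OF ip(1)] ip(2) by simp
    \<comment> \<open>some count exceeds \<open>R\<close>, so nothing better than the crude bounds holds, but \<open>Q / R > 1\<close>\<close>
    have "\<bar>?e\<bar> \<le> 1"
    proof (induction J)
      case (Cons z J)
      then show ?case using at_least_abs by (cases z) (auto simp: abs_mult intro!: mult_le_one)
    qed simp
    moreover have "\<bar>?a\<bar> \<le> 3 ^ Q"
      unfolding Q_def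
    proof (induction J)
      case (Cons z J)
      obtain j q where z: "z = (j, q)" by (cases z)
      have "\<bar>newton_poly (at_least j) R (N q)\<bar> \<le> 3 ^ N q" by (rule newton_poly_bound) (rule at_least_abs)
      then show ?case using Cons
        by (simp add: z abs_mult power_add mult_mono)
    qed simp
    moreover have "(1::real) \<le> 3 ^ Q" by simp
    ultimately have "\<bar>?e - ?a\<bar> \<le> 2 * 3 ^ Q" by linarith
    also have "\<dots> \<le> 2 * 3 ^ Q * (real Q / real R)"
      using QR R by (intro mult_le_cancel_left1[THEN iffD2]) (auto simp: field_simps)
    also have "\<dots> \<le> 2 * 3 ^ Q * (2 ^ Q / real R)"
      using of_nat_less_two_power[of Q, where ?'a = real] R
      by (intro mult_left_mono divide_right_mono) auto
    also have "\<dots> = 2 / real R * 6 ^ Q" by (simp flip: power_mult_distrib)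
    also have "\<dots> \<le> 2 / real R * ?s"
    proof (intro mult_left_mono)
      have "J \<noteq> []" using ip by auto
      \<comment> \<open>bound the sum of the counts by its largest term\<close>
      let ?m = "Max (set (map (\<lambda>(i, p). N p) J))"
      have "?m \<in> set (map (\<lambda>(i, p). N p) J)" using \<open>J \<noteq> []\<close> by (intro Max_in) auto
      then obtain j q where jq: "(j, q) \<in> set J" "N q = ?m" by auto
      have "Q \<le> length J * N q"
      proof -
        have "Q \<le> (\<Sum>(i, p)\<leftarrow>J. N q)"
          unfolding Q_def jq(2) by (rule sum_list_mono) (force intro!: Max_ge)
        also have "\<dots> = length J * N q" by (simp add: case_prod_unfold sum_list_triv)
        finally show ?thesis .
      qed
      then have "(6::real) ^ Q \<le> 6 ^ (length J * N q)" by (intro power_increasing) auto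
      also have "\<dots> = (6 ^ length J) ^ N q" by (simp add: power_mult)
      also have "\<dots> \<le> ?s"
      proof -
        have "(\<lambda>(i, p). (6 ^ length J) ^ N p :: real) (j, q) \<le> ?s"
          using jq(1) by (intro nonneg_le_sum_list) auto
        then show ?thesis by simp
      qed
      finally show "6 ^ Q \<le> ?s" .
    qed (use R in auto)
    finally show ?thesis .
  qed
qed

context airy_ensemble
begin

definition npts :: "ray_id \<Rightarrow> 'a \<Rightarrow> nat" where
  "npts p \<omega> = card (points \<omega> \<inter> ray p)"

lemma cnt_npts: "cnt p \<omega> = real (npts p \<omega>)"
  by (simp add: cnt_def npts_def)

lemma measurable_npts [measurable]: "npts p \<in> measurable M (count_space UNIV)"
proof -
  have "npts p = (\<lambda>\<omega>. nat \<lfloor>cnt p \<omega>\<rfloor>)" by (simp add: cnt_npts)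
  also have "\<dots> \<in> measurable M (count_space UNIV)" by measurable
  finally show ?thesis .
qed

text \<open>Linear combinations of tuple numbers, each carried along with the time shift \<open>T\<close>. The shift is an
  argument of the function because the coefficients of the linear combination must not depend on it.\<close>

inductive count_functional :: "(real \<Rightarrow> 'a \<Rightarrow> real) \<Rightarrow> bool" where
  mon: "count_functional (\<lambda>T. tuple_number (map (tshift T) D))"
| add: "count_functional F \<Longrightarrow> count_functional G \<Longrightarrow> count_functional (\<lambda>T \<omega>. F T \<omega> + G T \<omega>)"
| scale: "count_functional F \<Longrightarrow> count_functional (\<lambda>T \<omega>. c * F T \<omega>)"

lemma count_functional_zero: "count_functional (\<lambda>T \<omega>. 0)"
  using scale[OF mon[of "[]"], of 0] by simp

lemma count_functional_one: "count_functional (\<lambda>T \<omega>. 1)"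
  using mon[of "[]"] by (simp add: tuple_number_def[abs_def])

lemma count_functional_sum:
  assumes "finite A" "\<And>i. i \<in> A \<Longrightarrow> count_functional (F i)"
  shows "count_functional (\<lambda>T \<omega>. \<Sum>i\<in>A. F i T \<omega>)"
  using assms by (induction A) (auto intro: count_functional_zero add)

text \<open>This is the recursion of \<open>tuple_poly\<close> read backwards; whether two rays have the same time does not
  change under a common shift, so neither do the coefficients.\<close>

lemma count_functional_mult_cnt:
  assumes "count_functional F"
  shows "count_functional (\<lambda>T \<omega>. cnt (tshift T p) \<omega> * F T \<omega>)"
  using assms
proof induction
  case (mon D)
  let ?E = "\<lambda>i. D[i := meet p (D ! i)]"
  have "count_functional (\<lambda>T \<omega>. tuple_number (map (tshift T) (p # D)) \<omega> +
      (\<Sum>i<length D. if fst (D ! i) = fst p then tuple_number (map (tshift T) (?E i)) \<omega> else 0))"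
  proof (intro add count_functional.mon count_functional_sum)
    show "count_functional (\<lambda>T \<omega>. if fst (D ! i) = fst p then tuple_number (map (tshift T) (?E i)) \<omega> else 0)" for i
      using mon count_functional_zero by (cases "fst (D ! i) = fst p") (auto intro: count_functional.mon)
  qed simp
  also have "(\<lambda>T \<omega>. tuple_number (map (tshift T) (p # D)) \<omega> +
      (\<Sum>i<length D. if fst (D ! i) = fst p then tuple_number (map (tshift T) (?E i)) \<omega> else 0))
    = (\<lambda>T \<omega>. cnt (tshift T p) \<omega> * tuple_number (map (tshift T) D) \<omega>)"
  proof (intro ext)
    fix T \<omega>
    have "map (tshift T) (?E i) =
        (map (tshift T) D)[i := meet (tshift T p) (map (tshift T) D ! i)]"
      if "i < length D" for i
      using that by (simp add: map_update) (simp add: tshift_def meet_def)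
    then show "tuple_number (map (tshift T) (p # D)) \<omega> +
      (\<Sum>i<length D. if fst (D ! i) = fst p then tuple_number (map (tshift T) (?E i)) \<omega> else 0)
      = cnt (tshift T p) \<omega> * tuple_number (map (tshift T) D) \<omega>"
      by (simp add: tuple_number_def cong: if_cong sum.cong_simp)
  qed
  finally show ?case .
next
  case (add F G)
  then show ?case using count_functional.add[OF add.IH] by (simp add: distrib_left)
next
  case (scale F c)
  then show ?case using count_functional.scale[OF scale.IH, of c] by (simp add: mult.left_commute)
qed

lemma count_functional_mult_newton:
  assumes F: "count_functional F"
  shows "count_functional (\<lambda>T \<omega>. newton_poly g R (npts (tshift T p) \<omega>) * F T \<omega>)"
proof -
  have prod: "count_functional (\<lambda>T \<omega>. (\<Prod>i=0..<k. cnt (tshift T p) \<omega> - real i) * F T \<omega>)" for k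
  proof (induction k)
    case (Suc k)
    have "count_functional (\<lambda>T \<omega>. cnt (tshift T p) \<omega> * ((\<Prod>i=0..<k. cnt (tshift T p) \<omega> - real i) * F T \<omega>)
        + (- real k) * ((\<Prod>i=0..<k. cnt (tshift T p) \<omega> - real i) * F T \<omega>))"
      by (intro add scale count_functional_mult_cnt Suc)
    then show ?case by (simp add: algebra_simps)
  qed (use F in simp)
  have "count_functional (\<lambda>T \<omega>. \<Sum>k\<le>R. ((forward_diff ^^ k) g 0 / fact k) *
      ((\<Prod>i=0..<k. cnt (tshift T p) \<omega> - real i) * F T \<omega>))"
    by (intro count_functional_sum scale prod) auto
  also have "(\<lambda>T \<omega>. \<Sum>k\<le>R. ((forward_diff ^^ k) g 0 / fact k) *
      ((\<Prod>i=0..<k. cnt (tshift T p) \<omega> - real i) * F T \<omega>))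
    = (\<lambda>T \<omega>. newton_poly g R (npts (tshift T p) \<omega>) * F T \<omega>)"
    by (auto simp: newton_poly_def sum_distrib_right binomial_gbinomial gbinomial_prod_rev cnt_npts fun_eq_iff
        intro!: sum.cong)
  finally show ?thesis .
qed

text \<open>The indicator \<open>exceed\<close> below with each factor replaced by its interpolating polynomial.\<close>

definition approx :: "nat \<Rightarrow> (nat \<times> ray_id) list \<Rightarrow> real \<Rightarrow> 'a \<Rightarrow> real" where
  "approx R J T \<omega> = (\<Prod>(i, p)\<leftarrow>J. newton_poly (at_least i) R (npts (tshift T p) \<omega>))"

text \<open>By the ordering of the lines this is almost surely the indicator of the event that for each \<open>(i, (t, a))\<close>
  in the list line \<open>i\<close> lies above \<open>a\<close> at time \<open>t + T\<close>.\<close>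

definition exceed :: "(nat \<times> ray_id) list \<Rightarrow> real \<Rightarrow> 'a \<Rightarrow> real" where
  "exceed J T \<omega> = (\<Prod>(i, p)\<leftarrow>J. at_least i (npts (tshift T p) \<omega>))"

lemma count_functional_approx: "count_functional (approx R J)"
proof (induction J)
  case Nil
  then show ?case using count_functional_one by (simp add: approx_def[abs_def])
next
  case (Cons z J)
  then show ?case using count_functional_mult_newton[OF Cons, of "at_least (fst z)" R "snd z"]
    by (simp add: approx_def[abs_def] case_prod_beta)
qed

lemma
  assumes "count_functional F"
  shows integrable_count_functional: "integrable M (F T)"
    and expectation_count_functional: "expectation (F T) = expectation (F 0)"
proof -
  have "integrable M (F T) \<and> integrable M (F 0) \<and> expectation (F T) = expectation (F 0)"
    using assms
  proof induction
    case (mon D)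
    have "tshift 0 = id" by (auto simp: tshift_def)
    then show ?case
      by (simp add: integrable_tuple_number expectation_tuple_number ray_moment_tshift)
  qed auto
  then show "integrable M (F T)" "expectation (F T) = expectation (F 0)" by auto
qed

text \<open>Integrability for all large \<open>T\<close> is part of the notion, since the expectation of a sum splits only then.\<close>

definition expectation_tends :: "(real \<Rightarrow> 'a \<Rightarrow> real) \<Rightarrow> real \<Rightarrow> bool" where
  "expectation_tends X l \<longleftrightarrow> (\<forall>\<^sub>F T in at_top. integrable M (X T)) \<and> ((\<lambda>T. expectation (X T)) \<longlongrightarrow> l) at_top"

lemma expectation_tends_add:
  assumes "expectation_tends X l" "expectation_tends Y m"
  shows "expectation_tends (\<lambda>T \<omega>. X T \<omega> + Y T \<omega>) (l + m)"
proof -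
  have ev: "\<forall>\<^sub>F T in at_top. integrable M (X T) \<and> integrable M (Y T)"
    using assms by (auto simp: expectation_tends_def intro: eventually_conj)
  have "\<forall>\<^sub>F T in at_top. expectation (X T) + expectation (Y T) = expectation (\<lambda>\<omega>. X T \<omega> + Y T \<omega>)"
    using ev by eventually_elim simp
  moreover have "((\<lambda>T. expectation (X T) + expectation (Y T)) \<longlongrightarrow> l + m) at_top"
    using assms by (intro tendsto_add) (auto simp: expectation_tends_def)
  ultimately have "((\<lambda>T. expectation (\<lambda>\<omega>. X T \<omega> + Y T \<omega>)) \<longlongrightarrow> l + m) at_top"
    by (rule Lim_transform_eventually[rotated])
  moreover have "\<forall>\<^sub>F T in at_top. integrable M (\<lambda>\<omega>. X T \<omega> + Y T \<omega>)"
    using ev by eventually_elim simp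
  ultimately show ?thesis by (simp add: expectation_tends_def)
qed

lemma expectation_tends_scale:
  assumes "expectation_tends X l"
  shows "expectation_tends (\<lambda>T \<omega>. c * X T \<omega>) (c * l)"
  using assms by (auto simp: expectation_tends_def intro: tendsto_mult_left elim: eventually_mono)

text \<open>The claim is bilinear, so it reduces to single tuple numbers. For these, once the times of the two
  factors are disjoint the product is again a tuple number, and \<open>ray_moment_append_tendsto\<close> applies.\<close>

lemma count_functional_mixing:
  assumes "count_functional F" "count_functional G"
  shows "expectation_tends (\<lambda>T \<omega>. F 0 \<omega> * G T \<omega>) (expectation (F 0) * expectation (G 0))"
  using assms(1)
proof induction
  case (mon D)
  show ?case using assms(2)
  proof induction
    case (mon E)
    have id: "map (tshift 0) D = D" for D by (rule map_idI) (simp add: tshift_def)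
    let ?B = "\<Sum>p\<in>set D \<union> set E. \<bar>fst p\<bar>"
    have B: "\<bar>fst p\<bar> \<le> ?B" if "p \<in> set D \<union> set E" for p
      by (rule member_le_sum[of p "set D \<union> set E" "\<lambda>p. \<bar>fst p\<bar>"]) (use that in auto)
    have ev: "\<forall>\<^sub>F T in at_top. AE \<omega> in M.
        tuple_number (D @ map (tshift T) E) \<omega> = tuple_number D \<omega> * tuple_number (map (tshift T) E) \<omega>"
      using eventually_gt_at_top[of "2 * ?B"]
    proof eventually_elim
      case (elim T)
      show ?case
      proof (rule AE_tuple_number_append)
        fix p q assume p: "p \<in> set D" and "q \<in> set (map (tshift T) E)"
        then obtain r where r: "r \<in> set E" "q = tshift T r" by auto
        show "fst p \<noteq> fst q" using B[of p] B[of r] p r elim by auto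
      qed
    qed
    have int: "\<forall>\<^sub>F T in at_top. integrable M (\<lambda>\<omega>. tuple_number D \<omega> * tuple_number (map (tshift T) E) \<omega>)"
      using ev
    proof eventually_elim
      case (elim T)
      show ?case
        by (rule integrable_cong_AE_imp[OF integrable_tuple_number[of "D @ map (tshift T) E"] _ elim]) simp
    qed
    have "\<forall>\<^sub>F T in at_top. ray_moment (D @ map (tshift T) E)
        = expectation (\<lambda>\<omega>. tuple_number D \<omega> * tuple_number (map (tshift T) E) \<omega>)"
      using ev
    proof eventually_elim
      case (elim T)
      have "ray_moment (D @ map (tshift T) E) = expectation (tuple_number (D @ map (tshift T) E))"
        by (simp add: expectation_tuple_number)
      also have "\<dots> = expectation (\<lambda>\<omega>. tuple_number D \<omega> * tuple_number (map (tshift T) E) \<omega>)"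
        by (rule integral_cong_AE) (use elim in auto)
      finally show ?case .
    qed
    from Lim_transform_eventually[OF ray_moment_append_tendsto this] int
    show ?case by (simp add: expectation_tends_def id expectation_tuple_number)
  next
    case (add G H)
    then show ?case
      using expectation_tends_add[OF add.IH] integrable_count_functional[of G 0] integrable_count_functional[of H 0]
      by (simp add: distrib_left)
  next
    case (scale G c)
    then show ?case using expectation_tends_scale[OF scale.IH, of c] by (simp add: mult.left_commute[of _ c])
  qed
next
  case (add F H)
  then show ?case
    using expectation_tends_add[OF add.IH] integrable_count_functional[of F 0] integrable_count_functional[of H 0]
    by (simp add: distrib_right)
next
  case (scale F c)
  then show ?case using expectation_tends_scale[OF scale.IH, of c] by (simp add: mult.assoc)
qed

lemma tail_mass_nonneg: "0 \<le> tail_mass a"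
proof -
  have "0 \<le> expectation (tuple_number [(0, a)])"
    by (rule integral_nonneg_AE) (use AE_tuple_number_eq[of "[(0, a)]"] in \<open>auto elim: eventually_mono\<close>)
  also have "\<dots> \<le> tail_mass a"
    using ray_moment_replicate[of 1 "(0, a)"] by (simp add: expectation_tuple_number)
  finally show ?thesis .
qed

text \<open>Expand \<open>(1 + y) ^ N\<close> in binomial coefficients of \<open>N\<close>; their expectations are factorial moments divided
  by \<open>k!\<close>, which Hadamard's inequality bounds by \<open>tail_mass ^ k / k!\<close>.\<close>

lemma
  assumes y: "y \<ge> 0"
  shows integrable_exponential: "integrable M (\<lambda>\<omega>. (1 + y) ^ npts p \<omega>)"
    and expectation_exponential: "expectation (\<lambda>\<omega>. (1 + y) ^ npts p \<omega>) \<le> exp (y * tail_mass (snd p))"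
proof -
  let ?m = "tail_mass (snd p)"
  have bound: "(\<integral>\<^sup>+\<omega>. ennreal (real (npts p \<omega> choose k) * y ^ k) \<partial>M) \<le> ennreal ((y * ?m) ^ k / fact k)" for k
  proof -
    have "AE \<omega> in M. ennreal (real (npts p \<omega> choose k) * y ^ k) = ennreal (y ^ k / fact k * tuple_number (replicate k p) \<omega>)"
      using AE_tuple_number_eq[of "replicate k p"] AE_finite_points[of p]
    proof eventually_elim
      case (elim \<omega>)
      then show ?case using card_tuples_replicate[OF elim(2), of k] by (simp add: npts_def mult.commute)
    qed
    then have "(\<integral>\<^sup>+\<omega>. ennreal (real (npts p \<omega> choose k) * y ^ k) \<partial>M)
        = (\<integral>\<^sup>+\<omega>. ennreal (y ^ k / fact k * tuple_number (replicate k p) \<omega>) \<partial>M)"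
      by (rule nn_integral_cong_AE)
    also have "\<dots> = ennreal (expectation (\<lambda>\<omega>. y ^ k / fact k * tuple_number (replicate k p) \<omega>))"
    proof (rule nn_integral_eq_integral)
      show "integrable M (\<lambda>\<omega>. y ^ k / fact k * tuple_number (replicate k p) \<omega>)"
        using integrable_tuple_number by simp
      show "AE \<omega> in M. 0 \<le> y ^ k / fact k * tuple_number (replicate k p) \<omega>"
        using AE_tuple_number_eq[of "replicate k p"] by eventually_elim (use y in simp)
    qed
    also have "\<dots> \<le> ennreal (y ^ k / fact k * ?m ^ k)"
      using y by (intro ennreal_leI) (auto simp: expectation_tuple_number intro!: mult_left_mono divide_right_mono ray_moment_replicate)
    finally show ?thesis by (simp add: power_mult_distrib)
  qed
  have expand: "ennreal ((1 + y) ^ N) = (\<Sum>k. ennreal (real (N choose k) * y ^ k))" for N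
  proof -
    have "(1 + y) ^ N = (\<Sum>k\<le>N. real (N choose k) * y ^ k)"
      using binomial_ring[of y 1 N] by (simp add: add.commute)
    also have "ennreal \<dots> = (\<Sum>k\<le>N. ennreal (real (N choose k) * y ^ k))"
      using y by (subst sum_ennreal) auto
    also have "\<dots> = (\<Sum>k. ennreal (real (N choose k) * y ^ k))"
      by (rule suminf_finite[symmetric]) (auto simp: binomial_eq_0)
    finally show ?thesis .
  qed
  have "(\<integral>\<^sup>+\<omega>. ennreal ((1 + y) ^ npts p \<omega>) \<partial>M)
      = (\<Sum>k. \<integral>\<^sup>+\<omega>. ennreal (real (npts p \<omega> choose k) * y ^ k) \<partial>M)"
    unfolding expand by (rule nn_integral_suminf) measurable
  also have "\<dots> \<le> (\<Sum>k. ennreal ((y * ?m) ^ k / fact k))"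
    by (intro suminf_le bound) auto
  also have "\<dots> = ennreal (exp (y * ?m))"
  proof (rule suminf_ennreal_eq)
    show "0 \<le> (y * ?m) ^ k / fact k" for k using y tail_mass_nonneg[of "snd p"] by simp
    show "(\<lambda>k. (y * ?m) ^ k / fact k) sums exp (y * ?m)"
      using exp_converges[of "y * ?m"] by (simp add: scaleR_conv_of_real field_simps)
  qed
  finally have le: "(\<integral>\<^sup>+\<omega>. ennreal ((1 + y) ^ npts p \<omega>) \<partial>M) \<le> ennreal (exp (y * ?m))" .
  show int: "integrable M (\<lambda>\<omega>. (1 + y) ^ npts p \<omega>)"
    using le_less_trans[OF le ennreal_less_top] y by (intro integrableI_nonneg) auto
  have "ennreal (expectation (\<lambda>\<omega>. (1 + y) ^ npts p \<omega>)) \<le> ennreal (exp (y * ?m))"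
    using le nn_integral_eq_integral[OF int] y by simp
  then show "expectation (\<lambda>\<omega>. (1 + y) ^ npts p \<omega>) \<le> exp (y * ?m)" by simp
qed

definition error_const :: "(nat \<times> ray_id) list \<Rightarrow> real" where
  "error_const J = 2 * (\<Sum>(i, p)\<leftarrow>J. exp ((6 ^ length J - 1) * tail_mass (snd p)))"

lemma exceed_01: "exceed J T \<omega> = 0 \<or> exceed J T \<omega> = 1"
proof (induction J)
  case (Cons z J)
  have "exceed (z # J) T \<omega> = at_least (fst z) (npts (tshift T (snd z)) \<omega>) * exceed J T \<omega>"
    by (simp add: exceed_def case_prod_beta)
  then show ?case using Cons by (auto simp: at_least_def)
qed (simp add: exceed_def)

lemma borel_measurable_exceed [measurable]: "exceed J T \<in> borel_measurable M"
proof (induction J)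
  case (Cons z J)
  have "exceed (z # J) T = (\<lambda>\<omega>. at_least (fst z) (npts (tshift T (snd z)) \<omega>) * exceed J T \<omega>)"
    by (auto simp: exceed_def case_prod_beta)
  also have "\<dots> \<in> borel_measurable M" using Cons by measurable
  finally show ?case .
qed (simp add: exceed_def[abs_def])

lemma integrable_exceed: "integrable M (exceed J T)"
proof (rule integrable_const_bound[of _ 1])
  show "AE \<omega> in M. norm (exceed J T \<omega>) \<le> 1"
  proof (rule AE_I2)
    fix \<omega> show "norm (exceed J T \<omega>) \<le> 1" using exceed_01[of J T \<omega>] by auto
  qed
qed simp

lemma sum_list_expectation:
  assumes "\<And>z. z \<in> set J \<Longrightarrow> integrable M (f z)"
  shows "integrable M (\<lambda>\<omega>. \<Sum>z\<leftarrow>J. f z \<omega>) \<and> expectation (\<lambda>\<omega>. \<Sum>z\<leftarrow>J. f z \<omega>) = (\<Sum>z\<leftarrow>J. expectation (f z))"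
  using assms by (induction J) (auto simp: Bochner_Integration.integral_add)

text \<open>The right-hand side does not depend on \<open>T\<close>, since only moments of single times enter. Both the
  invariance and the mixing property of the events follow from this uniformity.\<close>

lemma exceed_approx_error:
  assumes "R > 0"
  shows "\<bar>expectation (exceed J T) - expectation (approx R J T)\<bar> \<le> error_const J / real R"
proof -
  let ?y = "6 ^ length J - 1 :: real"
  let ?f = "\<lambda>z \<omega>. (1 + ?y) ^ npts (tshift T (snd z)) \<omega>"
  have y: "?y \<ge> 0" by simp
  have int: "integrable M (?f z)" for z using integrable_exponential[OF y] by simp
  note S = sum_list_expectation[of J ?f, OF int]
  have ia: "integrable M (approx R J T)" by (rule integrable_count_functional[OF count_functional_approx])
  have "\<bar>expectation (exceed J T) - expectation (approx R J T)\<bar>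
      = \<bar>expectation (\<lambda>\<omega>. exceed J T \<omega> - approx R J T \<omega>)\<bar>"
    using integrable_exceed ia by simp
  also have "\<dots> \<le> expectation (\<lambda>\<omega>. \<bar>exceed J T \<omega> - approx R J T \<omega>\<bar>)"
    by (rule integral_abs_bound)
  also have "\<dots> \<le> expectation (\<lambda>\<omega>. 2 / real R * (\<Sum>z\<leftarrow>J. ?f z \<omega>))"
  proof (rule integral_mono)
    show "integrable M (\<lambda>\<omega>. \<bar>exceed J T \<omega> - approx R J T \<omega>\<bar>)"
      using integrable_exceed ia by simp
    show "integrable M (\<lambda>\<omega>. 2 / real R * (\<Sum>z\<leftarrow>J. ?f z \<omega>))" using S by simp
    show "\<bar>exceed J T \<omega> - approx R J T \<omega>\<bar> \<le> 2 / real R * (\<Sum>z\<leftarrow>J. ?f z \<omega>)" for \<omega>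
      using newton_product_error[OF assms, where J = J and N = "\<lambda>p. npts (tshift T p) \<omega>"]
      by (simp add: exceed_def approx_def case_prod_unfold)
  qed
  also have "\<dots> = 2 / real R * (\<Sum>z\<leftarrow>J. expectation (?f z))" using S by simp
  also have "\<dots> \<le> 2 / real R * (\<Sum>z\<leftarrow>J. exp (?y * tail_mass (snd (snd z))))"
    using expectation_exponential[OF y, of "tshift T (snd z)" for z]
    by (intro mult_left_mono sum_list_mono) auto
  finally show ?thesis by (simp add: error_const_def case_prod_unfold)
qed

lemma expectation_exceed_tendsto:
  "(\<lambda>R. expectation (approx (Suc R) J T)) \<longlonglongrightarrow> expectation (exceed J T)"
proof (rule Lim_null_comparison[of "\<lambda>R. expectation (approx (Suc R) J T) - expectation (exceed J T)", THEN Lim_null[THEN iffD2]])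
  show "\<forall>\<^sub>F R in sequentially. norm (expectation (approx (Suc R) J T) - expectation (exceed J T)) \<le> error_const J / real (Suc R)"
    using exceed_approx_error[of "Suc _" J T] by (intro always_eventually allI) (simp add: abs_minus_commute)
  show "(\<lambda>R. error_const J / real (Suc R)) \<longlonglongrightarrow> 0"
    by (rule LIMSEQ_Suc[OF lim_const_over_n])
qed

lemma exceed_stationary: "expectation (exceed J T) = expectation (exceed J 0)"
proof (rule LIMSEQ_unique)
  show "(\<lambda>R. expectation (approx (Suc R) J T)) \<longlonglongrightarrow> expectation (exceed J T)"
    by (rule expectation_exceed_tendsto)
  have "expectation (approx R J T) = expectation (approx R J 0)" for R
    by (rule expectation_count_functional[OF count_functional_approx])
  then show "(\<lambda>R. expectation (approx (Suc R) J T)) \<longlonglongrightarrow> expectation (exceed J 0)"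
    using expectation_exceed_tendsto[of J 0] by simp
qed

lemma exceed_append_shift:
  "exceed J 0 \<omega> * exceed K T \<omega> = exceed (J @ map (nshift T) K) 0 \<omega>"
  by (simp add: exceed_def nshift_def o_def case_prod_unfold tshift_def)

lemma approx_append_shift:
  "approx R J 0 \<omega> * approx R K T \<omega> = approx R (J @ map (nshift T) K) 0 \<omega>"
  by (simp add: approx_def nshift_def o_def case_prod_unfold tshift_def)

text \<open>Mixing of the polynomial approximations carries over because the approximation error, applied to
  the concatenated list, is small uniformly in the shift.\<close>

lemma exceed_mixing:
  "((\<lambda>T. expectation (\<lambda>\<omega>. exceed J 0 \<omega> * exceed K T \<omega>))
     \<longlongrightarrow> expectation (exceed J 0) * expectation (exceed K 0)) at_top"
proof (rule tendstoI)
  fix \<epsilon> :: real assume \<epsilon>: "\<epsilon> > 0"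
  let ?J = "\<lambda>T. J @ map (nshift T) K"
  \<comment> \<open>\<open>R\<close> is fixed before \<open>T\<close>, which is possible because the error constant does not depend on \<open>T\<close>\<close>
  define B where "B = error_const (?J 0)"
  have B: "error_const (?J T) = B" for T
    by (simp add: B_def error_const_def o_def case_prod_unfold nshift_def)
  let ?m = "\<lambda>R. expectation (approx R J 0) * expectation (approx R K 0)"
  have "(\<lambda>R. ?m (Suc R)) \<longlonglongrightarrow> expectation (exceed J 0) * expectation (exceed K 0)"
    by (intro tendsto_mult expectation_exceed_tendsto)
  then have "\<forall>\<^sub>F R in sequentially. dist (?m (Suc R)) (expectation (exceed J 0) * expectation (exceed K 0)) < \<epsilon> / 3"
    using \<epsilon> by (intro tendstoD) auto
  moreover have "(\<lambda>R. B / real (Suc R)) \<longlonglongrightarrow> 0"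
    by (rule LIMSEQ_Suc[OF lim_const_over_n])
  then have "\<forall>\<^sub>F R in sequentially. dist (B / real (Suc R)) 0 < \<epsilon> / 3"
    using \<epsilon> by (intro tendstoD) auto
  ultimately have "\<forall>\<^sub>F R in sequentially. dist (?m (Suc R)) (expectation (exceed J 0) * expectation (exceed K 0)) < \<epsilon> / 3
      \<and> dist (B / real (Suc R)) 0 < \<epsilon> / 3"
    by (rule eventually_conj)
  then obtain R where R: "dist (?m (Suc R)) (expectation (exceed J 0) * expectation (exceed K 0)) < \<epsilon> / 3"
    "dist (B / real (Suc R)) 0 < \<epsilon> / 3"
    using eventually_happens'[OF sequentially_bot] by blast
  have "((\<lambda>T. expectation (\<lambda>\<omega>. approx (Suc R) J 0 \<omega> * approx (Suc R) K T \<omega>)) \<longlongrightarrow> ?m (Suc R)) at_top"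
    using count_functional_mixing[OF count_functional_approx count_functional_approx]
    by (simp add: expectation_tends_def)
  then have "\<forall>\<^sub>F T in at_top. dist (expectation (\<lambda>\<omega>. approx (Suc R) J 0 \<omega> * approx (Suc R) K T \<omega>)) (?m (Suc R)) < \<epsilon> / 3"
    using \<epsilon> by (intro tendstoD) auto
  then show "\<forall>\<^sub>F T in at_top. dist (expectation (\<lambda>\<omega>. exceed J 0 \<omega> * exceed K T \<omega>))
      (expectation (exceed J 0) * expectation (exceed K 0)) < \<epsilon>"
  proof eventually_elim
    case (elim T)
    have "\<bar>expectation (exceed (?J T) 0) - expectation (approx (Suc R) (?J T) 0)\<bar> \<le> B / real (Suc R)"
      using exceed_approx_error[of "Suc R" "?J T" 0] B by simp
    then have "\<bar>expectation (\<lambda>\<omega>. exceed J 0 \<omega> * exceed K T \<omega>)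
        - expectation (\<lambda>\<omega>. approx (Suc R) J 0 \<omega> * approx (Suc R) K T \<omega>)\<bar> \<le> B / real (Suc R)"
      by (simp only: exceed_append_shift approx_append_shift)
    moreover have "\<bar>B / real (Suc R)\<bar> < \<epsilon> / 3" using R(2) by (simp only: dist_real_def diff_zero)
    ultimately show ?case using elim R(1) unfolding dist_real_def by linarith
  qed
qed

text \<open>As the lines are strictly ordered, distinct lines give distinct points and the lines above \<open>a\<close> at
  time \<open>t\<close> are the first \<open>npts (t, a)\<close> ones.\<close>

lemma AE_npts_iff:
  "AE \<omega> in M. \<forall>i\<ge>1. i \<le> npts (t, a) \<omega> \<longleftrightarrow> a < L \<omega> (i, t)"
proof -
  have "AE \<omega> in M. \<forall>t. \<forall>i\<ge>1. L \<omega> (i, t) > L \<omega> (i + 1, t)"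
    using airy by (simp add: airy_line_ensemble_def)
  then show ?thesis using AE_finite_points[of "(t, a)"]
  proof eventually_elim
    case (elim \<omega>)
    let ?l = "\<lambda>i. L \<omega> (i, t)"
    have step: "?l (i + Suc d) < ?l i" if "1 \<le> i" for i d
    proof (induction d)
      case 0
      then show ?case using elim(1) that by simp
    next
      case (Suc d)
      have "?l (i + Suc d + 1) < ?l (i + Suc d)" using elim(1) that by (meson le_add1 le_trans)
      then show ?case using Suc by simp
    qed
    have lt: "?l j < ?l i" if "1 \<le> i" "i < j" for i j
      using step[OF that(1), of "j - i - 1"] that(2) by simp
    have inj: "inj_on (\<lambda>i. (t, ?l i)) {1..}"
      by (rule inj_onI) (metis atLeast_iff lt less_irrefl linorder_neqE_nat prod.inject)
    define X where "X = {i. 1 \<le> i \<and> a < ?l i}"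
    have img: "points \<omega> \<inter> ray (t, a) = (\<lambda>i. (t, ?l i)) ` X"
      by (auto simp: points_def ray_def X_def)
    have injX: "inj_on (\<lambda>i. (t, ?l i)) X" by (rule inj_on_subset[OF inj]) (auto simp: X_def)
    have card: "npts (t, a) \<omega> = card X"
      unfolding npts_def img by (rule card_image[OF injX])
    have finX: "finite X" using elim(2) finite_imageD[OF _ injX] by (simp add: img)
    show ?case
    proof (intro allI impI)
      fix i :: nat assume i: "1 \<le> i"
      show "i \<le> npts (t, a) \<omega> \<longleftrightarrow> a < ?l i"
      proof
        assume a: "a < ?l i"
        have "{1..i} \<subseteq> X"
        proof
          fix j assume j: "j \<in> {1..i}"
          then have "?l i \<le> ?l j" using lt[of j i] by (cases "j = i") auto
          then show "j \<in> X" using a j by (auto simp: X_def)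
        qed
        from card_mono[OF finX this] show "i \<le> npts (t, a) \<omega>" by (simp add: card)
      next
        assume le: "i \<le> npts (t, a) \<omega>"
        show "a < ?l i"
        proof (rule ccontr)
          assume n: "\<not> a < ?l i"
          have "X \<subseteq> {1..<i}"
          proof
            fix j assume j: "j \<in> X"
            then have "\<not> i \<le> j" using lt[of i j] i n by (cases "i = j") (auto simp: X_def)
            then show "j \<in> {1..<i}" using j by (auto simp: X_def)
          qed
          from card_mono[OF _ this] show False using le i by (simp add: card)
        qed
      qed
    qed
  qed
qed

lemma AE_exceed_iff:
  assumes "line_indices J"
  shows "AE \<omega> in M. exceed J T \<omega> = (if \<forall>(i, t, a)\<in>set J. a < L \<omega> (i, t + T) then 1 else 0)"
proof -
  have "AE \<omega> in M. \<forall>(i, t, a)\<in>set J. i \<le> npts (t + T, a) \<omega> \<longleftrightarrow> a < L \<omega> (i, t + T)"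
  proof (subst AE_ball_countable)
    show "\<forall>z\<in>set J. AE \<omega> in M. case z of (i, t, a) \<Rightarrow> i \<le> npts (t + T, a) \<omega> \<longleftrightarrow> a < L \<omega> (i, t + T)"
    proof
      fix z assume z: "z \<in> set J"
      obtain i t a where zz: "z = (i, t, a)" by (cases z)
      have "1 \<le> i" using assms z zz by auto
      then show "AE \<omega> in M. case z of (i, t, a) \<Rightarrow> i \<le> npts (t + T, a) \<omega> \<longleftrightarrow> a < L \<omega> (i, t + T)"
        using AE_npts_iff[of "t + T" a] unfolding zz by (auto elim!: eventually_mono)
    qed
  qed (simp add: countable_finite)
  then show ?thesis
  proof eventually_elim
    case (elim \<omega>)
    have "exceed J T \<omega> = (if \<forall>(i, p)\<in>set J. i \<le> npts (tshift T p) \<omega> then 1 else 0)"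
      by (induction J) (auto simp: exceed_def at_least_def)
    also have "(\<forall>(i, p)\<in>set J. i \<le> npts (tshift T p) \<omega>) \<longleftrightarrow> (\<forall>(i, t, a)\<in>set J. a < L \<omega> (i, t + T))"
      using elim by (fastforce simp: tshift_def)
    finally show ?case .
  qed
qed

end

section \<open>The Borel sigma-algebra and the cylinder sets\<close>

text \<open>These sets are open, and by \<open>AE_exceed_iff\<close> they pull back to the exceedance events.\<close>

definition cylinder :: "(nat \<times> ray_id) list \<Rightarrow> (nat \<times> real \<Rightarrow> real) set" where
  "cylinder J = {f \<in> ensemble_carrier. \<forall>(i, t, a)\<in>set J. a < f (i, t)}"

definition cylinders :: "(nat \<times> real \<Rightarrow> real) set set" where
  "cylinders = {cylinder J | J. line_indices J}"

lemma cylinder_Nil [simp]: "cylinder [] = ensemble_carrier"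
  by (simp add: cylinder_def)

lemma cylinders_Pow: "cylinders \<subseteq> Pow ensemble_carrier"
  by (auto simp: cylinders_def cylinder_def)

lemma cylinder_append: "cylinder J \<inter> cylinder K = cylinder (J @ K)"
  unfolding cylinder_def set_append ball_Un by blast

lemma Int_stable_cylinders: "Int_stable cylinders"
proof (rule Int_stableI)
  fix X Y assume "X \<in> cylinders" "Y \<in> cylinders"
  then obtain J K where "X = cylinder J" "line_indices J" "Y = cylinder K" "line_indices K"
    by (auto simp: cylinders_def)
  then have "X \<inter> Y = cylinder (J @ K)" "line_indices (J @ K)"
    by (simp_all only: cylinder_append set_append ball_Un simp_thms)
  then show "X \<inter> Y \<in> cylinders" unfolding cylinders_def by blast
qed

lemma carrier_in_cylinders: "ensemble_carrier \<in> cylinders"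
  unfolding cylinders_def by (rule CollectI, rule exI[of _ "[]"]) simp

lemma openin_upper:
  assumes "1 \<le> i"
  shows "openin ensemble_topology {f \<in> ensemble_carrier. a < f (i, t)}"
proof (subst openin_subopen, intro ballI)
  fix f assume f: "f \<in> {f \<in> ensemble_carrier. a < f (i, t)}"
  let ?T = "{g \<in> ensemble_carrier. \<forall>p\<in>{(i, t)}. \<bar>g p - f p\<bar> < f (i, t) - a}"
  have "openin ensemble_topology ?T"
    unfolding ensemble_topology_def
    by (rule topology_generated_by_Basis,
        intro CollectI exI[of _ f] exI[of _ "{(i, t)}"] exI[of _ "f (i, t) - a"] conjI refl)
       (use f assms in auto)
  then show "\<exists>T. openin ensemble_topology T \<and> f \<in> T \<and> T \<subseteq> {f \<in> ensemble_carrier. a < f (i, t)}"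
    by (intro exI[of _ ?T]) (use f in auto)
qed

lemma cylinders_measurable: "cylinders \<subseteq> sets ensemble_borel"
proof
  fix X assume "X \<in> cylinders"
  then obtain J where J: "X = cylinder J" "line_indices J" by (auto simp: cylinders_def)
  have "cylinder J \<in> sets ensemble_borel" using J(2)
  proof (induction J)
    case Nil
    then show ?case using sets.top[of ensemble_borel] by simp
  next
    case (Cons z J)
    obtain i t a where z: "z = (i, t, a)" by (cases z)
    have "{f \<in> ensemble_carrier. a < f (i, t)} \<in> sets ensemble_borel"
      unfolding sets_ensemble_borel by (rule sigma_sets.Basic) (use Cons.prems z openin_upper in auto)
    moreover have "cylinder (z # J) = {f \<in> ensemble_carrier. a < f (i, t)} \<inter> cylinder J"
      by (auto simp: cylinder_def z)
    ultimately show ?case using Cons by auto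
  qed
  then show "X \<in> sets ensemble_borel" using J by simp
qed

text \<open>The radius is twice the tolerance of \<open>grid_cell\<close> below, so that any two members of one cell lie in each
  other's strip.\<close>

definition strip :: "nat \<Rightarrow> (nat \<times> real \<Rightarrow> real) \<Rightarrow> (nat \<times> real \<Rightarrow> real) set" where
  "strip n f = {g \<in> ensemble_carrier. \<forall>i\<in>{1..n}. \<forall>x\<in>{-real n<..<real n}.
     \<bar>g (i, x) - f (i, x)\<bar> \<le> 4 / real n}"

text \<open>If every strip neighbourhood of \<open>f\<close> left \<open>U\<close>, points outside \<open>U\<close> would converge to \<open>f\<close> uniformly on
  compact sets.\<close>

lemma open_contains_strip:
  assumes U: "openin ensemble_topology U" and f: "f \<in> U"
  shows "\<exists>n\<ge>1. strip n f \<subseteq> U"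
proof (rule ccontr)
  assume "\<not> ?thesis"
  then have "\<not> strip n f \<subseteq> U" if "1 \<le> n" for n using that by blast
  from this[of "Suc _"] have "\<forall>n. \<exists>g. g \<in> strip (Suc n) f \<and> g \<notin> U" by (simp add: subset_iff)
  from choice[OF this] obtain g where g': "\<forall>n. g n \<in> strip (Suc n) f \<and> g n \<notin> U" ..
  then have g: "g n \<in> strip (Suc n) f" "g n \<notin> U" for n by auto
  have fc: "f \<in> ensemble_carrier" using openin_subset[OF U] f by auto
  have "limitin ensemble_topology g f sequentially"
    unfolding limitin_ensemble_topology
  proof (intro conjI allI impI fc)
    have "g n \<in> ensemble_carrier" for n using g(1)[of n] by (simp add: strip_def)
    then show "\<forall>\<^sub>F n in sequentially. g n \<in> ensemble_carrier" by simp
    fix K :: "(nat \<times> real) set" assume K: "compact K \<and> K \<subseteq> index_space"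
    have "continuous_on K (\<lambda>p. real (fst p))" "continuous_on K (\<lambda>p. snd p)"
      by (auto intro!: continuous_intros continuous_on_of_nat)
    then have "bounded ((\<lambda>p. real (fst p)) ` K)" "bounded (snd ` K)"
      using K by (auto intro!: compact_imp_bounded compact_continuous_image)
    then obtain b1 b2 where b: "\<And>p. p \<in> K \<Longrightarrow> real (fst p) \<le> b1" "\<And>p. p \<in> K \<Longrightarrow> \<bar>snd p\<bar> \<le> b2"
      unfolding bounded_iff by (metis abs_of_nat imageI real_norm_def)
    show "uniform_limit K g f sequentially"
    proof (rule uniform_limitI)
      fix e :: real assume e: "e > 0"
      show "\<forall>\<^sub>F n in sequentially. \<forall>p\<in>K. dist (g n p) (f p) < e"
        using eventually_gt_at_top[of "nat \<lceil>max (4 / e) (max b1 b2)\<rceil>"]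
      proof eventually_elim
        case (elim n)
        then have n: "real (Suc n) > 4 / e" "real (Suc n) > b1" "real (Suc n) > b2" by linarith+
        show ?case
        proof
          fix p assume p: "p \<in> K"
          obtain i x where ix: "p = (i, x)" by (cases p)
          have "i \<in> {1..Suc n}" "x \<in> {-real (Suc n)<..<real (Suc n)}"
            using b[OF p] n K p by (auto simp: ix)
          then have "\<bar>g n (i, x) - f (i, x)\<bar> \<le> 4 / real (Suc n)" using g(1)[of n] unfolding strip_def by blast
          also have "\<dots> < e" using n(1) e by (simp add: field_simps)
          finally show "dist (g n p) (f p) < e" by (simp add: ix dist_real_def)
        qed
      qed
    qed
  qed
  then have "\<forall>\<^sub>F n in sequentially. g n \<in> U" using U f by (simp add: limitin_def)
  then show False using g(2) by simp
qed

text \<open>The paths that stay close to a step function with values in \<open>(1 / n) \<int>\<close> and steps of width \<open>1 / m\<close>.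
  Only rational arguments are tested, which keeps the set in the sigma-algebra of the cylinders;
  continuity recovers the others.\<close>

definition grid_cell :: "nat \<Rightarrow> nat \<Rightarrow> (nat \<times> int \<Rightarrow> int) \<Rightarrow> (nat \<times> real \<Rightarrow> real) set" where
  "grid_cell n m h = {f \<in> ensemble_carrier. \<forall>i\<in>{1..n}. \<forall>x\<in>\<rat> \<inter> {-real n<..<real n}.
     \<bar>f (i, x) - real_of_int (h (i, \<lfloor>real m * x\<rfloor>)) / real n\<bar> \<le> 2 / real n}"

lemma carrier_continuous:
  assumes "f \<in> ensemble_carrier" "1 \<le> i"
  shows "continuous_on A (\<lambda>x. f (i, x))"
proof -
  have "continuous_on A (f \<circ> (\<lambda>x. (i, x)))"
    using assms by (intro continuous_on_compose continuous_intros)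
      (auto simp: ensemble_carrier_def elim!: continuous_on_subset)
  then show ?thesis by (simp add: o_def)
qed

lemma grid_cell_close:
  assumes f: "f \<in> grid_cell n m h" and g: "g \<in> grid_cell n m h" and n: "1 \<le> n"
    and i: "i \<in> {1..n}" and x: "x \<in> {-real n<..<real n}"
  shows "\<bar>g (i, x) - f (i, x)\<bar> \<le> 4 / real n"
proof (rule ccontr)
  assume "\<not> ?thesis"
  then have gt: "4 / real n < \<bar>g (i, x) - f (i, x)\<bar>" by simp
  have "f \<in> ensemble_carrier" "g \<in> ensemble_carrier" using f g by (auto simp: grid_cell_def)
  then have "continuous_on UNIV (\<lambda>x. \<bar>g (i, x) - f (i, x)\<bar>)"
    using i by (intro continuous_intros carrier_continuous) auto
  then have "open ((\<lambda>x. \<bar>g (i, x) - f (i, x)\<bar>) -` {4 / real n<..})" by (intro open_vimage) auto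
  then have "open ((\<lambda>x. \<bar>g (i, x) - f (i, x)\<bar>) -` {4 / real n<..} \<inter> {-real n<..<real n})" by auto
  then obtain e where e: "e > 0" "\<And>y. dist y x < e \<Longrightarrow> 4 / real n < \<bar>g (i, y) - f (i, y)\<bar> \<and> y \<in> {-real n<..<real n}"
    using gt x unfolding open_dist by force
  obtain y where y: "y \<in> \<rat>" "x < y" "y < x + e" using Rats_dense_in_real[of x "x + e"] e(1) by auto
  then have "dist y x < e" by (simp add: dist_real_def)
  then have y2: "4 / real n < \<bar>g (i, y) - f (i, y)\<bar>" "y \<in> \<rat> \<inter> {-real n<..<real n}" using e(2) y(1) by auto
  let ?c = "real_of_int (h (i, \<lfloor>real m * y\<rfloor>)) / real n"
  have "\<bar>f (i, y) - ?c\<bar> \<le> 2 / real n" "\<bar>g (i, y) - ?c\<bar> \<le> 2 / real n"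
    using f g i y2(2) unfolding grid_cell_def by blast+
  moreover have "4 / real n = 2 / real n + 2 / real n" by simp
  ultimately show False using y2(1) by linarith
qed

text \<open>Uniform continuity on a compact interval: round the values at the grid points.\<close>

lemma grid_cell_exists:
  assumes f: "f \<in> ensemble_carrier" and n: "1 \<le> n"
  shows "\<exists>m h. h \<in> ({1..n} \<times> {-int (n * m)..int (n * m)}) \<rightarrow>\<^sub>E UNIV \<and> f \<in> grid_cell n m h"
proof -
  let ?K = "{-real n..real n}"
  have npos: "0 < 1 / real n" using n by simp
  have "\<exists>d>0. \<forall>x\<in>?K. \<forall>y\<in>?K. dist y x < d \<longrightarrow> dist (f (i, y)) (f (i, x)) < 1 / real n" if "i \<in> {1..n}" for i
  proof -
    have "uniformly_continuous_on ?K (\<lambda>x. f (i, x))"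
      using f that by (intro compact_uniformly_continuous carrier_continuous) auto
    then show ?thesis using npos unfolding uniformly_continuous_on_def by blast
  qed
  then have "\<forall>i\<in>{1..n}. \<exists>d>0. \<forall>x\<in>?K. \<forall>y\<in>?K. dist y x < d \<longrightarrow> dist (f (i, y)) (f (i, x)) < 1 / real n" by blast
  from bchoice[OF this] obtain di where di:
    "\<forall>i\<in>{1..n}. 0 < di i \<and> (\<forall>x\<in>?K. \<forall>y\<in>?K. dist y x < di i \<longrightarrow> dist (f (i, y)) (f (i, x)) < 1 / real n)" ..
  define d where "d = Min (di ` {1..n})"
  have d: "0 < d" unfolding d_def using n di by (subst Min_gr_iff) auto
  have d2: "dist (f (i, y)) (f (i, x)) < 1 / real n"
    if "i \<in> {1..n}" "x \<in> ?K" "y \<in> ?K" "dist y x < d" for i x y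
  proof -
    have "d \<le> di i" unfolding d_def using that(1) by (intro Min_le) auto
    then have "dist y x < di i" using that(4) by linarith
    then show ?thesis using di that(1-3) by blast
  qed
  obtain m where m: "1 / d < real m" using reals_Archimedean2 by blast
  have "0 < 1 / d" using d by simp
  then have mpos: "0 < real m" using m by linarith
  \<comment> \<open>round \<open>f\<close> down at the grid points; rounding and the oscillation on a step cost at most \<open>1 / n\<close> each\<close>
  define h where "h = (\<lambda>z\<in>{1..n} \<times> {-int (n * m)..int (n * m)}. \<lfloor>real n * f (fst z, real_of_int (snd z) / real m)\<rfloor>)"
  have "f \<in> grid_cell n m h"
    unfolding grid_cell_def
  proof (intro CollectI conjI ballI f)
    fix i x assume i: "i \<in> {1..n}" and x: "x \<in> \<rat> \<inter> {-real n<..<real n}"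
    let ?j = "\<lfloor>real m * x\<rfloor>"
    have jl: "real_of_int ?j \<le> real m * x" "real m * x < real_of_int ?j + 1" by linarith+
    have lo: "- (real n * real m) \<le> real m * x" "real m * x \<le> real n * real m"
      using x mpos mult_left_mono[of "- real n" x "real m"] mult_left_mono[of x "real n" "real m"]
      by (auto simp: mult.commute)
    have j: "?j \<in> {-int (n * m)..int (n * m)}"
    proof -
      have "- int (n * m) \<le> ?j" using lo(1) by (simp add: le_floor_iff)
      moreover have "real_of_int ?j \<le> real n * real m" using jl(1) lo(2) by linarith
      then have "?j \<le> int (n * m)" by (metis of_int_le_iff of_int_of_nat_eq of_nat_mult)
      ultimately show ?thesis by simp
    qed
    let ?y = "real_of_int ?j / real m"
    have y: "?y \<le> x" using jl mpos by (simp add: field_simps)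
    have "x < (real_of_int ?j + 1) / real m" using jl(2) mpos by (simp add: pos_less_divide_eq mult.commute)
    then have y': "x - ?y < 1 / real m" by (simp add: add_divide_distrib)
    have "- (real n * real m) \<le> real_of_int ?j" using j by (metis atLeastAtMost_iff of_int_le_iff of_int_minus of_int_of_nat_eq of_nat_mult)
    then have "- real n \<le> ?y" using mpos by (simp add: field_simps)
    then have yK: "?y \<in> ?K" "x \<in> ?K" using y x by auto
    have "1 / real m < d" using m d mpos by (simp add: field_simps)
    then have "dist x ?y < d" using y y' by (simp add: dist_real_def)
    then have "\<bar>f (i, x) - f (i, ?y)\<bar> < 1 / real n" using d2[OF i yK] by (simp add: dist_real_def)
    moreover have "\<bar>f (i, ?y) - real_of_int \<lfloor>real n * f (i, ?y)\<rfloor> / real n\<bar> \<le> 1 / real n"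
    proof -
      have "\<bar>real n * f (i, ?y) - real_of_int \<lfloor>real n * f (i, ?y)\<rfloor>\<bar> \<le> 1" by linarith
      then have "\<bar>(real n * f (i, ?y) - real_of_int \<lfloor>real n * f (i, ?y)\<rfloor>) / real n\<bar> \<le> 1 / real n"
        using n by (simp add: divide_right_mono)
      then show ?thesis using n by (simp add: diff_divide_distrib)
    qed
    moreover have "h (i, ?j) = \<lfloor>real n * f (i, ?y)\<rfloor>" using i j by (simp add: h_def)
    moreover have "2 / real n = 1 / real n + 1 / real n" by simp
    ultimately show "\<bar>f (i, x) - real_of_int (h (i, ?j)) / real n\<bar> \<le> 2 / real n" by (simp only:)
  qed
  moreover have "h \<in> ({1..n} \<times> {-int (n * m)..int (n * m)}) \<rightarrow>\<^sub>E UNIV" by (simp add: h_def)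
  ultimately show ?thesis by blast
qed

lemma grid_cell_measurable: "grid_cell n m h \<in> sigma_sets ensemble_carrier cylinders"
proof -
  define N where "N = sigma ensemble_carrier cylinders"
  have N: "space N = ensemble_carrier" "sets N = sigma_sets ensemble_carrier cylinders"
    unfolding N_def using cylinders_Pow by (auto simp: space_measure_of sets_measure_of)
  have ev: "(\<lambda>f. f (i, t)) \<in> borel_measurable N" if "1 \<le> i" for i t
    unfolding borel_measurable_iff_greater
  proof
    fix a
    have "cylinder [(i, t, a)] \<in> cylinders" unfolding cylinders_def using that by (intro CollectI exI[of _ "[(i, t, a)]"]) auto
    then have "cylinder [(i, t, a)] \<in> sets N" unfolding N by (rule sigma_sets.Basic)
    then show "{f \<in> space N. a < f (i, t)} \<in> sets N" by (simp add: cylinder_def N)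
  qed
  have "{f \<in> space N. \<forall>i\<in>{1..n}. \<forall>x\<in>\<rat> \<inter> {-real n<..<real n}.
     \<bar>f (i, x) - real_of_int (h (i, \<lfloor>real m * x\<rfloor>)) / real n\<bar> \<le> 2 / real n} \<in> sets N"
  proof (intro sets.sets_Collect_countable_All')
    fix i x assume "i \<in> {1..n}"
    then have [measurable]: "(\<lambda>f. f (i, x)) \<in> borel_measurable N" by (intro ev) auto
    show "{f \<in> space N. \<bar>f (i, x) - real_of_int (h (i, \<lfloor>real m * x\<rfloor>)) / real n\<bar> \<le> 2 / real n} \<in> sets N"
      by measurable
  qed (auto intro: countable_subset[OF _ countable_rat])
  then show ?thesis by (simp add: grid_cell_def N)
qed

text \<open>An open set is the union of the grid cells that it contains, and there are only countably many grid
  cells.\<close>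

lemma sets_ensemble_borel_cylinders: "sets ensemble_borel = sigma_sets ensemble_carrier cylinders"
proof
  show "sigma_sets ensemble_carrier cylinders \<subseteq> sets ensemble_borel"
    using sets.sigma_sets_subset[OF cylinders_measurable] by simp
  interpret S: sigma_algebra ensemble_carrier "sigma_sets ensemble_carrier cylinders"
    by (rule sigma_algebra_sigma_sets[OF cylinders_Pow])
  have "U \<in> sigma_sets ensemble_carrier cylinders" if U: "openin ensemble_topology U" for U
  proof -
    let ?I = "{(n, m, h). 1 \<le> n \<and> h \<in> ({1..n} \<times> {-int (n * m)..int (n * m)}) \<rightarrow>\<^sub>E UNIV \<and> grid_cell n m h \<subseteq> U}"
    have "?I \<subseteq> (SIGMA n:UNIV. SIGMA m:UNIV. ({1..n} \<times> {-int (n * m)..int (n * m)}) \<rightarrow>\<^sub>E UNIV)" by auto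
    moreover have "countable (SIGMA n:UNIV. SIGMA m:UNIV. ({1..n} \<times> {-int (n * m)..int (n * m)}) \<rightarrow>\<^sub>E (UNIV :: int set))"
      by (intro countable_SIGMA countable_PiE) auto
    ultimately have cI: "countable ?I" by (rule countable_subset)
    have "U = (\<Union>(n, m, h)\<in>?I. grid_cell n m h)"
    proof (intro equalityI subsetI)
      fix f assume f: "f \<in> U"
      have fc: "f \<in> ensemble_carrier" using openin_subset[OF U] f by auto
      obtain n where n: "n \<ge> 1" "strip n f \<subseteq> U"
        using open_contains_strip[OF U f] by blast
      obtain m h where mh: "h \<in> ({1..n} \<times> {-int (n * m)..int (n * m)}) \<rightarrow>\<^sub>E UNIV" "f \<in> grid_cell n m h"
        using grid_cell_exists[OF fc n(1)] by blast
      have "grid_cell n m h \<subseteq> U"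
      proof
        fix g assume g: "g \<in> grid_cell n m h"
        then have "g \<in> ensemble_carrier" by (simp add: grid_cell_def)
        then show "g \<in> U" using n(2) grid_cell_close[OF mh(2) g n(1)] unfolding strip_def by blast
      qed
      then show "f \<in> (\<Union>(n, m, h)\<in>?I. grid_cell n m h)"
        using mh n(1) by (intro UN_I[of "(n, m, h)"]) auto
    qed auto
    also have "\<dots> \<in> sigma_sets ensemble_carrier cylinders"
      using cI by (intro S.countable_UN' ) (auto intro: grid_cell_measurable)
    finally show ?thesis .
  qed
  then show "sets ensemble_borel \<subseteq> sigma_sets ensemble_carrier cylinders"
    unfolding sets_ensemble_borel by (intro S.sigma_sets_subset) auto
qed

section \<open>Mixing and ergodicity\<close>

abbreviation shift_event :: "real \<Rightarrow> (nat \<times> real \<Rightarrow> real) set \<Rightarrow> (nat \<times> real \<Rightarrow> real) set" where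
  "shift_event T F \<equiv> hshift T -` F \<inter> ensemble_carrier"

lemma cylinder_Int_carrier: "cylinder J \<inter> ensemble_carrier = cylinder J"
  by (auto simp: cylinder_def)

lemma hshift_vimage_carrier: "shift_event T ensemble_carrier = ensemble_carrier"
  by (auto simp: hshift_in_carrier)

lemma hshift_vimage_cylinder: "shift_event T (cylinder J) = cylinder (map (nshift T) J)"
proof -
  have "(\<forall>(i, t, a)\<in>set J. a < hshift T f (i, t)) \<longleftrightarrow> (\<forall>(i, t, a)\<in>set (map (nshift T) J). a < f (i, t))" for f
    by (auto simp: hshift_def nshift_def tshift_def)
  then show ?thesis by (auto simp: cylinder_def hshift_in_carrier)
qed

lemma measurable_hshift [measurable]: "hshift T \<in> measurable ensemble_borel ensemble_borel"
proof (rule measurable_sigma_sets[OF sets_ensemble_borel_cylinders cylinders_Pow])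
  show "hshift T \<in> space ensemble_borel \<rightarrow> ensemble_carrier" by (auto intro: hshift_in_carrier)
  fix X assume "X \<in> cylinders"
  then obtain J where J: "X = cylinder J" "line_indices J" by (auto simp: cylinders_def)
  have "cylinder (map (nshift T) J) \<in> cylinders"
    unfolding cylinders_def using J(2)
    by (intro CollectI exI[of _ "map (nshift T) J"]) (auto simp: nshift_def)
  then show "hshift T -` X \<inter> space ensemble_borel \<in> sets ensemble_borel"
    using cylinders_measurable hshift_vimage_cylinder[of T J] by (auto simp: J)
qed

context airy_ensemble
begin

abbreviation law :: "(nat \<times> real \<Rightarrow> real) measure" where
  "law \<equiv> distr M ensemble_borel L"

lemma measurable_L [measurable]: "L \<in> measurable M ensemble_borel"
  using airy by (simp add: airy_line_ensemble_def line_ensemble_def)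

sublocale law: prob_space law
  by (rule prob_space_distr) simp

lemma law_cylinder:
  assumes "line_indices J" "line_indices K"
  shows "measure law (cylinder J \<inter> (shift_event T (cylinder K)))
    = expectation (\<lambda>\<omega>. exceed J 0 \<omega> * exceed K T \<omega>)"
proof -
  let ?X = "cylinder J \<inter> (shift_event T (cylinder K))"
  have "cylinder J \<in> sets ensemble_borel" "cylinder K \<in> sets ensemble_borel"
    using cylinders_measurable assms by (auto simp: cylinders_def)
  then have X: "?X \<in> sets ensemble_borel"
    using measurable_sets[OF measurable_hshift, of "cylinder K" T] by auto
  have "measure law ?X = measure M (L -` ?X \<inter> space M)"
    using X by (simp add: measure_distr)
  also have "\<dots> = expectation (indicator (L -` ?X \<inter> space M))" by simp
  also have "\<dots> = expectation (\<lambda>\<omega>. exceed J 0 \<omega> * exceed K T \<omega>)"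
  proof (rule integral_cong_AE)
    show "AE \<omega> in M. indicator (L -` ?X \<inter> space M) \<omega> = exceed J 0 \<omega> * exceed K T \<omega>"
      using AE_exceed_iff[OF assms(1), of 0] AE_exceed_iff[OF assms(2), of T] AE_space
    proof eventually_elim
      case (elim \<omega>)
      have c: "L \<omega> \<in> ensemble_carrier" using measurable_space[OF measurable_L elim(3)] by simp
      have "L \<omega> \<in> ?X \<longleftrightarrow> (\<forall>(i, t, a)\<in>set J. a < L \<omega> (i, t + 0)) \<and> (\<forall>(i, t, a)\<in>set K. a < L \<omega> (i, t + T))"
      proof -
        have "hshift T (L \<omega>) \<in> ensemble_carrier" by (rule hshift_in_carrier[OF c])
        then show ?thesis using c by (auto simp: cylinder_def) (auto simp: hshift_def)
      qed
      then show ?case using elim by (simp add: indicator_def)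
    qed
  qed (use X in measurable)
  finally show ?thesis .
qed

text \<open>Both laws agree on the cylinders, which are closed under intersection and generate.\<close>

lemma law_invariant: "distr law ensemble_borel (hshift T) = law"
proof (rule measure_eqI_generator_eq[OF Int_stable_cylinders cylinders_Pow, where A = "\<lambda>_. ensemble_carrier"])
  fix X assume "X \<in> cylinders"
  then obtain J where J: "X = cylinder J" "line_indices J" by (auto simp: cylinders_def)
  have X: "X \<in> sets ensemble_borel" using cylinders_measurable \<open>X \<in> cylinders\<close> by blast
  have e: "exceed [] 0 = (\<lambda>\<omega>. 1)" by (simp add: exceed_def[abs_def])
  have "measure (distr law ensemble_borel (hshift T)) X = measure law (shift_event T X)"
    using X by (subst measure_distr) auto
  also have "\<dots> = expectation (exceed J T)"
  proof -
    have "cylinder [] \<inter> (shift_event T X) = shift_event T X" by auto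
    then show ?thesis using law_cylinder[of "[]" J T] J by (simp add: e)
  qed
  also have "\<dots> = expectation (exceed J 0)" by (rule exceed_stationary)
  also have "\<dots> = measure law X"
    using law_cylinder[of J "[]" 0] J by (simp add: e hshift_vimage_carrier cylinder_Int_carrier)
  finally have eq: "measure (distr law ensemble_borel (hshift T)) X = measure law X" .
  interpret D: prob_space "distr law ensemble_borel (hshift T)"
    by (rule law.prob_space_distr) simp
  show "emeasure (distr law ensemble_borel (hshift T)) X = emeasure law X"
    by (simp add: D.emeasure_eq_measure law.emeasure_eq_measure eq)
next
  interpret D: prob_space "distr law ensemble_borel (hshift T)"
    by (rule law.prob_space_distr) simp
  show "emeasure (distr law ensemble_borel (hshift T)) ensemble_carrier \<noteq> \<infinity>" by simp
qed (use carrier_in_cylinders sets_ensemble_borel_cylinders in auto)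

lemma measure_hshift:
  assumes "F \<in> sets ensemble_borel"
  shows "measure law (shift_event T F) = measure law F"
proof -
  have "measure (distr law ensemble_borel (hshift T)) F = measure law (shift_event T F)"
    using assms by (subst measure_distr) auto
  then show ?thesis by (simp add: law_invariant)
qed

text \<open>Dynkin's argument in the second event. For countable disjoint unions the limit passes through the
  series by Tannery's theorem, because by invariance the measures of the single pieces are a summable bound
  that does not depend on the shift.\<close>

lemma law_mixing_cylinder:
  assumes J: "line_indices J" and F: "F \<in> sets ensemble_borel"
  shows "((\<lambda>T. measure law (cylinder J \<inter> (shift_event T F)))
    \<longlongrightarrow> measure law (cylinder J) * measure law F) at_top"
proof -
  have C: "cylinder J \<in> sets ensemble_borel" using cylinders_measurable J by (auto simp: cylinders_def)
  have pre: "shift_event T F \<in> sets ensemble_borel" if "F \<in> sets ensemble_borel" for T F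
    using measurable_sets[OF measurable_hshift that, of T] by simp
  have "F \<in> sigma_sets ensemble_carrier cylinders" using F sets_ensemble_borel_cylinders by simp
  with Int_stable_cylinders cylinders_Pow show ?thesis
  proof (induction rule: sigma_sets_induct_disjoint)
    case (basic X)
    then obtain K where K: "X = cylinder K" "line_indices K" by (auto simp: cylinders_def)
    have e: "exceed [] T = (\<lambda>\<omega>. 1)" for T by (simp add: exceed_def[abs_def])
    have m: "measure law (cylinder K) = expectation (exceed K 0)" if "line_indices K" for K
      using law_cylinder[of K "[]" 0] that by (simp add: e hshift_vimage_carrier cylinder_Int_carrier)
    show ?case
      unfolding K(1) law_cylinder[OF J K(2)] m[OF J] m[OF K(2)] by (rule exceed_mixing)
  next
    case empty
    then show ?case by simp
  next
    case (compl A)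
    have A: "A \<in> sets ensemble_borel" using compl.hyps sets_ensemble_borel_cylinders by simp
    have "measure law (cylinder J \<inter> (shift_event T (ensemble_carrier - A)))
        = measure law (cylinder J) - measure law (cylinder J \<inter> (shift_event T A))" for T
    proof -
      have "cylinder J \<inter> (shift_event T (ensemble_carrier - A))
          = cylinder J - (cylinder J \<inter> (shift_event T A))"
        by (auto simp: cylinder_def hshift_in_carrier)
      then show ?thesis using C pre[OF A, of T] by (simp add: law.finite_measure_Diff')
    qed
    moreover have "measure law (ensemble_carrier - A) = 1 - measure law A"
      using law.prob_compl[of A] A by simp
    ultimately show ?case
      using tendsto_diff[OF tendsto_const compl.IH, of "measure law (cylinder J)"]
      by (simp add: right_diff_distrib)
  next
    case (union A)
    have A: "A i \<in> sets ensemble_borel" for i using union.hyps(2) sets_ensemble_borel_cylinders by auto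
    have sums: "measure law (cylinder J \<inter> (shift_event T (\<Union>i. A i)))
        = (\<Sum>i. measure law (cylinder J \<inter> (shift_event T (A i))))" for T
    proof -
      have "(\<lambda>i. measure law (cylinder J \<inter> (shift_event T (A i)))) sums
          measure law (\<Union>i. cylinder J \<inter> (shift_event T (A i)))"
      proof (rule law.finite_measure_UNION)
        show "range (\<lambda>i. cylinder J \<inter> (shift_event T (A i))) \<subseteq> sets law"
          using C pre[OF A] by auto
        show "disjoint_family (\<lambda>i. cylinder J \<inter> (shift_event T (A i)))"
          using union.hyps(1) unfolding disjoint_family_on_def by blast
      qed
      moreover have "(\<Union>i. cylinder J \<inter> (shift_event T (A i)))
          = cylinder J \<inter> (shift_event T (\<Union>i. A i))" by auto
      ultimately show ?thesis by (simp add: sums_iff)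
    qed
    have sA: "(\<lambda>i. measure law (A i)) sums measure law (\<Union>i. A i)"
      using A union.hyps(1) by (intro law.finite_measure_UNION) auto
    have "((\<lambda>T. \<Sum>i. measure law (cylinder J \<inter> (shift_event T (A i))))
        \<longlongrightarrow> (\<Sum>i. measure law (cylinder J) * measure law (A i))) at_top"
    proof (rule tannerys_theorem[THEN conjunct2, THEN conjunct2])
      show "((\<lambda>T. measure law (cylinder J \<inter> (shift_event T (A i))))
          \<longlongrightarrow> measure law (cylinder J) * measure law (A i)) at_top" for i by (rule union.IH)
      show "\<forall>\<^sub>F (i, T) in at_top \<times>\<^sub>F at_top. norm (measure law (cylinder J \<inter> (shift_event T (A i)))) \<le> measure law (A i)"
      proof (intro always_eventually allI, clarify)
        fix i T
        have "measure law (cylinder J \<inter> (shift_event T (A i))) \<le> measure law (shift_event T (A i))"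
          by (rule law.finite_measure_mono) (use pre[OF A] in auto)
        then show "norm (measure law (cylinder J \<inter> (shift_event T (A i)))) \<le> measure law (A i)"
          using measure_hshift[OF A, of T] by simp
      qed
      show "summable (\<lambda>i. measure law (A i))" using sA by (rule sums_summable)
    qed simp
    moreover have "(\<Sum>i. measure law (cylinder J) * measure law (A i)) = measure law (cylinder J) * measure law (\<Union>i. A i)"
      using sums_mult[OF sA] by (simp add: sums_iff)
    ultimately show ?case by (simp add: sums)
  qed
qed

text \<open>For a shift-invariant event the mixing limit is a limit of a constant, so the event is independent of
  each cylinder, and by Dynkin's argument of every event.\<close>

lemma invariant_independent:
  assumes A: "A \<in> sets ensemble_borel" and inv: "\<And>s. hshift s ` A = A" and E: "E \<in> sets ensemble_borel"
  shows "measure law (E \<inter> A) = measure law E * measure law A"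
proof -
  have Ac: "A \<subseteq> ensemble_carrier" using sets.sets_into_space[OF A] by simp
  have pre: "shift_event T A = A" for T
  proof
    show "A \<subseteq> shift_event T A" using Ac inv[of T] by auto
    show "shift_event T A \<subseteq> A"
    proof
      fix f assume "f \<in> shift_event T A"
      then have "hshift (- T) (hshift T f) \<in> hshift (- T) ` A" by auto
      moreover have "hshift (- T) (hshift T f) = f" by (auto simp: hshift_def fun_eq_iff)
      ultimately show "f \<in> A" using inv[of "- T"] by simp
    qed
  qed
  have "E \<in> sigma_sets ensemble_carrier cylinders" using E sets_ensemble_borel_cylinders by simp
  with Int_stable_cylinders cylinders_Pow show ?thesis
  proof (induction rule: sigma_sets_induct_disjoint)
    case (basic X)
    then obtain J where J: "X = cylinder J" "line_indices J" by (auto simp: cylinders_def)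
    have "((\<lambda>T::real. measure law (cylinder J \<inter> A)) \<longlongrightarrow> measure law (cylinder J) * measure law A) at_top"
      using law_mixing_cylinder[OF J(2) A] by (simp add: pre)
    then show ?case unfolding J(1) by (rule tendsto_const_iff[THEN iffD1, rotated]) simp
  next
    case empty
    then show ?case by simp
  next
    case (compl B)
    have B: "B \<in> sets ensemble_borel" using compl.hyps sets_ensemble_borel_cylinders by simp
    have "(ensemble_carrier - B) \<inter> A = A - B \<inter> A" using Ac by auto
    then have "measure law ((ensemble_carrier - B) \<inter> A) = measure law A - measure law (B \<inter> A)"
      using A B by (simp add: law.finite_measure_Diff)
    moreover have "measure law (ensemble_carrier - B) = 1 - measure law B"
      using law.prob_compl[of B] B by simp
    ultimately show ?case using compl.IH by (simp add: left_diff_distrib)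
  next
    case (union B)
    have B: "B i \<in> sets ensemble_borel" for i using union.hyps(2) sets_ensemble_borel_cylinders by auto
    have "(\<lambda>i. measure law (B i \<inter> A)) sums measure law (\<Union>i. B i \<inter> A)"
    proof (rule law.finite_measure_UNION)
      show "disjoint_family (\<lambda>i. B i \<inter> A)" using union.hyps(1) unfolding disjoint_family_on_def by blast
    qed (use A B in auto)
    moreover have "(\<lambda>i. measure law (B i) * measure law A) sums (measure law (\<Union>i. B i) * measure law A)"
      using B union.hyps(1) by (intro sums_mult2 law.finite_measure_UNION) auto
    moreover have "(\<Union>i. B i \<inter> A) = (\<Union>i. B i) \<inter> A" by auto
    ultimately show ?case using sums_unique2 union.IH by force
  qed
qed

end

theorem theorem1p6:
  fixes M :: "'a measure" and L :: "'a \<Rightarrow> nat \<times> real \<Rightarrow> real"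
  assumes "airy_line_ensemble M L"
  shows "\<forall>A \<in> sets ensemble_borel. (\<forall>s::real. hshift s ` A = A) \<longrightarrow>
           measure (distr M ensemble_borel L) A \<in> {0, 1}"
proof (intro ballI impI)
  interpret airy_ensemble M L by standard (rule assms)
  fix A assume A: "A \<in> sets ensemble_borel" and inv: "\<forall>s::real. hshift s ` A = A"
  have "measure law A = measure law A * measure law A"
    using invariant_independent[OF A _ A] inv by simp
  then show "measure (distr M ensemble_borel L) A \<in> {0, 1}" by auto
qed

end
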